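(* Suppose that $\Omega\subset\mathbb{R}^n$ is a domain with Lipschitz boundary. If $1<p<\infty$ and $f\in B^{s,p}(\Omega)$ for $1+\frac{1}{p}>s>\frac{1}{p}$, then for $0\le\alpha<s-\frac{1}{p}$, for $1\le q\le p$, and for a.e. $y\in\partial\Omega$ there is a constant $C$, depending on $y$, such that $$\Big(\frac{1}{r^n}\int_{B_r(y)\cap\Omega}|f(x)-f(y)|^q\,dx\Big)^{\frac{1}{q}}\le C r^\alpha\quad\text{for all } 0<r\le1.$$
   Context: $B_r(y)$ is the ball of radius $r$ centered at $y$. "a.e." on $\partial\Omega$ is with respect to surface measure. For dyadic $\lambda=2^k\ge1$, let $(P_\lambda f)^\wedge=m_\lambda\widehat f$ be Littlewood–Paley projections with $\sum_{\lambda\ge1}P_\lambda f=f$, where $m_\lambda(\xi)=m(\xi/\lambda)$ with $m$ a smooth multiplier supported in $|\xi|\sim1$, except that for $\lambda=1$ one takes a smooth $m_1$ supported in $|\xi|\lesssim1$. For $1<p<\infty$, $B^{s,p}(\mathbb{R}^n)$ is the Besov space of distributions $f$ with $\|f\|_{B^{s,p}}^p:=\|P_1f\|_p^p+\sum_{\lambda\ge1}\lambda^{sp}\|P_\lambda f\|_p^p<\infty$. $B^{s,p}(\Omega)$ consists of the restrictions to $\Omega$ of functions in $B^{s,p}(\mathbb{R}^n)$. The value $f(y)$ at $y\in\partial\Omega$ (a.e.) is the trace value: $f(y)=g(y)$, where $g\in B^{s,p}(\mathbb{R}^n)$ is an extension of $f$ and the representative of $g$ is $g(y)=\lim_{M\to\infty}\sum_{1\le\lambda\le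 M}P_\lambda g(y)$. *)

theory Defs
  imports "HOL-Analysis.Analysis"
begin

definition partial :: "'n \<Rightarrow> (real^'n \<Rightarrow> complex) \<Rightarrow> (real^'n \<Rightarrow> complex)" where
  "partial i f x = frechet_derivative f (at x) (axis i 1)"

primrec iter_partial :: "'n list \<Rightarrow> (real^'n \<Rightarrow> complex) \<Rightarrow> (real^'n \<Rightarrow> complex)" where
  "iter_partial [] f = f"
| "iter_partial (i # js) f = partial i (iter_partial js f)"

definition smooth :: "(real^'n \<Rightarrow> complex) \<Rightarrow> bool" where
  "smooth f \<longleftrightarrow> (\<forall>js x. iter_partial js f differentiable (at x))"

definition schwartz :: "(real^'n \<Rightarrow> complex) set" where
  "schwartz = {f. smooth f \<and>
     (\<forall>N js. bounded (range (\<lambda>x. (1 + norm x) ^ N *\<^sub>R iter_partial js f x)))}"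

definition schwartz_norm :: "nat \<Rightarrow> (real^'n \<Rightarrow> complex) \<Rightarrow> real" where
  "schwartz_norm N f =
     (SUP (x, js) \<in> UNIV \<times> {js. length js \<le> N}. (1 + norm x) ^ N * norm (iter_partial js f x))"

text \<open>A distribution is encoded as a functional on all functions; only its values on Schwartz
  functions are ever relevant.\<close>

type_synonym 'n dist = "(real^'n \<Rightarrow> complex) \<Rightarrow> complex"

definition tempered :: "'n::finite dist \<Rightarrow> bool" where
  "tempered u \<longleftrightarrow>
     (\<forall>f\<in>schwartz. \<forall>g\<in>schwartz. u (\<lambda>x. f x + g x) = u f + u g) \<and>
     (\<forall>c. \<forall>f\<in>schwartz. u (\<lambda>x. c * f x) = c * u f) \<and>
     (\<exists>N C. \<forall>f\<in>schwartz. norm (u f) \<le> C * schwartz_norm N f)"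

definition dist_of_fun :: "(real^'n \<Rightarrow> complex) \<Rightarrow> 'n::finite dist" where
  "dist_of_fun g = (\<lambda>\<phi>. LINT x|lebesgue. g x * \<phi> x)"

text \<open>The integrability clause rules out junk values of the integral; in particular it forces
  local integrability of the representing function.\<close>

definition represents :: "(real^'n \<Rightarrow> complex) \<Rightarrow> 'n::finite dist \<Rightarrow> bool" where
  "represents g u \<longleftrightarrow> g \<in> borel_measurable lebesgue \<and>
     (\<forall>\<phi>\<in>schwartz. integrable lebesgue (\<lambda>x. g x * \<phi> x) \<and> u \<phi> = dist_of_fun g \<phi>)"

definition cont_rep :: "'n::finite dist \<Rightarrow> (real^'n \<Rightarrow> complex)" where
  "cont_rep u = (THE h. continuous_on UNIV h \<and> represents h u)"

definition fourier :: "(real^'n \<Rightarrow> complex) \<Rightarrow> (real^'n \<Rightarrow> complex)" where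
  "fourier f \<xi> = (LINT x|lebesgue. cis (- (x \<bullet> \<xi>)) * f x)"

definition inv_fourier :: "(real^'n \<Rightarrow> complex) \<Rightarrow> (real^'n \<Rightarrow> complex)" where
  "inv_fourier f x =
     complex_of_real (1 / (2 * pi) ^ CARD('n)) * (LINT \<xi>|lebesgue. cis (x \<bullet> \<xi>) * f \<xi>)"

definition dist_fourier :: "'n::finite dist \<Rightarrow> 'n dist" where
  "dist_fourier u = (\<lambda>\<phi>. u (fourier \<phi>))"

definition dist_inv_fourier :: "'n::finite dist \<Rightarrow> 'n dist" where
  "dist_inv_fourier u = (\<lambda>\<phi>. u (inv_fourier \<phi>))"

definition dist_mult :: "(real^'n \<Rightarrow> complex) \<Rightarrow> 'n::finite dist \<Rightarrow> 'n dist" where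
  "dist_mult m u = (\<lambda>\<phi>. u (\<lambda>\<xi>. m \<xi> * \<phi> \<xi>))"

text \<open>The index k stands for the dyadic number 2^k; the low-frequency multiplier is m1.\<close>

definition lp_symbol ::
  "(real^'n \<Rightarrow> complex) \<Rightarrow> (real^'n \<Rightarrow> complex) \<Rightarrow> nat \<Rightarrow> (real^'n \<Rightarrow> complex)" where
  "lp_symbol m1 m k = (if k = 0 then m1 else (\<lambda>\<xi>. m (\<xi> /\<^sub>R 2 ^ k)))"

definition lp_proj ::
  "(real^'n \<Rightarrow> complex) \<Rightarrow> (real^'n \<Rightarrow> complex) \<Rightarrow> nat \<Rightarrow> 'n::finite dist \<Rightarrow> 'n dist" where
  "lp_proj m1 m k u = dist_inv_fourier (dist_mult (lp_symbol m1 m k) (dist_fourier u))"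

text \<open>The last clause says that the projections of u sum to u in the weak sense, for every
  tempered distribution u.\<close>

definition littlewood_paley :: "(real^'n \<Rightarrow> complex) \<Rightarrow> (real^'n \<Rightarrow> complex) \<Rightarrow> bool" where
  "littlewood_paley m1 m \<longleftrightarrow>
     smooth m1 \<and> (\<exists>c. \<forall>\<xi>. m1 \<xi> \<noteq> 0 \<longrightarrow> norm \<xi> \<le> c) \<and>
     smooth m \<and> (\<exists>a b. 0 < a \<and> (\<forall>\<xi>. m \<xi> \<noteq> 0 \<longrightarrow> a \<le> norm \<xi> \<and> norm \<xi> \<le> b)) \<and>
     (\<forall>u. tempered u \<longrightarrow> (\<forall>\<phi>\<in>schwartz. (\<lambda>k. lp_proj m1 m k u \<phi>) sums u \<phi>))"

text \<open>The p-th power of the L^p norm of a distribution. All representing functions agree almost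
  everywhere, and the infimum is infinite if there is none.\<close>

definition Lp_norm_pow :: "real \<Rightarrow> 'n::finite dist \<Rightarrow> ennreal" where
  "Lp_norm_pow p u =
     (INF h \<in> {h. represents h u}. \<integral>\<^sup>+ x. ennreal (norm (h x) powr p) \<partial>lebesgue)"

text \<open>The p-th power of the Besov norm; the term k = 0 deliberately occurs twice, as the norm
  sums over all dyadic numbers at least 1 in addition to the low-frequency term.\<close>

definition besov_norm_pow ::
  "(real^'n \<Rightarrow> complex) \<Rightarrow> (real^'n \<Rightarrow> complex) \<Rightarrow> real \<Rightarrow> real \<Rightarrow> 'n::finite dist \<Rightarrow> ennreal" where
  "besov_norm_pow m1 m s p u =
     Lp_norm_pow p (lp_proj m1 m 0 u) +
     (\<Sum>k. ennreal ((2 ^ k) powr (s * p)) * Lp_norm_pow p (lp_proj m1 m k u))"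

definition besov ::
  "(real^'n \<Rightarrow> complex) \<Rightarrow> (real^'n \<Rightarrow> complex) \<Rightarrow> real \<Rightarrow> real \<Rightarrow> 'n::finite dist set" where
  "besov m1 m s p = {u. tempered u \<and> besov_norm_pow m1 m s p u < \<infinity>}"

definition besov_extension ::
  "(real^'n \<Rightarrow> complex) \<Rightarrow> (real^'n \<Rightarrow> complex) \<Rightarrow> real \<Rightarrow> real \<Rightarrow> (real^'n) set \<Rightarrow>
   (real^'n \<Rightarrow> complex) \<Rightarrow> (real^'n \<Rightarrow> complex) \<Rightarrow> bool" where
  "besov_extension m1 m s p \<Omega> f g \<longleftrightarrow>
     represents g (dist_of_fun g) \<and> dist_of_fun g \<in> besov m1 m s p \<and>
     (AE x in lebesgue. x \<in> \<Omega> \<longrightarrow> f x = g x)"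

definition besov_on ::
  "(real^'n \<Rightarrow> complex) \<Rightarrow> (real^'n \<Rightarrow> complex) \<Rightarrow> real \<Rightarrow> real \<Rightarrow> (real^'n) set \<Rightarrow>
   (real^'n \<Rightarrow> complex) set" where
  "besov_on m1 m s p \<Omega> = {f. \<exists>g. besov_extension m1 m s p \<Omega> f g}"

text \<open>Each projection is a continuous function and is evaluated through its continuous
  representative, since the boundary of a Lipschitz domain is a Lebesgue null set.\<close>

definition lp_partial_sum ::
  "(real^'n \<Rightarrow> complex) \<Rightarrow> (real^'n \<Rightarrow> complex) \<Rightarrow> (real^'n \<Rightarrow> complex) \<Rightarrow> real^'n \<Rightarrow> nat \<Rightarrow> complex"
where
  "lp_partial_sum m1 m g y K = (\<Sum>k\<le>K. cont_rep (lp_proj m1 m k (dist_of_fun g)) y)"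

text \<open>Near each boundary point the set is the part above the graph of a Lipschitz function, which
  is defined on the hyperplane orthogonal to some unit vector e. No uniformity in the boundary
  point and no boundedness is required.\<close>

definition lipschitz_boundary :: "(real^'n) set \<Rightarrow> bool" where
  "lipschitz_boundary \<Omega> \<longleftrightarrow>
     (\<forall>x0 \<in> frontier \<Omega>. \<exists>e \<rho> L \<psi>. norm e = 1 \<and> 0 < \<rho> \<and> L-lipschitz_on {z. z \<bullet> e = 0} \<psi> \<and>
        \<Omega> \<inter> ball x0 \<rho> = {x \<in> ball x0 \<rho>. x \<bullet> e > \<psi> (x - (x \<bullet> e) *\<^sub>R e)})"

definition hausdorff_content :: "nat \<Rightarrow> real \<Rightarrow> 'a::euclidean_space set \<Rightarrow> ennreal" where
  "hausdorff_content d \<delta> A =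
     (INF C \<in> {C :: nat \<Rightarrow> 'a set. A \<subseteq> (\<Union>i. C i) \<and> (\<forall>i. bounded (C i) \<and> diameter (C i) \<le> \<delta>)}.
        (\<Sum>i. if C i = {} then 0
             else ennreal (unit_ball_vol (real d) * (diameter (C i) / 2) ^ d)))"

text \<open>Hausdorff (outer) measure, normalized so that in dimension n - 1 it is the usual surface
  measure on a Lipschitz hypersurface.\<close>

definition hausdorff_measure :: "nat \<Rightarrow> 'a::euclidean_space set \<Rightarrow> ennreal" where
  "hausdorff_measure d A = (SUP \<delta> \<in> {0<..}. hausdorff_content d \<delta> A)"

definition ae_boundary :: "(real^'n) set \<Rightarrow> (real^'n \<Rightarrow> bool) \<Rightarrow> bool" where
  "ae_boundary \<Omega> P \<longleftrightarrow> hausdorff_measure (CARD('n) - 1) {y \<in> frontier \<Omega>. \<not> P y} = 0"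

end

theory Submission
  imports Defs
begin

text \<open>Let \<open>h k\<close> be the continuous representative of the \<open>k\<close>-th projection of \<open>g\<close> and
  \<open>F = (\<Sum>k. 2 ^ (k * s * p) * |h k| ^ p)\<close>, which is integrable because \<open>g\<close> lies in the Besov space.
  By a Vitali covering, outside a set of vanishing (n - 1)-dimensional Hausdorff measure every point
  \<open>y\<close> satisfies \<open>(\<integral>z\<in>ball y r. F z) \<le> A * r ^ (n - 1)\<close> for all \<open>r\<close>; the geometry of the domain
  plays no role. At such a point put \<open>\<beta> = s - 1 / p\<close>. Since \<open>h k\<close> is the convolution of a rapidly
  decreasing kernel of width \<open>2 ^ -k\<close> with the frequencies of \<open>g\<close> at least comparable to \<open>2 ^ k\<close>,
  the growth condition gives \<open>|h k y| \<le> M * 2 ^ (-k * \<beta>)\<close> and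
  \<open>|h k x - h k y| \<le> M * 2 ^ k * |x - y| * 2 ^ (-k * \<beta>)\<close> for \<open>|x - y| \<le> 2 ^ -k\<close>. Summing these bounds
  for \<open>2 ^ k \<le> 1 / r\<close>, and \<open>|h k x| \<le> 2 ^ (-k * s) * F x ^ (1 / p)\<close> for the other \<open>k\<close>, the difference
  \<open>g x - (\<Sum>k. h k y)\<close> is at most \<open>C * r ^ \<beta> * (1 + (r * F x) ^ (1 / p))\<close> for almost every \<open>x\<close> in \<open>ball y r\<close>,
  and averaging this over the ball gives the claim, even with exponent \<open>\<beta>\<close>.\<close>

section \<open>Decay kernels and exceptional sets\<close>

text \<open>The boundary is a null set, so an a.e. bound such as
  \<open>norm (h k x) <= \<rho> ^ k * F x powr (1 / p)\<close> says nothing at a boundary point;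
  pointwise estimates there come from integrating such a bound against a kernel, which is why the
  growth condition is stated for ball integrals of \<open>F\<close>. The exponent n - 1 fits:
  averaged over a ball of radius 2^-k, \<open>F\<close> is at most of order 2^k, and 2^(-k s) times
  the p-th root of 2^k is 2^(-k \<beta>). Convolving all of \<open>g\<close> with the k-th kernel
  would lose this factor, since the low frequencies of \<open>g\<close> do not decay in k; they are
  subtracted first, and orthogonality of kernels with separated frequency supports makes the
  subtraction harmless. The two bounds on s enter as 0 < \<beta>, which makes the bounds on |h k y|
  summable, and \<beta> < 1, which makes the Lipschitz bounds 2^k 2^(-k \<beta>) grow geometrically,
  so that their sum up to a scale is comparable to its last term. Under convolutions roots are
  linearized by t^(1/p) <= 1 + t, so that only integrals of \<open>F\<close> itself occur.\<close>

definition decay :: "real \<Rightarrow> 'a::euclidean_space \<Rightarrow> real" where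
  "decay t x = 1 / (1 + t * norm x) ^ (DIM('a) + 1)"

lemma ball_in_sets_borel [measurable]: "ball (y :: 'a::metric_space) r \<in> sets borel"
  by simp

lemma decay_nonneg [simp]: "0 \<le> t \<Longrightarrow> 0 \<le> decay t x"
  by (simp add: decay_def)

lemma decay_le_1: "0 \<le> t \<Longrightarrow> decay t x \<le> 1"
  unfolding decay_def by (intro divide_le_eq_1[THEN iffD2] disjI1 conjI zero_less_power one_le_power)
    (auto intro: add_pos_nonneg)

lemma decay_uminus [simp]: "decay t (- x) = decay t x"
  by (simp add: decay_def)

lemma decay_minus_commute: "decay t (x - y) = decay t (y - x)"
  by (simp add: decay_def norm_minus_commute)

lemma decay_measurable [measurable]: "decay t \<in> borel_measurable borel"
  unfolding decay_def by measurable

text \<open>Moving the point by at most one kernel width \<open>1 / t\<close> at most doubles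
  \<open>1 + t * norm x\<close>, so a bound at an intermediate point of a short segment can be
  carried back to its endpoint.\<close>

lemma decay_shift:
  fixes x y :: "'a::euclidean_space"
  assumes "0 \<le> t" "t * norm (x - y) \<le> 1"
  shows "decay t x \<le> 2 ^ (DIM('a) + 1) * decay t y"
proof -
  have "t * norm y \<le> t * (norm x + norm (x - y))"
    using assms norm_triangle_ineq2[of y x] by (intro mult_left_mono) (auto simp: norm_minus_commute)
  then have "1 + t * norm y \<le> 2 + t * norm x"
    using assms by (simp add: algebra_simps)
  also have "\<dots> \<le> 2 * (1 + t * norm x)"
    using assms by simp
  finally have "(1 + t * norm y) ^ (DIM('a) + 1) \<le> (2 * (1 + t * norm x)) ^ (DIM('a) + 1)"
    using assms by (intro power_mono) auto
  moreover have "0 < (1 + t * norm x) ^ (DIM('a) + 1)" "0 < (1 + t * norm y) ^ (DIM('a) + 1)"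
    using assms by (auto intro!: zero_less_power add_pos_nonneg simp del: power_Suc power_Suc2 Suc_eq_plus1 add_Suc_right)
  ultimately show ?thesis
    unfolding decay_def power_mult_distrib
    by (simp only: divide_le_eq mult_1 times_divide_eq_right) (simp add: field_simps)
qed

text \<open>Dominating the kernel by indicators of dyadic balls lets ball integrals control
  convolutions. One term suffices: the least \<open>l\<close> with \<open>t * norm x < 2 ^ l\<close>
  satisfies \<open>2 ^ l \<le> 2 * (1 + t * norm x)\<close>.\<close>

lemma decay_le_dyadic:
  fixes x :: "'a::euclidean_space"
  assumes "0 < t"
  shows "ennreal (decay t x) \<le>
    (\<Sum>l. ennreal (2 ^ (DIM('a) + 1) / (2 ^ l) ^ (DIM('a) + 1)) * indicator (ball 0 (2 ^ l / t)) x)"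
proof -
  let ?N = "DIM('a) + 1"
  let ?f = "\<lambda>l. ennreal (2 ^ ?N / (2 ^ l) ^ ?N) * indicator (ball 0 (2 ^ l / t)) x"
  define l where "l = (LEAST l. t * norm x < 2 ^ l)"
  have ex: "\<exists>l. t * norm x < 2 ^ l"
    using real_arch_pow[of 2 "t * norm x"] by auto
  have l: "t * norm x < 2 ^ l"
    unfolding l_def using ex by (rule LeastI_ex)
  have "2 ^ l \<le> 2 * (1 + t * norm x)"
  proof (cases l)
    case (Suc l')
    then have "\<not> t * norm x < 2 ^ l'"
      using not_less_Least[of l' "\<lambda>l. t * norm x < 2 ^ l"] by (simp add: l_def)
    then show ?thesis
      using Suc by simp
  qed (use assms in auto)
  then have "(2 ^ l) ^ ?N \<le> (2 * (1 + t * norm x)) ^ ?N"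
    using assms by (intro power_mono) auto
  then have "decay t x \<le> 2 ^ ?N / (2 ^ l) ^ ?N"
    using assms unfolding decay_def power_mult_distrib
    by (simp add: divide_simps add_pos_nonneg pos_add_strict mult_ac)
  then have "ennreal (decay t x) \<le> ?f l"
    using l assms by (simp add: indicator_def pos_less_divide_eq mult.commute ennreal_leI)
  also have "\<dots> = (\<Sum>i\<in>{l}. ?f i)"
    by (subst sum.insert) auto
  also have "\<dots> \<le> (\<Sum>l. ?f l)"
    by (intro sum_le_suminf) (auto intro: summableI)
  finally show ?thesis .
qed

text \<open>The exponent \<open>DIM('a) + 1\<close> in \<open>decay\<close> exceeds every admissible
  \<open>d\<close>, so the layers of radius \<open>2 ^ l / t\<close> are dominated by a geometric
  series of ratio 1/2; its sum 2 accounts for the power \<open>DIM('a) + 2\<close>. The growth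
  exponent is \<open>DIM('a)\<close> for Lebesgue measure and one less for \<open>F\<close>.\<close>

lemma nn_integral_decay:
  fixes y :: "'a::euclidean_space" and W :: "'a \<Rightarrow> ennreal"
  assumes [measurable]: "W \<in> borel_measurable borel"
    and "0 < t" "d \<le> DIM('a)" "0 \<le> A"
    and growth: "\<And>r. 0 < r \<Longrightarrow> (\<integral>\<^sup>+z\<in>ball y r. W z \<partial>lborel) \<le> ennreal (A * r ^ d)"
  shows "(\<integral>\<^sup>+z. ennreal (decay t (y - z)) * W z \<partial>lborel) \<le> ennreal (2 ^ (DIM('a) + 2) * A / t ^ d)"
proof -
  let ?N = "DIM('a) + 1"
  let ?c = "\<lambda>l. ennreal (2 ^ ?N / (2 ^ l) ^ ?N)"
  have [simp]: "indicator (ball 0 r) (y - z) = (indicator (ball y r) z :: ennreal)" for r z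
    by (auto simp: indicator_def dist_norm norm_minus_commute)
  have "(\<integral>\<^sup>+z. ennreal (decay t (y - z)) * W z \<partial>lborel)
      \<le> (\<integral>\<^sup>+z. (\<Sum>l. ?c l * indicator (ball y (2 ^ l / t)) z) * W z \<partial>lborel)"
    using decay_le_dyadic[OF \<open>0 < t\<close>] by (intro nn_integral_mono mult_right_mono) (auto simp flip: \<open>\<And>z r. indicator (ball 0 r) (y - z) = (indicator (ball y r) z :: ennreal)\<close>)
  also have "\<dots> = (\<integral>\<^sup>+z. (\<Sum>l. ?c l * (W z * indicator (ball y (2 ^ l / t)) z)) \<partial>lborel)"
    by (simp add: ennreal_suminf_multc[symmetric] mult_ac)
  also have "\<dots> = (\<Sum>l. ?c l * (\<integral>\<^sup>+z\<in>ball y (2 ^ l / t). W z \<partial>lborel))"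
    by (subst nn_integral_suminf) (simp_all add: nn_integral_cmult)
  also have "\<dots> \<le> (\<Sum>l. ennreal (2 ^ ?N * A / t ^ d * (1 / 2) ^ l))"
  proof (intro suminf_le summableI)
    fix l :: nat
    have "?c l * (\<integral>\<^sup>+z\<in>ball y (2 ^ l / t). W z \<partial>lborel) \<le> ?c l * ennreal (A * (2 ^ l / t) ^ d)"
      using \<open>0 < t\<close> by (intro mult_left_mono growth) auto
    also have "\<dots> = ennreal (2 ^ ?N / (2 ^ l) ^ ?N * (A * (2 ^ l / t) ^ d))"
      using assms by (intro ennreal_mult[symmetric]) auto
    also have "\<dots> \<le> ennreal (2 ^ ?N * A / t ^ d * (1 / 2) ^ l)"
    proof (rule ennreal_leI)
      have "(2 ^ l) ^ d * 2 ^ l \<le> ((2::real) ^ l) ^ ?N"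
        using \<open>d \<le> DIM('a)\<close> by (simp add: power_increasing mult.commute flip: power_Suc)
      then have "(2 ^ l) ^ d / (2 ^ l) ^ ?N \<le> (1 / 2 :: real) ^ l"
        by (simp add: field_simps power_divide)
      then have "(2 ^ ?N * A / t ^ d) * ((2 ^ l) ^ d / (2 ^ l) ^ ?N) \<le> (2 ^ ?N * A / t ^ d) * (1 / 2) ^ l"
        using assms by (intro mult_left_mono) auto
      then show "2 ^ ?N / (2 ^ l) ^ ?N * (A * (2 ^ l / t) ^ d) \<le> 2 ^ ?N * A / t ^ d * (1 / 2) ^ l"
        by (simp add: power_divide mult_ac)
    qed
    finally show "?c l * (\<integral>\<^sup>+z\<in>ball y (2 ^ l / t). W z \<partial>lborel) \<le> \<dots>" .
  qed
  also have "\<dots> = ennreal (\<Sum>l. 2 ^ ?N * A / t ^ d * (1 / 2) ^ l)"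
    using assms by (intro suminf_ennreal2 summable_mult summable_geometric) auto
  also have "(\<Sum>l. 2 ^ ?N * A / t ^ d * (1 / 2) ^ l) = 2 ^ ?N * A / t ^ d * 2"
    by (subst suminf_mult) (auto simp: suminf_geometric)
  also have "2 ^ ?N * A / t ^ d * 2 = 2 ^ (DIM('a) + 2) * A / t ^ d"
    by simp
  finally show ?thesis .
qed

lemma nn_integral_decay_lborel:
  fixes y :: "'a::euclidean_space"
  assumes "0 < t"
  shows "(\<integral>\<^sup>+z. ennreal (decay t (y - z)) \<partial>lborel)
    \<le> ennreal (2 ^ (DIM('a) + 2) * unit_ball_vol (DIM('a)) / t ^ DIM('a))"
  using nn_integral_decay[of "\<lambda>_. 1" t "DIM('a)" "unit_ball_vol (DIM('a))" y] assms
  by (simp add: emeasure_ball)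

lemma integrable_decay_shift [intro]:
  fixes y :: "'a::euclidean_space"
  assumes "0 < t"
  shows "integrable lborel (\<lambda>z. decay t (y - z))"
proof (rule integrableI_bounded)
  have "(\<integral>\<^sup>+z. ennreal (norm (decay t (y - z))) \<partial>lborel) = (\<integral>\<^sup>+z. ennreal (decay t (y - z)) \<partial>lborel)"
    using assms by (intro nn_integral_cong) auto
  also have "\<dots> < \<infinity>"
    using nn_integral_decay_lborel[OF assms, of y] by (rule le_less_trans) simp
  finally show "(\<integral>\<^sup>+z. ennreal (norm (decay t (y - z))) \<partial>lborel) < \<infinity>" .
qed simp

lemma integrable_decay [intro]:
  "0 < t \<Longrightarrow> integrable lborel (decay t :: 'a::euclidean_space \<Rightarrow> real)"
  using integrable_decay_shift[of t "0::'a"] by simp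

text \<open>If no constant works at \<open>y\<close>, then for every \<open>M\<close> some ball
  around \<open>y\<close> has mass above \<open>M * r ^ d\<close>. Among these balls a disjoint
  family is selected whose fivefold enlargements cover the set, so the sum of the
  \<open>r ^ d\<close> is at most the total mass divided by \<open>M\<close>. At fixed
  \<open>\<delta>\<close> the content is squeezed to zero by letting \<open>M\<close> tend to
  infinity.\<close>

lemma hausdorff_measure_exceptional:
  fixes W :: "'a::euclidean_space \<Rightarrow> ennreal"
  assumes [measurable]: "W \<in> borel_measurable borel" and fin: "(\<integral>\<^sup>+z. W z \<partial>lborel) < \<infinity>"
  shows "hausdorff_measure d {y. \<not> (\<exists>A. \<forall>r>0. (\<integral>\<^sup>+z\<in>ball y r. W z \<partial>lborel) \<le> ennreal (A * r ^ d))} = 0"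
    (is "hausdorff_measure d ?E = 0")
proof -
  define E where "E = ?E"
  define \<nu> where "\<nu> = density lborel W"
  define T where "T = enn2real (\<nu> UNIV)"
  have [simp]: "sets \<nu> = sets borel" "space \<nu> = UNIV"
    by (auto simp: \<nu>_def)
  have \<nu>_ball: "\<nu> (ball y r) = (\<integral>\<^sup>+z\<in>ball y r. W z \<partial>lborel)" for y r
    by (simp add: \<nu>_def emeasure_density)
  have T: "\<nu> UNIV = ennreal T" "0 \<le> T"
    using fin by (auto simp: T_def \<nu>_def emeasure_density)
  have "hausdorff_content d \<delta> E \<le> 0" if \<delta>: "0 < \<delta>" for \<delta>
  proof -
    \<comment> \<open>A ball of radius below \<open>\<rho>\<close>, enlarged five times, has
      diameter at most \<open>\<delta>\<close>.\<close>
    define \<rho> where "\<rho> = \<delta> / 10"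
    have "0 < \<rho>"
      using \<delta> by (simp add: \<rho>_def)
    define V where "V = unit_ball_vol (real d) * 5 ^ d"
    have "0 \<le> V"
      by (simp add: V_def)
    \<comment> \<open>A bad ball has \<open>M * r ^ d < T\<close>, so this threshold forces
      \<open>r < \<rho>\<close>; the summand 1 keeps \<open>M\<close> positive even when
      \<open>T = 0\<close>.\<close>
    have bound: "hausdorff_content d \<delta> E \<le> ennreal (V * T / M)" if M: "(T + 1) / \<rho> ^ d \<le> M" for M
    proof -
      have "0 < M"
        using M T \<open>0 < \<rho>\<close> by (smt (verit) divide_pos_pos zero_less_power)
      have "\<exists>r>0. r < \<rho> \<and> ennreal (M * r ^ d) < \<nu> (ball y r)" if y: "y \<in> E" for y
      proof -
        obtain r where r: "0 < r" "ennreal (M * r ^ d) < \<nu> (ball y r)"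
          using y unfolding E_def \<nu>_ball not_le mem_Collect_eq by (meson not_le)
        have "\<nu> (ball y r) \<le> ennreal T"
          unfolding T(1)[symmetric] by (intro emeasure_mono) auto
        with r have "ennreal (M * r ^ d) < ennreal T"
          by order
        then have "M * r ^ d < T"
          using \<open>0 < M\<close> r by (subst (asm) ennreal_less_iff) auto
        moreover have "T + 1 \<le> M * \<rho> ^ d"
          using M \<open>0 < \<rho>\<close> by (simp add: field_simps)
        ultimately have "\<not> \<rho> \<le> r"
          using \<open>0 < M\<close> \<open>0 < \<rho>\<close> power_mono[of \<rho> r d] mult_left_mono[of "\<rho> ^ d" "r ^ d" M] by fastforce
        with r show ?thesis
          by auto
      qed
      then have "\<forall>y\<in>E. \<exists>r. 0 < r \<and> r < \<rho> \<and> ennreal (M * r ^ d) < \<nu> (ball y r)"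
        by blast
      from bchoice[OF this] obtain r where r: "\<And>y. y \<in> E \<Longrightarrow> 0 < r y \<and> r y < \<rho> \<and> ennreal (M * r y ^ d) < \<nu> (ball y (r y))"
        by blast
      obtain C where C: "countable C" "C \<subseteq> E"
        "pairwise (\<lambda>i j. disjnt (cball i (r i)) (cball j (r j))) C"
        "\<And>i. i \<in> E \<Longrightarrow> \<exists>j. j \<in> C \<and> \<not> disjnt (cball i (r i)) (cball j (r j)) \<and>
            cball i (r i) \<subseteq> ball j (5 * r j)"
      proof (rule Vitali_covering_lemma_cballs_balls[of E r \<rho> "\<lambda>y. y"])
        show "0 < r i \<and> r i \<le> \<rho>" if "i \<in> E" for i
          using r[OF that] by simp
      qed (rule that)
      define ix where "ix = to_nat_on C"
      \<comment> \<open>Content and measure are summed over sequences, so the countable family is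
        indexed by \<open>nat\<close>, with the empty set at the remaining indices. The case
        distinction in \<open>hausdorff_content\<close> makes the empty set free; for
        \<open>d = 0\<close> the volume formula alone would charge 1.\<close>
      define B where "B i = (if i \<in> ix ` C then ball (the_inv_into C ix i) (r (the_inv_into C ix i)) else {})" for i
      define D where "D i = (if i \<in> ix ` C then ball (the_inv_into C ix i) (5 * r (the_inv_into C ix i)) else {})" for i
      have inj: "inj_on ix C"
        using C(1) by (auto simp: ix_def)
      have ix [simp]: "the_inv_into C ix (ix y) = y" if "y \<in> C" for y
        using inj that by (rule the_inv_into_f_f)
      have rC: "0 < r y" "r y < \<rho>" "ennreal (M * r y ^ d) < \<nu> (ball y (r y))" if "y \<in> C" for y
        using r C(2) that by blast+
      have "E \<subseteq> (\<Union>i. D i)"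
      proof
        fix y assume "y \<in> E"
        with C(4) r obtain j where j: "j \<in> C" "y \<in> ball j (5 * r j)"
          by (smt (verit, best) centre_in_cball subset_iff)
        then have "y \<in> D (ix j)"
          by (auto simp: D_def)
        then show "y \<in> (\<Union>i. D i)"
          by blast
      qed
      moreover have "bounded (D i) \<and> diameter (D i) \<le> \<delta>" for i
        using rC \<delta> by (auto simp: D_def \<rho>_def intro: less_imp_le) (smt (verit, del_insts) field_sum_of_halves)
      ultimately have "hausdorff_content d \<delta> E \<le> (\<Sum>i. if D i = {} then 0
             else ennreal (unit_ball_vol (real d) * (diameter (D i) / 2) ^ d))"
        unfolding hausdorff_content_def by (intro INF_lower) auto
      also have "\<dots> \<le> (\<Sum>i. ennreal (V / M) * \<nu> (B i))"
      proof (intro suminf_le summableI)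
        fix i
        show "(if D i = {} then 0 else ennreal (unit_ball_vol (real d) * (diameter (D i) / 2) ^ d))
            \<le> ennreal (V / M) * \<nu> (B i)"
        proof (cases "i \<in> ix ` C")
          case True
          then obtain y where y: "y \<in> C" "i = ix y"
            by auto
          have "unit_ball_vol (real d) * (diameter (D i) / 2) ^ d = V / M * (M * r y ^ d)"
            using y rC[OF y(1)] \<open>0 < M\<close> by (simp add: D_def V_def power_mult_distrib)
          then have "ennreal (unit_ball_vol (real d) * (diameter (D i) / 2) ^ d)
              = ennreal (V / M) * ennreal (M * r y ^ d)"
            using \<open>0 < M\<close> \<open>0 \<le> V\<close> rC[OF y(1)] by (simp add: ennreal_mult'[symmetric])
          also have "\<dots> \<le> ennreal (V / M) * \<nu> (B i)"
            using rC[OF y(1)] y by (intro mult_left_mono) (auto simp: B_def)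
          finally show ?thesis
            by (auto split: if_splits)
        qed (simp add: D_def)
      qed
      also have "\<dots> = ennreal (V / M) * (\<Sum>i. \<nu> (B i))"
        by simp
      also have "(\<Sum>i. \<nu> (B i)) = \<nu> (\<Union>i. B i)"
      proof (rule suminf_emeasure)
        show "range B \<subseteq> sets \<nu>"
          by (auto simp: B_def)
        show "disjoint_family B"
        proof (unfold disjoint_family_on_def, safe)
          fix i j :: nat and x assume ij: "i \<noteq> j" "x \<in> B i" "x \<in> B j"
          then obtain y z where yz: "y \<in> C" "i = ix y" "z \<in> C" "j = ix z"
            by (auto simp: B_def split: if_splits)
          with ij have "y \<noteq> z" "x \<in> cball y (r y)" "x \<in> cball z (r z)"
            by (auto simp: B_def)
          moreover from this yz have "disjnt (cball y (r y)) (cball z (r z))"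
            using C(3) by (simp add: pairwise_def)
          ultimately show "x \<in> {}"
            by (meson disjnt_iff)
        qed
      qed
      also have "ennreal (V / M) * \<nu> (\<Union>i. B i) \<le> ennreal (V / M) * ennreal T"
        unfolding T(1)[symmetric] by (intro mult_left_mono emeasure_mono) auto
      also have "\<dots> = ennreal (V * T / M)"
        using T \<open>0 \<le> V\<close> \<open>0 < M\<close> by (simp add: ennreal_mult'[symmetric])
      finally show ?thesis .
    qed
    have "hausdorff_content d \<delta> E \<le> ennreal 0"
    proof (rule tendsto_lowerbound)
      show "((\<lambda>M. ennreal (V * T / M)) \<longlongrightarrow> ennreal 0) at_top"
        by (intro tendsto_ennrealI tendsto_divide_0[OF tendsto_const] filterlim_at_top_imp_at_infinity filterlim_ident)
      show "\<forall>\<^sub>F M in at_top. hausdorff_content d \<delta> E \<le> ennreal (V * T / M)"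
        using eventually_ge_at_top[of "(T + 1) / \<rho> ^ d"] by (rule eventually_mono) (rule bound)
    qed simp
    then show ?thesis
      by simp
  qed
  then have "hausdorff_measure d E = 0"
    by (auto simp: hausdorff_measure_def intro!: antisym SUP_least)
  then show ?thesis
    by (simp only: E_def)
qed

lemma hausdorff_measure_mono: "A \<subseteq> B \<Longrightarrow> hausdorff_measure d A \<le> hausdorff_measure d B"
  unfolding hausdorff_measure_def hausdorff_content_def
  by (intro SUP_mono' INF_superset_mono) auto

section \<open>Smooth functions\<close>

lemma partial_eqI: "(f has_derivative f') (at x) \<Longrightarrow> partial i f x = f' (axis i 1)"
  by (simp add: partial_def frechet_derivative_at[symmetric])

lemma iter_partial_append: "iter_partial (is @ js) f = iter_partial is (iter_partial js f)"
  by (induction "is") auto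

lemma smooth_differentiable: "smooth f \<Longrightarrow> f differentiable (at x)"
  unfolding smooth_def by (metis iter_partial.simps(1))

lemma smooth_partial: "smooth f \<Longrightarrow> smooth (partial i f)"
  unfolding smooth_def
  using iter_partial_append[of _ "[i]" f] by (metis iter_partial.simps)

lemma smoothI:
  assumes "\<And>x. f differentiable (at x)" "\<And>i. smooth (partial i f)"
  shows "smooth f"
  unfolding smooth_def
proof (intro allI)
  fix js x
  show "iter_partial js f differentiable (at x)"
  proof (cases js rule: rev_cases)
    case (snoc ks i)
    then show ?thesis
      using assms(2)[of i] by (simp add: iter_partial_append smooth_def)
  qed (use assms(1) in simp)
qed

text \<open>Iterated partials of products, quotients or dilates have no convenient closed form; a
  class of differentiable functions that is closed under \<open>partial\<close> serves as the
  invariant instead.\<close>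

lemma smooth_coinduct:
  assumes "C f" and diff: "\<And>f x. C f \<Longrightarrow> f differentiable (at x)"
    and step: "\<And>f i. C f \<Longrightarrow> C (partial i f)"
  shows "smooth f"
proof -
  have "C (iter_partial js f)" for js
    by (induction js) (use assms in auto)
  then show ?thesis
    using diff by (auto simp: smooth_def)
qed

lemma smooth_continuous: "smooth f \<Longrightarrow> continuous_on UNIV f"
  by (meson differentiable_at_withinI differentiable_imp_continuous_on differentiable_on_def smooth_differentiable)

lemma smooth_measurable: "smooth f \<Longrightarrow> f \<in> borel_measurable borel"
  by (rule borel_measurable_continuous_onI) (rule smooth_continuous)

lemma partial_const: "partial i (\<lambda>_. c) = (\<lambda>_. 0)"
  by (rule ext) (rule partial_eqI[OF has_derivative_const])

lemma partial_add:
  "\<lbrakk>\<And>x. f differentiable (at x); \<And>x. g differentiable (at x)\<rbrakk> \<Longrightarrow>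
    partial i (\<lambda>x. f x + g x) = (\<lambda>x. partial i f x + partial i g x)"
  by (rule ext, subst partial_eqI, rule has_derivative_add)
    (auto simp: partial_def simp flip: frechet_derivative_works)

lemma partial_mult:
  fixes f g :: "real^'n \<Rightarrow> complex"
  shows "\<lbrakk>\<And>x. f differentiable (at x); \<And>x. g differentiable (at x)\<rbrakk> \<Longrightarrow>
    partial i (\<lambda>x. f x * g x) = (\<lambda>x. f x * partial i g x + partial i f x * g x)"
  by (rule ext, subst partial_eqI, rule has_derivative_mult)
    (auto simp: partial_def simp flip: frechet_derivative_works)

lemma smooth_const: "smooth (\<lambda>_. c)"
  by (rule smooth_coinduct[of "\<lambda>f. \<exists>c. f = (\<lambda>_. c)"]) (auto simp: partial_const)

text \<open>Differentiating a product yields a sum of products, so sums and products are handled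
  together to make the class closed under \<open>partial\<close>.\<close>

inductive smooth_algebra :: "(real^'n \<Rightarrow> complex) \<Rightarrow> bool" where
  smooth_algebra_base: "smooth f \<Longrightarrow> smooth_algebra f"
| smooth_algebra_add: "smooth_algebra f \<Longrightarrow> smooth_algebra g \<Longrightarrow> smooth_algebra (\<lambda>x. f x + g x)"
| smooth_algebra_mult: "smooth_algebra f \<Longrightarrow> smooth_algebra g \<Longrightarrow> smooth_algebra (\<lambda>x. f x * g x)"

lemma smooth_algebra_imp_smooth: "smooth_algebra f \<Longrightarrow> smooth f"
proof (rule smooth_coinduct[of smooth_algebra])
  have *: "(\<forall>x. f differentiable (at x)) \<and> (\<forall>i. smooth_algebra (partial i f))"
    if "smooth_algebra f" for f :: "real^'n \<Rightarrow> complex"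
    using that
  proof induction
    case (smooth_algebra_base f)
    then show ?case
      using smooth_algebra.smooth_algebra_base smooth_differentiable smooth_partial by blast
  next
    case (smooth_algebra_add f g)
    then show ?case
      by (auto simp: partial_add intro!: smooth_algebra.smooth_algebra_add)
  next
    case (smooth_algebra_mult f g)
    then show ?case
      by (auto simp: partial_mult intro!: smooth_algebra.smooth_algebra_add smooth_algebra.smooth_algebra_mult)
  qed
  show "smooth_algebra f \<Longrightarrow> f differentiable (at x)" for f :: "real^'n \<Rightarrow> complex" and x
    using * by blast
  show "smooth_algebra f \<Longrightarrow> smooth_algebra (partial i f)" for f :: "real^'n \<Rightarrow> complex" and i
    using * by blast
qed

lemma smooth_add: "smooth f \<Longrightarrow> smooth g \<Longrightarrow> smooth (\<lambda>x. f x + g x)"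
  by (intro smooth_algebra_imp_smooth[OF smooth_algebra_add] smooth_algebra_base)

lemma smooth_mult: "smooth f \<Longrightarrow> smooth g \<Longrightarrow> smooth (\<lambda>x. f x * g x)"
  by (intro smooth_algebra_imp_smooth[OF smooth_algebra_mult] smooth_algebra_base)

lemma has_derivative_of_real_inner:
  "((\<lambda>x. complex_of_real (x \<bullet> e)) has_derivative (\<lambda>h. complex_of_real (h \<bullet> e))) (at x)"
  by (intro derivative_eq_intros) auto

lemma smooth_inner:
  fixes e :: "real^'n"
  shows "smooth (\<lambda>x. complex_of_real (x \<bullet> e))"
proof (rule smoothI)
  show "(\<lambda>x. complex_of_real (x \<bullet> e)) differentiable (at x)" for x :: "real^'n"
    using has_derivative_of_real_inner differentiable_def by blast
  have "partial i (\<lambda>x. complex_of_real (x \<bullet> e)) = (\<lambda>_. complex_of_real (axis i 1 \<bullet> e))" for i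
    by (rule ext) (rule partial_eqI[OF has_derivative_of_real_inner])
  then show "smooth (partial i (\<lambda>x. complex_of_real (x \<bullet> e)))" for i
    by (simp add: smooth_const)
qed

text \<open>Scalar multiples are included in the invariant class so that the factor \<open>c\<close>
  of the chain rule stays within it.\<close>

lemma smooth_scale:
  fixes f :: "real^'n \<Rightarrow> complex"
  assumes "smooth f"
  shows "smooth (\<lambda>x. f (c *\<^sub>R x))"
proof (rule smooth_coinduct[of "\<lambda>h. \<exists>f a. smooth f \<and> h = (\<lambda>x. a * f (c *\<^sub>R x))"])
  show "\<exists>g a. smooth g \<and> (\<lambda>x. f (c *\<^sub>R x)) = (\<lambda>x. a * g (c *\<^sub>R x))"
    using assms by (intro exI[of _ f] exI[of _ 1]) auto
next
  have deriv: "((\<lambda>x. a * f (c *\<^sub>R x)) has_derivative (\<lambda>h. a * frechet_derivative f (at (c *\<^sub>R x)) (c *\<^sub>R h))) (at x)"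
    if "smooth f" for f :: "real^'n \<Rightarrow> complex" and a x
  proof -
    have "(f has_derivative frechet_derivative f (at (c *\<^sub>R x))) (at (c *\<^sub>R x))"
      using smooth_differentiable[OF that] frechet_derivative_works by blast
    then have "((\<lambda>x. f (c *\<^sub>R x)) has_derivative (\<lambda>h. frechet_derivative f (at (c *\<^sub>R x)) (c *\<^sub>R h))) (at x)"
      by (rule has_derivative_compose[rotated]) (auto intro!: derivative_eq_intros)
    then show ?thesis
      by (rule has_derivative_mult_right)
  qed
  fix h :: "real^'n \<Rightarrow> complex" assume "\<exists>f a. smooth f \<and> h = (\<lambda>x. a * f (c *\<^sub>R x))"
  then obtain f a where f: "smooth f" and h: "h = (\<lambda>x. a * f (c *\<^sub>R x))"
    by blast
  show "h differentiable (at x)" for x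
    unfolding h using deriv[OF f] differentiable_def by blast
  have "partial i h = (\<lambda>x. (a * of_real c) * partial i f (c *\<^sub>R x))" for i
  proof
    fix x
    have "linear (frechet_derivative f (at (c *\<^sub>R x)))"
      using smooth_differentiable[OF f] by (rule linear_frechet_derivative)
    then have "frechet_derivative f (at (c *\<^sub>R x)) (c *\<^sub>R axis i 1) = c *\<^sub>R partial i f (c *\<^sub>R x)"
      unfolding partial_def by (rule linear_cmul)
    then show "partial i h x = (a * of_real c) * partial i f (c *\<^sub>R x)"
      unfolding h partial_eqI[OF deriv[OF f]] by (simp add: scaleR_conv_of_real[where 'a = complex])
  qed
  then show "\<exists>f a. smooth f \<and> partial i h = (\<lambda>x. a * f (c *\<^sub>R x))" for i
    using smooth_partial[OF f] by blast
qed

text \<open>The class of multipliers. The radius is explicit because separation of frequency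
  supports is later expressed by comparing radii.\<close>

definition smooth_in_ball :: "real \<Rightarrow> (real^'n \<Rightarrow> complex) \<Rightarrow> bool" where
  "smooth_in_ball R f \<longleftrightarrow> smooth f \<and> (\<forall>\<xi>. f \<xi> \<noteq> 0 \<longrightarrow> norm \<xi> \<le> R)"

lemma has_derivative_zero_outside:
  fixes f :: "real^'n \<Rightarrow> complex"
  assumes "\<And>\<xi>. f \<xi> \<noteq> 0 \<Longrightarrow> norm \<xi> \<le> R" "R < norm x"
  shows "(f has_derivative (\<lambda>_. 0)) (at x)"
proof (rule has_derivative_transform_within_open[OF has_derivative_const[of 0]])
  show "open {x::real^'n. R < norm x}"
    by (intro open_Collect_less continuous_intros)
  show "0 = f \<xi>" if "\<xi> \<in> {x. R < norm x}" for \<xi>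
    using assms(1)[of \<xi>] that by fastforce
qed (use assms in simp)

lemma smooth_in_ball_partial: "smooth_in_ball R f \<Longrightarrow> smooth_in_ball R (partial i f)"
  unfolding smooth_in_ball_def
  using partial_eqI[OF has_derivative_zero_outside[of f R], of _ i] smooth_partial[of f i]
  by (meson not_le)

lemma smooth_in_ball_mult:
  assumes "smooth_in_ball R f" "smooth g"
  shows "smooth_in_ball R (\<lambda>\<xi>. g \<xi> * f \<xi>)"
  using assms smooth_mult unfolding smooth_in_ball_def by auto

text \<open>Inside the ball the denominator has no zero; outside it \<open>f\<close> vanishes, and
  so does the quotient, even at zeros of the denominator, because division by zero yields zero. The
  invariant class consists of quotients by powers of the linear form, since one differentiation
  raises the exponent by one.\<close>

lemma smooth_in_ball_divide:
  fixes f :: "real^'n \<Rightarrow> complex"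
  assumes "smooth_in_ball R f" and nz: "\<And>\<xi>. norm \<xi> \<le> R \<Longrightarrow> \<xi> \<bullet> e \<noteq> a"
  shows "smooth_in_ball R (\<lambda>\<xi>. f \<xi> / of_real (\<xi> \<bullet> e - a))"
proof -
  let ?l = "\<lambda>\<xi>. complex_of_real (\<xi> \<bullet> e - a)"
  have l_smooth: "smooth ?l"
    using smooth_add[OF smooth_inner[of e] smooth_const[of "- of_real a"]] by simp
  have *: "(\<forall>x. h differentiable (at x)) \<and> (\<exists>f' k'. smooth_in_ball R f' \<and> partial i h = (\<lambda>\<xi>. f' \<xi> / ?l \<xi> ^ k'))"
    if "smooth_in_ball R f" and h: "h = (\<lambda>\<xi>. f \<xi> / ?l \<xi> ^ k)" for f h i k
  proof -
    \<comment> \<open>Numerator of the derivative of \<open>f / ?l ^ k\<close> over the denominator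
      \<open>?l ^ Suc k\<close>.\<close>
    define f' where "f' = (\<lambda>\<xi>. ?l \<xi> * partial i f \<xi> + (- (of_nat k * of_real (axis i 1 \<bullet> e))) * f \<xi>)"
    have supp: "norm \<xi> \<le> R" if "f \<xi> \<noteq> 0 \<or> partial i f \<xi> \<noteq> 0" for \<xi>
      using that \<open>smooth_in_ball R f\<close> smooth_in_ball_partial[of R f i] by (auto simp: smooth_in_ball_def)
    have deriv_in: "(h has_derivative (\<lambda>v. (frechet_derivative f (at x) v * ?l x ^ k
          - f x * (of_nat k * of_real (v \<bullet> e) * ?l x ^ (k - 1))) / (?l x ^ k * ?l x ^ k))) (at x)"
      if "norm x \<le> R" for x
    proof -
      have "?l x \<noteq> 0"
        using nz[OF that] by (simp del: of_real_diff)
      have "(f has_derivative frechet_derivative f (at x)) (at x)"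
        using \<open>smooth_in_ball R f\<close> smooth_differentiable frechet_derivative_works
        by (auto simp: smooth_in_ball_def)
      moreover have "((\<lambda>\<xi>. ?l \<xi> ^ k) has_derivative (\<lambda>v. of_nat k * of_real (v \<bullet> e) * ?l x ^ (k - 1))) (at x)"
        by (auto intro!: derivative_eq_intros)
      ultimately show ?thesis
        unfolding h using \<open>?l x \<noteq> 0\<close> by (intro has_derivative_divide') auto
    qed
    have deriv_out: "(h has_derivative (\<lambda>_. 0)) (at x)" if "R < norm x" for x
      using that supp by (intro has_derivative_zero_outside[of _ R]) (auto simp: h)
    have "h differentiable (at x)" for x
      using deriv_in[of x] deriv_out[of x] unfolding differentiable_def by fastforce
    moreover have "smooth_in_ball R f'"
      unfolding smooth_in_ball_def
    proof
      show "smooth f'"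
        using \<open>smooth_in_ball R f\<close> unfolding f'_def smooth_in_ball_def
        by (intro smooth_add smooth_mult smooth_partial smooth_const l_smooth) auto
      show "\<forall>\<xi>. f' \<xi> \<noteq> 0 \<longrightarrow> norm \<xi> \<le> R"
        unfolding f'_def by (intro allI impI, rule supp) fastforce
    qed
    moreover have "partial i h = (\<lambda>\<xi>. f' \<xi> / ?l \<xi> ^ Suc k)"
    proof
      fix x
      show "partial i h x = f' x / ?l x ^ Suc k"
      proof (cases "norm x \<le> R")
        case True
        then have "?l x \<noteq> 0"
          using nz by (simp del: of_real_diff)
        then show ?thesis
          unfolding partial_eqI[OF deriv_in[OF True]] unfolding f'_def partial_def
          by (cases k) (auto simp: field_simps simp del: of_real_diff)
      next
        case False
        then have "f x = 0" "partial i f x = 0"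
          using supp[of x] by blast+
        then show ?thesis
          using False partial_eqI[OF deriv_out, of x i] by (simp add: f'_def)
      qed
    qed
    ultimately show ?thesis
      by blast
  qed
  have "smooth (\<lambda>\<xi>. f \<xi> / ?l \<xi>)"
  proof (rule smooth_coinduct[of "\<lambda>h. \<exists>f k. smooth_in_ball R f \<and> h = (\<lambda>\<xi>. f \<xi> / ?l \<xi> ^ k)"])
    show "\<exists>g k. smooth_in_ball R g \<and> (\<lambda>\<xi>. f \<xi> / ?l \<xi>) = (\<lambda>\<xi>. g \<xi> / ?l \<xi> ^ k)"
      using assms by (intro exI[of _ f] exI[of _ 1]) auto
  qed (use * in blast)+
  then show ?thesis
    using assms by (auto simp: smooth_in_ball_def)
qed

text \<open>Since tanh' = 1 - tanh^2, this class is closed under \<open>partial\<close>, and its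
  members grow at most polynomially. Multiplied by a Gaussian they become Schwartz functions, rich
  enough to approximate indicators of boxes; the coordinates are included because differentiating
  the Gaussian produces them.\<close>

inductive tanh_polynomial :: "(real^'n \<Rightarrow> complex) \<Rightarrow> bool" where
  const: "tanh_polynomial (\<lambda>_. c)"
| coord: "tanh_polynomial (\<lambda>x. complex_of_real (x \<bullet> e))"
| tanh: "tanh_polynomial (\<lambda>x. complex_of_real (tanh (x \<bullet> e + a)))"
| add: "tanh_polynomial f \<Longrightarrow> tanh_polynomial g \<Longrightarrow> tanh_polynomial (\<lambda>x. f x + g x)"
| mult: "tanh_polynomial f \<Longrightarrow> tanh_polynomial g \<Longrightarrow> tanh_polynomial (\<lambda>x. f x * g x)"

lemma has_derivative_tanh_inner:
  "((\<lambda>x. complex_of_real (tanh (x \<bullet> e + a))) has_derivative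
    (\<lambda>h. complex_of_real ((1 - tanh (x \<bullet> e + a) ^ 2) * (h \<bullet> e)))) (at x)"
  by (intro has_derivative_of_real has_derivative_compose[where g = tanh, of "\<lambda>x. x \<bullet> e + a"]
        has_field_derivative_tanh[THEN has_field_derivative_imp_has_derivative, THEN has_derivative_eq_rhs])
    (auto intro!: derivative_eq_intros)

lemma tanh_polynomial_partial:
  "tanh_polynomial f \<Longrightarrow> (\<forall>x. f differentiable (at x)) \<and> (\<forall>i. tanh_polynomial (partial i f))"
proof (induction rule: tanh_polynomial.induct)
  case (const c)
  then show ?case
    by (simp add: partial_const tanh_polynomial.const)
next
  case (coord e)
  have "partial i (\<lambda>x. complex_of_real (x \<bullet> e)) = (\<lambda>_. complex_of_real (axis i 1 \<bullet> e))" for i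
    by (rule ext) (rule partial_eqI[OF has_derivative_of_real_inner])
  then show ?case
    using smooth_differentiable[OF smooth_inner[of e]] tanh_polynomial.const by auto
next
  case (tanh e a)
  let ?t = "\<lambda>x. complex_of_real (tanh (x \<bullet> e + a))"
  have "partial i ?t = (\<lambda>x. (1 + (- 1) * (?t x * ?t x)) * complex_of_real (axis i 1 \<bullet> e))" for i
    by (rule ext) (simp add: partial_eqI[OF has_derivative_tanh_inner] power2_eq_square)
  moreover have "tanh_polynomial (\<lambda>x. (1 + (- 1) * (?t x * ?t x)) * complex_of_real (axis i 1 \<bullet> e))" for i
    by (intro tanh_polynomial.add tanh_polynomial.mult tanh_polynomial.const tanh_polynomial.tanh)
  moreover have "?t differentiable (at x)" for x
    unfolding differentiable_def by (rule exI) (rule has_derivative_tanh_inner)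
  ultimately show ?case
    by simp
next
  case (add f g)
  then show ?case
    by (auto simp: partial_add intro!: tanh_polynomial.intros)
next
  case (mult f g)
  then show ?case
    by (auto simp: partial_mult intro!: tanh_polynomial.intros)
qed

lemma tanh_polynomial_bound:
  "tanh_polynomial f \<Longrightarrow> \<exists>C N. 0 \<le> C \<and> (\<forall>x. norm (f x) \<le> C * (1 + norm x) ^ N)"
proof (induction rule: tanh_polynomial.induct)
  case (const c)
  show ?case
    by (intro exI[of _ "norm c"] exI[of _ 0]) auto
next
  case (coord e)
  have "\<bar>x \<bullet> e\<bar> \<le> norm e * (1 + norm x)" for x
    using Cauchy_Schwarz_ineq2[of x e] by (simp add: algebra_simps add_increasing)
  then show ?case
    by (intro exI[of _ "norm e"] exI[of _ 1]) (auto simp: norm_of_real)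
next
  case (tanh e a)
  have "\<bar>tanh x\<bar> \<le> 1" for x :: real
    using tanh_real_bounds[of x] by auto
  then show ?case
    by (intro exI[of _ 1] exI[of _ 0]) auto
next
  case (add f g)
  then obtain C N D M where *: "0 \<le> C" "\<And>x. norm (f x) \<le> C * (1 + norm x) ^ N"
    "0 \<le> D" "\<And>x. norm (g x) \<le> D * (1 + norm x) ^ M"
    by blast
  have "norm (f x + g x) \<le> (C + D) * (1 + norm x) ^ (N + M)" for x
  proof -
    have "norm (f x + g x) \<le> C * (1 + norm x) ^ N + D * (1 + norm x) ^ M"
      using norm_triangle_ineq[of "f x" "g x"] *(2,4)[of x] by linarith
    also have "\<dots> \<le> C * (1 + norm x) ^ (N + M) + D * (1 + norm x) ^ (N + M)"
      using * by (intro add_mono mult_left_mono power_increasing) auto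
    finally show ?thesis
      by (simp add: algebra_simps)
  qed
  then show ?case
    using * by (intro exI[of _ "C + D"] exI[of _ "N + M"]) auto
next
  case (mult f g)
  then obtain C N D M where *: "0 \<le> C" "\<And>x. norm (f x) \<le> C * (1 + norm x) ^ N"
    "0 \<le> D" "\<And>x. norm (g x) \<le> D * (1 + norm x) ^ M"
    by blast
  have "norm (f x * g x) \<le> (C * D) * (1 + norm x) ^ (N + M)" for x
    using mult_mono[OF *(2)[of x] *(4)[of x]] * by (auto simp: norm_mult power_add mult_ac)
  then show ?case
    using * by (intro exI[of _ "C * D"] exI[of _ "N + M"]) auto
qed

section \<open>Gaussian-damped Schwartz functions\<close>

definition gaussian :: "real^'n \<Rightarrow> complex" where
  "gaussian x = of_real (exp (- (x \<bullet> x)))"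

lemma has_derivative_gaussian:
  "(gaussian has_derivative (\<lambda>h. of_real (- 2 * (x \<bullet> h)) * gaussian x)) (at x)"
  unfolding gaussian_def
  by (auto intro!: derivative_eq_intros simp: inner_commute)

lemma gaussian_decay: "\<exists>B. \<forall>x :: real^'n. (1 + norm x) ^ N * norm (gaussian x) \<le> B"
proof (intro exI allI)
  fix x :: "real^'n"
  have "(1 + norm x) ^ N \<le> exp (norm x) ^ N"
    by (intro power_mono) auto
  then have "(1 + norm x) ^ N * norm (gaussian x) \<le> exp (norm x) ^ N * exp (- (x \<bullet> x))"
    by (simp add: gaussian_def)
  also have "\<dots> = exp (real N * norm x - norm x ^ 2)"
    by (simp add: exp_diff exp_minus exp_of_nat_mult power2_norm_eq_inner field_simps)
  \<comment> \<open>Completing the square; the sharp constant is a quarter of this one.\<close>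
  also have "real N * norm x - norm x ^ 2 \<le> real N ^ 2"
  proof -
    have "(norm x - real N / 2)\<^sup>2 = norm x ^ 2 - real N * norm x + real N ^ 2 / 4"
      by (simp add: power2_eq_square field_simps)
    moreover have "0 \<le> (norm x - real N / 2)\<^sup>2" "0 \<le> real N ^ 2"
      by simp_all
    ultimately show ?thesis
      by linarith
  qed
  finally show "(1 + norm x) ^ N * norm (gaussian x) \<le> exp (real N ^ 2)"
    by simp
qed

lemma schwartz_tanh_polynomial_gaussian:
  fixes f :: "real^'n \<Rightarrow> complex"
  assumes "tanh_polynomial f"
  shows "(\<lambda>x. f x * gaussian x) \<in> schwartz"
proof -
  let ?C = "\<lambda>h :: real^'n \<Rightarrow> complex. \<exists>f. tanh_polynomial f \<and> h = (\<lambda>x. f x * gaussian x)"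
  have gdiff: "gaussian differentiable (at x)" for x :: "real^'n"
    using has_derivative_gaussian differentiable_def by blast
  have diff: "?C h \<Longrightarrow> h differentiable (at x)" for h x
    using gdiff tanh_polynomial_partial by (fastforce intro: differentiable_mult)
  have step: "?C (partial i h)" if "?C h" for h i
  proof -
    from that obtain f where f: "tanh_polynomial f" and h: "h = (\<lambda>x. f x * gaussian x)"
      by blast
    have "partial i h = (\<lambda>x. (f x * ((- 2) * of_real (x \<bullet> axis i 1)) + partial i f x) * gaussian x)"
      unfolding h using gdiff tanh_polynomial_partial[OF f]
      by (subst partial_mult) (auto simp: partial_eqI[OF has_derivative_gaussian] algebra_simps)
    moreover have "tanh_polynomial (\<lambda>x. f x * ((- 2) * of_real (x \<bullet> axis i 1)) + partial i f x)"
      using f tanh_polynomial_partial[OF f]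
      by (intro tanh_polynomial.add tanh_polynomial.mult tanh_polynomial.const tanh_polynomial.coord) auto
    ultimately show ?thesis
      by blast
  qed
  have C: "?C (iter_partial js (\<lambda>x. f x * gaussian x))" for js
  proof (induction js)
    case Nil
    then show ?case
      using assms by auto
  qed (simp add: step)
  have "bounded (range (\<lambda>x. (1 + norm x) ^ N *\<^sub>R h x))" if "?C h" for h N
  proof -
    from that obtain f where f: "tanh_polynomial f" and h: "h = (\<lambda>x. f x * gaussian x)"
      by blast
    obtain C M where C: "0 \<le> C" "\<And>x. norm (f x) \<le> C * (1 + norm x) ^ M"
      using tanh_polynomial_bound[OF f] by blast
    obtain B where B: "\<And>x::real^'n. (1 + norm x) ^ (N + M) * norm (gaussian x) \<le> B"
      using gaussian_decay by blast
    have "norm ((1 + norm x) ^ N *\<^sub>R h x) \<le> C * B" for x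
    proof -
      have "norm ((1 + norm x) ^ N *\<^sub>R h x) = (1 + norm x) ^ N * (norm (f x) * norm (gaussian x))"
        by (simp add: h norm_mult)
      also have "\<dots> \<le> (1 + norm x) ^ N * ((C * (1 + norm x) ^ M) * norm (gaussian x))"
        using C by (intro mult_left_mono mult_right_mono) auto
      also have "\<dots> = C * ((1 + norm x) ^ (N + M) * norm (gaussian x))"
        by (simp add: power_add)
      also have "\<dots> \<le> C * B"
        using C B by (intro mult_left_mono) auto
      finally show ?thesis .
    qed
    then show ?thesis
      by (auto simp: bounded_iff)
  qed
  moreover have "smooth (\<lambda>x. f x * gaussian x)"
    by (rule smooth_coinduct[of ?C]) (use assms diff step in blast)+
  ultimately show ?thesis
    using C by (auto simp: schwartz_def)
qed

section \<open>Uniqueness of representing functions\<close>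

text \<open>Boxes are closed under intersection and generate the Borel sets, so vanishing passes to
  all Borel sets by Dynkin's argument, and a density whose integrals all vanish is zero a.e.\<close>

lemma AE_zero_if_box_integrals_zero:
  fixes f :: "'a::euclidean_space \<Rightarrow> 'b::{banach, second_countable_topology}"
  assumes f: "integrable lborel f"
    and box: "\<And>a b. (LINT x:box a b|lborel. f x) = 0"
  shows "AE x in lborel. f x = 0"
proof (rule sigma_finite_measure.density_zero[OF sigma_finite_lborel f])
  let ?G = "range (\<lambda>(a, b). box a b :: 'a set)"
  have sets_eq: "sets lborel = sigma_sets UNIV ?G"
    by (simp add: borel_eq_box)
  have si: "set_integrable lborel A f" if "A \<in> sets lborel" for A
    unfolding set_integrable_def using f that by (intro integrable_mult_indicator) auto
  \<comment> \<open>The whole space is not a box, but the complement case needs its integral; it is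
    the limit over an increasing exhaustion by boxes.\<close>
  have "(LINT x:UNIV|lborel. f x) = 0"
  proof (rule LIMSEQ_unique)
    let ?B = "\<lambda>i::nat. box (- (real i *\<^sub>R One)) (real i *\<^sub>R One) :: 'a set"
    have "(\<lambda>i. LINT x:?B i|lborel. f x) \<longlonglongrightarrow> (LINT x:(\<Union>i. ?B i)|lborel. f x)"
    proof (rule set_integral_cont_up)
      show "incseq ?B"
        by (auto simp: incseq_def box_def)
    qed (auto intro!: si)
    then show "(\<lambda>i. LINT x:?B i|lborel. f x) \<longlonglongrightarrow> (LINT x:UNIV|lborel. f x)"
      by (simp only: UN_box_eq_UNIV)
    show "(\<lambda>i. LINT x:?B i|lborel. f x) \<longlonglongrightarrow> 0"
      by (simp add: box)
  qed
  fix A :: "'a set" assume "A \<in> sets lborel"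
  then have A: "A \<in> sigma_sets UNIV ?G"
    by (simp only: sets_eq)
  have "Int_stable ?G" "?G \<subseteq> Pow UNIV"
    by (auto simp: Int_stable_def box_Int_box)
  from this A show "(LINT x:A|lborel. f x) = 0"
  proof (induction A rule: sigma_sets_induct_disjoint)
    case (basic A)
    then show ?case
      using box by auto
  next
    case (compl A)
    then have A: "A \<in> sets lborel"
      by (simp only: sets_eq)
    then have "(LINT x:UNIV - A \<union> A|lborel. f x) = (LINT x:UNIV - A|lborel. f x) + (LINT x:A|lborel. f x)"
      by (intro set_integral_Un si) auto
    then show ?case
      using compl \<open>(LINT x:UNIV|lborel. f x) = 0\<close> by simp
  next
    case (union A)
    then have A: "A i \<in> sets lborel" for i
      unfolding sets_eq by blast
    have "(LINT x:(\<Union>i. A i)|lborel. f x) = (\<Sum>i. (LINT x:A i|lborel. f x))"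
      using union(1) A by (intro lebesgue_integral_countable_add si) (auto simp: disjoint_family_on_def)
    then show ?case
      using union by simp
  qed (simp add: set_lebesgue_integral_def)
qed

text \<open>The slope \<open>j ^ 2\<close> has to outgrow the shift \<open>j\<close>, so that every
  \<open>t > 0\<close> still reaches 1 in the limit.\<close>

definition smooth_step :: "nat \<Rightarrow> real \<Rightarrow> real" where
  "smooth_step j t = (1 + tanh (real j ^ 2 * t - real j)) / 2"

lemma smooth_step_bounds: "0 \<le> smooth_step j t" "smooth_step j t \<le> 1"
  using tanh_real_bounds[of "real j ^ 2 * t - real j"] by (auto simp: smooth_step_def)

text \<open>The shift by \<open>- j\<close> makes the limit at the jump equal to 0, so that products of steps
  converge to indicators of open boxes at every point.\<close>

lemma smooth_step_tendsto: "(\<lambda>j. smooth_step j t) \<longlonglongrightarrow> (if 0 < t then 1 else 0)"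
proof (cases "0 < t")
  case True
  have "filterlim (\<lambda>j. real j * (real j * t - 1)) at_top sequentially"
    using True
    by (intro filterlim_at_top_mult_at_top filterlim_real_sequentially filterlim_tendsto_add_at_top[where f = "\<lambda>_. -1", simplified]
        filterlim_at_top_mult_tendsto_pos[where c = t]) auto
  then have "(\<lambda>j. tanh (real j ^ 2 * t - real j)) \<longlonglongrightarrow> 1"
    by (intro filterlim_compose[OF tanh_real_at_top]) (simp add: power2_eq_square algebra_simps)
  then have "(\<lambda>j. smooth_step j t) \<longlonglongrightarrow> (1 + 1) / 2"
    unfolding smooth_step_def by (intro tendsto_intros) auto
  with True show ?thesis
    by simp
next
  case False
  have "filterlim (\<lambda>j. real j ^ 2 * t - real j) at_bot sequentially"
  proof (rule filterlim_at_bot_mono)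
    show "filterlim (\<lambda>j. - real j) at_bot sequentially"
      by (intro filterlim_uminus_at_bot_at_top[THEN filterlim_compose] filterlim_real_sequentially)
    show "\<forall>\<^sub>F j in sequentially. real j ^ 2 * t - real j \<le> - real j"
      using False by (intro always_eventually) (auto simp: mult_nonneg_nonpos)
  qed
  then have "(\<lambda>j. tanh (real j ^ 2 * t - real j)) \<longlonglongrightarrow> -1"
    by (rule filterlim_compose[OF tanh_real_at_bot])
  then have "(\<lambda>j. smooth_step j t) \<longlonglongrightarrow> (1 + -1) / 2"
    unfolding smooth_step_def by (intro tendsto_intros) auto
  with False show ?thesis
    by simp
qed

lemma tanh_polynomial_prod:
  assumes "finite A" "\<And>i. i \<in> A \<Longrightarrow> tanh_polynomial (f i)"
  shows "tanh_polynomial (\<lambda>x. \<Prod>i\<in>A. f i x)"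
  using assms by (induction A) (auto intro: tanh_polynomial.const tanh_polynomial.mult)

definition smooth_box :: "nat \<Rightarrow> real^'n \<Rightarrow> real^'n \<Rightarrow> real^'n \<Rightarrow> real" where
  "smooth_box j a b x = (\<Prod>i\<in>UNIV. smooth_step j (x $ i - a $ i) * smooth_step j (b $ i - x $ i))"

lemma smooth_box_bounds: "0 \<le> smooth_box j a b x" "smooth_box j a b x \<le> 1"
  unfolding smooth_box_def
  by (auto intro!: prod_nonneg prod_le_1 mult_le_one simp: smooth_step_bounds)

lemma smooth_box_tendsto: "(\<lambda>j. smooth_box j a b x) \<longlonglongrightarrow> indicator (box a b) x"
proof -
  have "(\<lambda>j. smooth_box j a b x) \<longlonglongrightarrow>
      (\<Prod>i\<in>UNIV. (if 0 < x $ i - a $ i then 1 else 0) * (if 0 < b $ i - x $ i then 1 else (0::real)))"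
    unfolding smooth_box_def by (intro tendsto_intros smooth_step_tendsto)
  moreover have "(\<Prod>i\<in>UNIV. (if 0 < x $ i - a $ i then 1 else 0) * (if 0 < b $ i - x $ i then 1 else (0::real)))
      = indicator (box a b) x"
    by (auto simp: indicator_def mem_box_cart not_less) (meson leD)
  ultimately show ?thesis
    by simp
qed

lemma tanh_polynomial_smooth_box: "tanh_polynomial (\<lambda>x. complex_of_real (smooth_box j a b x))"
proof -
  have step: "tanh_polynomial (\<lambda>x. complex_of_real (smooth_step j (x \<bullet> e + c)))" for e :: "real^'n" and c
  proof -
    have "tanh_polynomial (\<lambda>x. (1 / 2) * (1 + complex_of_real (tanh (x \<bullet> (real j ^ 2 *\<^sub>R e) + (real j ^ 2 * c - real j)))))"
      by (intro tanh_polynomial.mult tanh_polynomial.add tanh_polynomial.const tanh_polynomial.tanh)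
    then show ?thesis
      by (simp add: smooth_step_def algebra_simps add_divide_distrib)
  qed
  have "tanh_polynomial (\<lambda>x. complex_of_real (smooth_step j (x \<bullet> axis i 1 + - a $ i)) * complex_of_real (smooth_step j (x \<bullet> (- axis i 1) + b $ i)))" for i
    by (intro tanh_polynomial.mult step)
  then have "tanh_polynomial (\<lambda>x. complex_of_real (smooth_step j (x $ i - a $ i)) * complex_of_real (smooth_step j (b $ i - x $ i)))" for i
    by (simp add: inner_axis algebra_simps)
  then show ?thesis
    unfolding smooth_box_def of_real_prod of_real_mult by (intro tanh_polynomial_prod) auto
qed

text \<open>The function \<open>w * gaussian\<close> is integrable because the Gaussian is itself a
  test function. Smoothed boxes times the Gaussian are test functions bounded by it, so dominated
  convergence makes the integrals of \<open>w * gaussian\<close> over boxes vanish; the Gaussian has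
  no zeros, hence \<open>w\<close> is zero a.e.\<close>

lemma AE_zero_if_schwartz_integrals_zero:
  fixes w :: "real^'n \<Rightarrow> complex"
  assumes [measurable]: "w \<in> borel_measurable borel"
    and int: "\<And>\<phi>. \<phi> \<in> schwartz \<Longrightarrow> integrable lborel (\<lambda>x. w x * \<phi> x)"
    and zero: "\<And>\<phi>. \<phi> \<in> schwartz \<Longrightarrow> (LINT x|lborel. w x * \<phi> x) = 0"
  shows "AE x in lborel. w x = 0"
proof -
  have gauss: "gaussian \<in> schwartz"
    using schwartz_tanh_polynomial_gaussian[OF tanh_polynomial.const[of 1]] by simp
  have [measurable]: "gaussian \<in> borel_measurable borel"
    by (simp add: gaussian_def[abs_def])
  have [measurable]: "smooth_box j a b \<in> borel_measurable borel" for j and a b :: "real^'n"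
    unfolding smooth_box_def[abs_def] smooth_step_def tanh_def sinh_def cosh_def by measurable
  have "AE x in lborel. w x * gaussian x = 0"
  proof (rule AE_zero_if_box_integrals_zero)
    fix a b :: "real^'n"
    have "(\<lambda>j. LINT x|lborel. w x * (of_real (smooth_box j a b x) * gaussian x))
        \<longlonglongrightarrow> (LINT x|lborel. indicator (box a b) x *\<^sub>R (w x * gaussian x))"
    proof (rule integral_dominated_convergence)
      show "integrable lborel (\<lambda>x. norm (w x * gaussian x))"
        using int[OF gauss] by (rule integrable_norm)
      show "AE x in lborel. (\<lambda>j. w x * (of_real (smooth_box j a b x) * gaussian x))
          \<longlonglongrightarrow> indicator (box a b) x *\<^sub>R (w x * gaussian x)"
      proof (rule AE_I2)
        fix x
        have "(\<lambda>j. smooth_box j a b x *\<^sub>R (w x * gaussian x)) \<longlonglongrightarrow> indicator (box a b) x *\<^sub>R (w x * gaussian x)"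
          by (intro tendsto_intros smooth_box_tendsto)
        then show "(\<lambda>j. w x * (of_real (smooth_box j a b x) * gaussian x))
          \<longlonglongrightarrow> indicator (box a b) x *\<^sub>R (w x * gaussian x)"
          by (simp add: scaleR_conv_of_real[where 'a = complex] mult_ac)
      qed
      show "AE x in lborel. norm (w x * (of_real (smooth_box j a b x) * gaussian x)) \<le> norm (w x * gaussian x)" for j
      proof (rule AE_I2)
        fix x
        have "smooth_box j a b x * norm (w x * gaussian x) \<le> 1 * norm (w x * gaussian x)"
          by (intro mult_right_mono smooth_box_bounds) auto
        then show "norm (w x * (of_real (smooth_box j a b x) * gaussian x)) \<le> norm (w x * gaussian x)"
          using smooth_box_bounds(1)[of j a b x] by (simp add: norm_mult mult_ac)
      qed
    qed measurable
    moreover have "(LINT x|lborel. w x * (of_real (smooth_box j a b x) * gaussian x)) = 0" for j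
      by (intro zero schwartz_tanh_polynomial_gaussian tanh_polynomial_smooth_box)
    ultimately show "(LINT x:box a b|lborel. w x * gaussian x) = 0"
      unfolding set_lebesgue_integral_def by (simp add: LIMSEQ_const_iff)
  qed (rule int[OF gauss])
  then show ?thesis
    by (simp add: gaussian_def)
qed

section \<open>Representing functions: Borel versions and uniqueness\<close>

lemma schwartz_measurable: "\<phi> \<in> schwartz \<Longrightarrow> \<phi> \<in> borel_measurable borel"
  by (auto simp: schwartz_def intro: smooth_measurable)

lemma schwartz_decay:
  fixes \<phi> :: "real^'n \<Rightarrow> complex"
  assumes "\<phi> \<in> schwartz"
  obtains C where "0 \<le> C" "\<And>x. norm (\<phi> x) \<le> C * decay 1 x"
proof -
  have "bounded (range (\<lambda>x. (1 + norm x) ^ (DIM(real^'n) + 1) *\<^sub>R iter_partial [] \<phi> x))"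
    using assms unfolding schwartz_def by blast
  then obtain C where C: "\<And>x. norm ((1 + norm x) ^ (DIM(real^'n) + 1) *\<^sub>R \<phi> x) \<le> C"
    by (auto simp: bounded_iff)
  show thesis
  proof
    show "0 \<le> C"
      using C[of 0] norm_ge_zero order_trans by blast
    show "norm (\<phi> x) \<le> C * decay 1 x" for x
    proof -
      have "0 < (1 + norm x) ^ (DIM(real^'n) + 1)"
        by (intro zero_less_power add_pos_nonneg) auto
      with C[of x] show ?thesis
        by (simp add: decay_def field_simps del: power_Suc power_Suc2 Suc_eq_plus1 add_Suc_right)
    qed
  qed
qed

text \<open>\<open>represents\<close> speaks of Lebesgue measurability, whereas Fubini's theorem is
  applied on products of \<open>lborel\<close>; a Borel function that agrees a.e. bridges the
  two.\<close>

lemma lebesgue_measurable_borel_version: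
  fixes h :: "'a::euclidean_space \<Rightarrow> complex"
  assumes "h \<in> borel_measurable lebesgue"
  obtains h' where "h' \<in> borel_measurable borel" "AE x in lborel. h x = h' x"
proof -
  have "(\<lambda>x. Re (h x)) \<in> borel_measurable lebesgue" "(\<lambda>x. Im (h x)) \<in> borel_measurable lebesgue"
    using assms by measurable
  then obtain u v where [measurable]: "u \<in> borel_measurable lborel" "v \<in> borel_measurable lborel"
    and "AE x in lborel. Re (h x) = u x" "AE x in lborel. Im (h x) = v x"
    using completion_ex_borel_measurable_real by metis
  then have "AE x in lborel. h x = Complex (u x) (v x)"
    by (auto simp: complex_eq_iff)
  moreover have "(\<lambda>x. Complex (u x) (v x)) \<in> borel_measurable borel"
    unfolding Complex_eq by measurable
  ultimately show thesis
    using that by blast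
qed

lemma AE_lebesgue_iff: "(AE x in lebesgue. P x) \<longleftrightarrow> (AE x in lborel. P x)"
  by (rule AE_completion_iff)

lemma represents_borelI:
  fixes h :: "real^'n \<Rightarrow> complex"
  assumes [measurable]: "h \<in> borel_measurable borel"
    and "\<And>\<phi>. \<phi> \<in> schwartz \<Longrightarrow> integrable lborel (\<lambda>x. h x * \<phi> x)"
    and "\<And>\<phi>. \<phi> \<in> schwartz \<Longrightarrow> u \<phi> = (LINT x|lborel. h x * \<phi> x)"
  shows "represents h u"
  unfolding represents_def dist_of_fun_def
proof (intro conjI ballI)
  show "h \<in> borel_measurable lebesgue"
    by (simp add: measurable_completion)
  fix \<phi> :: "real^'n \<Rightarrow> complex" assume \<phi>: "\<phi> \<in> schwartz"
  then have [measurable]: "\<phi> \<in> borel_measurable borel"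
    by (rule schwartz_measurable)
  show "integrable lebesgue (\<lambda>x. h x * \<phi> x)" "u \<phi> = (LINT x|lebesgue. h x * \<phi> x)"
    using assms(2,3)[OF \<phi>] by (auto simp: integrable_completion integral_completion)
qed

lemma represents_borel_version:
  fixes h :: "real^'n \<Rightarrow> complex"
  assumes h: "represents h u" and [measurable]: "h' \<in> borel_measurable borel"
    and eq: "AE x in lborel. h x = h' x" and \<phi>: "\<phi> \<in> schwartz"
  shows "integrable lborel (\<lambda>x. h' x * \<phi> x)" "u \<phi> = (LINT x|lborel. h' x * \<phi> x)"
proof -
  have [measurable]: "\<phi> \<in> borel_measurable borel" "h \<in> borel_measurable lebesgue"
    using \<phi> h by (auto simp: represents_def intro: schwartz_measurable)
  have ae: "AE x in lebesgue. h x * \<phi> x = h' x * \<phi> x"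
    using eq unfolding AE_lebesgue_iff by eventually_elim simp
  have m: "(\<lambda>x. h x * \<phi> x) \<in> borel_measurable lebesgue" "(\<lambda>x. h' x * \<phi> x) \<in> borel_measurable lebesgue"
    by (intro borel_measurable_times measurable_completion[of \<phi>] measurable_completion[of h']; simp)+
  have "integrable lebesgue (\<lambda>x. h x * \<phi> x)" "u \<phi> = (LINT x|lebesgue. h x * \<phi> x)"
    using h \<phi> by (auto simp: represents_def dist_of_fun_def)
  then show "integrable lborel (\<lambda>x. h' x * \<phi> x)" "u \<phi> = (LINT x|lborel. h' x * \<phi> x)"
    using integrable_cong_AE[OF m ae] integral_cong_AE[OF m ae]
    by (simp_all add: integrable_completion integral_completion)
qed

text \<open>The difference of Borel versions integrates to zero against every Schwartz function.
  This gives meaning to the infimum in \<open>Lp_norm_pow\<close>, whose members all coincide, and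
  to the description in \<open>cont_rep\<close>.\<close>

lemma represents_unique:
  fixes h h' :: "real^'n \<Rightarrow> complex"
  assumes "represents h u" "represents h' u"
  shows "AE x in lborel. h x = h' x"
proof -
  obtain k where k: "k \<in> borel_measurable borel" "AE x in lborel. h x = k x"
    using assms(1) lebesgue_measurable_borel_version unfolding represents_def by blast
  obtain k' where k': "k' \<in> borel_measurable borel" "AE x in lborel. h' x = k' x"
    using assms(2) lebesgue_measurable_borel_version unfolding represents_def by blast
  note [measurable] = k(1) k'(1)
  note * = represents_borel_version[OF assms(1) k] represents_borel_version[OF assms(2) k']
  have "AE x in lborel. k x - k' x = 0"
  proof (rule AE_zero_if_schwartz_integrals_zero)
    show "integrable lborel (\<lambda>x. (k x - k' x) * \<phi> x)" "(LINT x|lborel. (k x - k' x) * \<phi> x) = 0"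
      if "\<phi> \<in> schwartz" for \<phi>
      using *[OF that] by (auto simp: left_diff_distrib)
  qed measurable
  then show ?thesis
    using k(2) k'(2) by eventually_elim simp
qed

text \<open>Two continuous representatives differ on an open null set, which is empty.\<close>

lemma cont_rep_eqI:
  fixes h :: "real^'n \<Rightarrow> complex"
  assumes "continuous_on UNIV h" "represents h u"
  shows "cont_rep u = h"
  unfolding cont_rep_def
proof (rule the_equality)
  fix h' :: "real^'n \<Rightarrow> complex" assume h': "continuous_on UNIV h' \<and> represents h' u"
  show "h' = h"
  proof (rule ccontr)
    assume "h' \<noteq> h"
    then obtain x where x: "h' x - h x \<noteq> 0"
      by auto
    have "open ((\<lambda>x. h' x - h x) -` (- {0}))"
      using h' assms by (intro open_vimage continuous_intros) auto
    moreover have "AE x in lborel. x \<notin> (\<lambda>x. h' x - h x) -` (- {0})"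
      using represents_unique[of h' u h] h' assms by auto
    ultimately have "(\<lambda>x. h' x - h x) -` (- {0}) \<in> null_sets lborel"
      by (subst AE_iff_null_sets) (auto intro: borel_open)
    moreover have "(\<lambda>x. h' x - h x) -` (- {0}) \<noteq> {}"
      using x by auto
    ultimately show False
      using \<open>open _\<close> open_not_negligible null_sets_completionI negligible_iff_null_sets by blast
  qed
qed (use assms in simp)

lemma Lp_norm_pow_eq:
  fixes h :: "real^'n \<Rightarrow> complex"
  assumes "represents h u"
  shows "Lp_norm_pow p u = (\<integral>\<^sup>+ x. ennreal (norm (h x) powr p) \<partial>lebesgue)"
proof -
  have "(\<integral>\<^sup>+ x. ennreal (norm (h' x) powr p) \<partial>lebesgue) = (\<integral>\<^sup>+ x. ennreal (norm (h x) powr p) \<partial>lebesgue)"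
    if "represents h' u" for h'
    unfolding nn_integral_completion
  proof (rule nn_integral_cong_AE)
    show "AE x in lborel. ennreal (norm (h' x) powr p) = ennreal (norm (h x) powr p)"
      using represents_unique[OF that assms] by eventually_elim simp
  qed
  then show ?thesis
    unfolding Lp_norm_pow_def
  proof (intro INF_eq_const)
    show "{h. represents h u} \<noteq> {}"
      using assms by blast
  qed blast
qed

section \<open>Kernels of smooth multipliers\<close>

text \<open>The derivative is taken at parameter 0 only, but at every base point, so translation
  along \<open>e\<close> supplies the other parameters.\<close>

definition has_directional_derivative ::
  "('a::euclidean_space \<Rightarrow> complex) \<Rightarrow> 'a \<Rightarrow> ('a \<Rightarrow> complex) \<Rightarrow> bool" where
  "has_directional_derivative v e D \<longleftrightarrow>
    (\<forall>x. ((\<lambda>t. v (x + t *\<^sub>R e)) has_vector_derivative D x) (at 0))"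

lemma has_directional_derivative_at:
  assumes "has_directional_derivative v e D"
  shows "((\<lambda>t. v (x + t *\<^sub>R e)) has_vector_derivative D (x + \<tau> *\<^sub>R e)) (at \<tau>)"
proof -
  have "((\<lambda>t. v ((x + \<tau> *\<^sub>R e) + t *\<^sub>R e)) has_vector_derivative D (x + \<tau> *\<^sub>R e)) (at (\<tau> - \<tau>))"
    using assms by (simp add: has_directional_derivative_def)
  then have "((\<lambda>t. v ((x + \<tau> *\<^sub>R e) + t *\<^sub>R e)) \<circ> (\<lambda>t. t - \<tau>) has_vector_derivative 1 *\<^sub>R D (x + \<tau> *\<^sub>R e)) (at \<tau>)"
    by (rule vector_diff_chain_at[rotated]) (auto intro!: derivative_eq_intros)
  moreover have "(\<lambda>t. v ((x + \<tau> *\<^sub>R e) + t *\<^sub>R e)) \<circ> (\<lambda>t. t - \<tau>) = (\<lambda>t. v (x + t *\<^sub>R e))"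
    by (auto simp: algebra_simps)
  ultimately show ?thesis
    by simp
qed

lemma directional_mean_value:
  assumes "has_directional_derivative v e D" "0 < t"
  shows "\<exists>\<tau>. 0 < \<tau> \<and> \<tau> < t \<and> norm (v (x + t *\<^sub>R e) - v x) \<le> t * norm (D (x + \<tau> *\<^sub>R e))"
proof -
  have "\<exists>\<tau>\<in>{0<..<t}. norm (v (x + t *\<^sub>R e) - v (x + 0 *\<^sub>R e)) \<le> norm ((t - 0) *\<^sub>R D (x + \<tau> *\<^sub>R e))"
  proof (rule mvt_general)
    show "continuous_on {0..t} (\<lambda>t. v (x + t *\<^sub>R e))"
      by (intro continuous_at_imp_continuous_on ballI)
        (rule has_vector_derivative_continuous[OF has_directional_derivative_at[OF assms(1)]])
    show "((\<lambda>t. v (x + t *\<^sub>R e)) has_derivative (\<lambda>h. h *\<^sub>R D (x + \<tau> *\<^sub>R e))) (at \<tau>)" for \<tau>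
      using has_directional_derivative_at[OF assms(1)] by (simp add: has_vector_derivative_def)
  qed (use assms in simp)
  then show ?thesis
    using assms by auto
qed

lemma integral_lborel_shift:
  fixes f :: "'a::euclidean_space \<Rightarrow> 'b::{banach, second_countable_topology}"
  assumes [measurable]: "f \<in> borel_measurable borel"
  shows "(LINT x|lborel. f (c + x)) = (LINT x|lborel. f x)"
proof -
  have "(LINT x|lborel. f x) = (LINT x|distr lborel borel ((+) c). f x)"
    by (simp only: lborel_distr_plus)
  also have "\<dots> = (LINT x|lborel. f (c + x))"
    by (intro integral_distr) auto
  finally show ?thesis ..
qed

lemma integrable_lborel_shift:
  fixes f :: "'a::euclidean_space \<Rightarrow> 'b::{banach, second_countable_topology}"
  assumes "integrable lborel f"
  shows "integrable lborel (\<lambda>x. f (c + x))"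
proof -
  have "integrable (distr lborel borel ((+) c)) f"
    using assms by (simp only: lborel_distr_plus)
  then show ?thesis
    by (subst (asm) integrable_distr_eq) (use assms in auto)
qed

lemma integral_lborel_scale:
  fixes f :: "'a::euclidean_space \<Rightarrow> 'b::{banach, second_countable_topology}"
  assumes [measurable]: "f \<in> borel_measurable borel" and "0 < c"
  shows "(LINT x|lborel. f x) = c ^ DIM('a) *\<^sub>R (LINT x|lborel. f (c *\<^sub>R x))"
proof -
  have "(LINT x|lborel. f x) = (LINT x|density (distr lborel borel (\<lambda>x. 0 + c *\<^sub>R x)) (\<lambda>_. ennreal (\<bar>c\<bar> ^ DIM('a))). f x)"
    using lborel_affine[of c "0 :: 'a"] assms by simp
  also have "\<dots> = (LINT x|distr lborel borel (\<lambda>x. 0 + c *\<^sub>R x). (\<bar>c\<bar> ^ DIM('a)) *\<^sub>R f x)"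
    using assms by (intro integral_density) auto
  also have "\<dots> = (LINT x|lborel. (\<bar>c\<bar> ^ DIM('a)) *\<^sub>R f (0 + c *\<^sub>R x))"
    by (intro integral_distr) auto
  finally show ?thesis
    using assms by simp
qed

lemma integrable_decay_bound:
  fixes v :: "'a::euclidean_space \<Rightarrow> 'b::{banach, second_countable_topology}"
  assumes "v \<in> borel_measurable borel" "\<And>x. norm (v x) \<le> C * decay 1 x"
  shows "integrable lborel v"
proof (rule Bochner_Integration.integrable_bound)
  show "integrable lborel (\<lambda>x :: 'a. C * decay 1 x)"
    by (intro integrable_mult_right integrable_decay) auto
  have "0 \<le> C * decay 1 x" for x :: 'a
    using assms(2)[of x] norm_ge_zero order_trans by blast
  then show "AE x in lborel. norm (v x) \<le> norm (C * decay 1 x)"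
    using assms(2) by (intro AE_I2) (simp add: abs_of_nonneg)
qed (use assms in auto)

text \<open>By translation invariance the difference quotients integrate to zero.\<close>

lemma integral_directional_derivative:
  fixes v D :: "'a::euclidean_space \<Rightarrow> complex"
  assumes deriv: "has_directional_derivative v e D"
    and [measurable]: "v \<in> borel_measurable borel" "D \<in> borel_measurable borel"
    and v: "\<And>x. norm (v x) \<le> C * decay 1 x" and D: "\<And>x. norm (D x) \<le> C' * decay 1 x"
  shows "(LINT x|lborel. D x) = 0"
proof -
  \<comment> \<open>Steps tending to zero with \<open>t k * norm e \<le> 1\<close>, so that
    \<open>decay_shift\<close> dominates all difference quotients by one integrable
    function.\<close>
  define t where "t k = inverse (real (Suc k)) / (1 + norm e)" for k
  have t: "0 < t k" "t k * norm e \<le> 1" for k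
  proof -
    show "0 < t k"
      by (simp add: t_def add_pos_nonneg)
    have "inverse (real (Suc k)) * norm e \<le> 1 * norm e"
      by (intro mult_right_mono) (auto simp: field_simps)
    then show "t k * norm e \<le> 1"
      by (simp add: t_def divide_le_eq add_pos_nonneg)
  qed
  have t0: "t \<longlonglongrightarrow> 0"
    using tendsto_mult[OF LIMSEQ_inverse_real_of_nat tendsto_const[of "1 / (1 + norm e)"]]
    by (simp add: t_def[abs_def])
  have C': "0 \<le> C'"
    using order_trans[OF norm_ge_zero D[of 0]] by (simp add: decay_def)
  let ?q = "\<lambda>k x. (v (x + t k *\<^sub>R e) - v x) /\<^sub>R t k"
  have v_int: "integrable lborel v"
    using v by (intro integrable_decay_bound) auto
  have "(\<lambda>k. LINT x|lborel. ?q k x) \<longlonglongrightarrow> (LINT x|lborel. D x)"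
  proof (rule integral_dominated_convergence)
    show "integrable lborel (\<lambda>x::'a. C' * (2 ^ (DIM('a) + 1) * decay 1 x))"
      by (intro integrable_mult_right integrable_decay) auto
    show "AE x in lborel. (\<lambda>k. ?q k x) \<longlonglongrightarrow> D x"
    proof (rule AE_I2)
      fix x
      have "((\<lambda>s. (v (x + s *\<^sub>R e) - v (x + 0 *\<^sub>R e) - (s - 0) *\<^sub>R D x) /\<^sub>R norm (s - 0)) \<longlongrightarrow> 0) (at 0)"
        using deriv by (auto simp: has_directional_derivative_def has_vector_derivative_def has_derivative_at_within)
      moreover have "filterlim t (at 0) sequentially"
        using t0 t(1) by (auto simp: filterlim_at less_imp_neq intro!: always_eventually) (metis less_irrefl)
      ultimately have "(\<lambda>k. (v (x + t k *\<^sub>R e) - v (x + 0 *\<^sub>R e) - (t k - 0) *\<^sub>R D x) /\<^sub>R norm (t k - 0)) \<longlonglongrightarrow> 0"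
        by (rule filterlim_compose)
      moreover have "(v (x + t k *\<^sub>R e) - v (x + 0 *\<^sub>R e) - (t k - 0) *\<^sub>R D x) /\<^sub>R norm (t k - 0) = ?q k x - D x" for k
        using t(1)[of k] by (simp add: scaleR_diff_right)
      ultimately show "(\<lambda>k. ?q k x) \<longlonglongrightarrow> D x"
        by (simp add: LIM_zero_iff)
    qed
    show "AE x in lborel. norm (?q k x) \<le> C' * (2 ^ (DIM('a) + 1) * decay 1 x)" for k
    proof (rule AE_I2)
      fix x
      obtain \<tau> where \<tau>: "0 < \<tau>" "\<tau> < t k" "norm (v (x + t k *\<^sub>R e) - v x) \<le> t k * norm (D (x + \<tau> *\<^sub>R e))"
        using directional_mean_value[OF deriv t(1)] by blast
      have "norm (?q k x) \<le> norm (D (x + \<tau> *\<^sub>R e))"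
        using \<tau>(3) t(1)[of k] unfolding norm_scaleR by (simp add: pos_divide_le_eq mult.commute flip: divide_inverse_commute)
      also have "\<dots> \<le> C' * decay 1 (x + \<tau> *\<^sub>R e)"
        by (rule D)
      also have "\<dots> \<le> C' * (2 ^ (DIM('a) + 1) * decay 1 x)"
      proof (intro mult_left_mono decay_shift C')
        have "\<tau> * norm e \<le> t k * norm e"
          using \<tau> by (intro mult_right_mono) auto
        then show "1 * norm (x + \<tau> *\<^sub>R e - x) \<le> 1"
          using t(2)[of k] \<tau> by simp
      qed simp
      finally show "norm (?q k x) \<le> C' * (2 ^ (DIM('a) + 1) * decay 1 x)" .
    qed
  qed measurable
  moreover have "(LINT x|lborel. ?q k x) = 0" for k
    using integrable_lborel_shift[OF v_int, of "t k *\<^sub>R e"] v_int integral_lborel_shift[of v "t k *\<^sub>R e"]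
    by (simp add: add.commute)
  ultimately have "(\<lambda>k. 0) \<longlonglongrightarrow> (LINT x|lborel. D x)"
    by (simp only:)
  then show ?thesis
    by (simp add: LIMSEQ_const_iff)
qed

lemma smooth_in_ball_measurable: "smooth_in_ball R f \<Longrightarrow> f \<in> borel_measurable borel"
  by (simp add: smooth_in_ball_def smooth_measurable)

lemma smooth_in_ball_decay:
  fixes f :: "real^'n \<Rightarrow> complex"
  assumes "smooth_in_ball R f"
  obtains C where "0 \<le> C" "\<And>\<xi>. norm (f \<xi>) \<le> C * decay 1 \<xi>"
proof -
  have "compact (f ` cball 0 R)"
    using assms by (intro compact_continuous_image continuous_on_subset[OF smooth_continuous])
      (auto simp: smooth_in_ball_def)
  then obtain B where B: "0 < B" "\<And>\<xi>. norm \<xi> \<le> R \<Longrightarrow> norm (f \<xi>) \<le> B"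
    using compact_imp_bounded bounded_pos by (metis imageI mem_cball_0)
  show thesis
  proof
    show "0 \<le> B * (1 + \<bar>R\<bar>) ^ (DIM(real^'n) + 1)"
      using B by simp
    show "norm (f \<xi>) \<le> B * (1 + \<bar>R\<bar>) ^ (DIM(real^'n) + 1) * decay 1 \<xi>" for \<xi>
    proof (cases "f \<xi> = 0")
      case False
      then have "norm \<xi> \<le> R"
        using assms by (auto simp: smooth_in_ball_def)
      then have "(1 + norm \<xi>) ^ (DIM(real^'n) + 1) \<le> (1 + \<bar>R\<bar>) ^ (DIM(real^'n) + 1)"
        by (intro power_mono) auto
      moreover have "0 < (1 + norm \<xi>) ^ (DIM(real^'n) + 1)"
        by (intro zero_less_power add_pos_nonneg) auto
      ultimately have "1 \<le> (1 + \<bar>R\<bar>) ^ (DIM(real^'n) + 1) * decay 1 \<xi>"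
        unfolding decay_def by (simp only: times_divide_eq_right mult_1 mult_1_right le_divide_eq_1_pos)
      then have "B * 1 \<le> B * ((1 + \<bar>R\<bar>) ^ (DIM(real^'n) + 1) * decay 1 \<xi>)"
        using B by (intro mult_left_mono) auto
      then show ?thesis
        using B(2)[OF \<open>norm \<xi> \<le> R\<close>] by (simp only: mult.assoc)
    qed (use B in simp)
  qed
qed

lemma smooth_in_ball_integrable:
  assumes "smooth_in_ball R f"
  shows "integrable lborel f"
  using smooth_in_ball_decay[OF assms] integrable_decay_bound[OF smooth_in_ball_measurable[OF assms]]
  by metis

section \<open>Inverse Fourier transforms of smooth compactly supported symbols\<close>

lemma cis_measurable [measurable]: "cis \<in> borel_measurable borel"
  by (intro borel_measurable_continuous_onI continuous_on_cis continuous_on_id)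

lemma integrable_cis_mult:
  fixes g :: "'a \<Rightarrow> real"
  assumes "integrable M f" and [measurable]: "g \<in> borel_measurable M"
  shows "integrable M (\<lambda>x. cis (g x) * f x)"
  using assms(1) by (rule Bochner_Integration.integrable_bound) (use assms in \<open>auto simp: norm_mult\<close>)

lemma inv_fourier_eq:
  fixes f :: "real^'n \<Rightarrow> complex"
  assumes [measurable]: "f \<in> borel_measurable borel"
  shows "inv_fourier f x = of_real (1 / (2 * pi) ^ CARD('n)) * (LINT \<xi>|lborel. cis (x \<bullet> \<xi>) * f \<xi>)"
  by (simp add: inv_fourier_def integral_completion)

lemma inv_fourier_add:
  fixes f g :: "real^'n \<Rightarrow> complex"
  assumes f: "integrable lborel f" and g: "integrable lborel g"
  shows "inv_fourier (\<lambda>\<xi>. f \<xi> + c * g \<xi>) x = inv_fourier f x + c * inv_fourier g x"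
proof -
  have "(LINT \<xi>|lborel. cis (x \<bullet> \<xi>) * (f \<xi> + c * g \<xi>))
      = (LINT \<xi>|lborel. cis (x \<bullet> \<xi>) * f \<xi> + c * (cis (x \<bullet> \<xi>) * g \<xi>))"
    by (simp add: algebra_simps)
  also have "\<dots> = (LINT \<xi>|lborel. cis (x \<bullet> \<xi>) * f \<xi>) + c * (LINT \<xi>|lborel. cis (x \<bullet> \<xi>) * g \<xi>)"
    using f g by (subst Bochner_Integration.integral_add) (auto intro!: integrable_cis_mult integrable_mult_right)
  finally show ?thesis
    using borel_measurable_integrable[OF f] borel_measurable_integrable[OF g]
    by (simp add: inv_fourier_eq algebra_simps)
qed

lemma inv_fourier_cmult:
  fixes f :: "real^'n \<Rightarrow> complex"
  assumes "integrable lborel f"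
  shows "inv_fourier (\<lambda>\<xi>. c * f \<xi>) x = c * inv_fourier f x"
  using inv_fourier_add[of "\<lambda>_. 0" f c x] assms by (simp add: inv_fourier_def)

lemma norm_inv_fourier_le:
  fixes f :: "real^'n \<Rightarrow> complex"
  assumes "integrable lborel f"
  shows "norm (inv_fourier f x) \<le> (1 / (2 * pi) ^ CARD('n)) * (LINT \<xi>|lborel. norm (f \<xi>))"
proof -
  have "norm (LINT \<xi>|lborel. cis (x \<bullet> \<xi>) * f \<xi>) \<le> (LINT \<xi>|lborel. norm (cis (x \<bullet> \<xi>) * f \<xi>))"
    by (rule integral_norm_bound)
  then have "norm (LINT \<xi>|lborel. cis (x \<bullet> \<xi>) * f \<xi>) \<le> (LINT \<xi>|lborel. norm (f \<xi>))"
    by (simp add: norm_mult)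
  then have "(1 / (2 * pi) ^ CARD('n)) * norm (LINT \<xi>|lborel. cis (x \<bullet> \<xi>) * f \<xi>) \<le> (1 / (2 * pi) ^ CARD('n)) * (LINT \<xi>|lborel. norm (f \<xi>))"
    by (intro mult_left_mono) auto
  then show ?thesis
    using borel_measurable_integrable[OF assms] by (simp add: inv_fourier_eq norm_mult norm_power norm_divide)
qed

lemma smooth_in_ball_inner_mult:
  "smooth_in_ball R f \<Longrightarrow> smooth_in_ball R (\<lambda>\<xi>. c * of_real (\<xi> \<bullet> e) * f \<xi>)"
  by (intro smooth_in_ball_mult smooth_mult smooth_const smooth_inner)

lemma has_vector_derivative_cis_affine:
  "((\<lambda>t. cis (a + t * b)) has_vector_derivative \<i> * of_real b * cis a) (at 0)"
proof -
  have "((\<lambda>z. exp (\<i> * (of_real a + z * of_real b))) has_field_derivative \<i> * of_real b * cis a) (at (of_real 0))"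
    by (auto intro!: derivative_eq_intros simp: cis_conv_exp)
  from has_vector_derivative_real_field[OF this] show ?thesis
    by (simp add: cis_conv_exp)
qed

text \<open>Integration by parts in frequency: the derivative of
  \<open>cis (x \<bullet> \<xi>) * f \<xi>\<close> along the i-th axis integrates to zero, and the
  phase contributes the factor \<open>\<i> * x $ i\<close>. Iterated, this yields polynomial decay
  of the kernel.\<close>

lemma inv_fourier_partial:
  fixes f :: "real^'n \<Rightarrow> complex"
  assumes f: "smooth_in_ball R f"
  shows "inv_fourier (partial i f) x = - (\<i> * of_real (x $ i)) * inv_fourier f x"
proof -
  let ?e = "axis i 1 :: real^'n"
  let ?c = "\<i> * of_real (x $ i)"
  note f' = smooth_in_ball_partial[OF f, of i]
  note [measurable] = smooth_in_ball_measurable[OF f] smooth_in_ball_measurable[OF f']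
  obtain C where C: "0 \<le> C" "\<And>\<xi>. norm (f \<xi>) \<le> C * decay 1 \<xi>"
    using smooth_in_ball_decay[OF f] by blast
  obtain C' where C': "0 \<le> C'" "\<And>\<xi>. norm (partial i f \<xi>) \<le> C' * decay 1 \<xi>"
    using smooth_in_ball_decay[OF f'] by blast
  have "(LINT \<xi>|lborel. ?c * (cis (x \<bullet> \<xi>) * f \<xi>) + cis (x \<bullet> \<xi>) * partial i f \<xi>) = 0"
  proof (rule integral_directional_derivative)
    show "has_directional_derivative (\<lambda>\<xi>. cis (x \<bullet> \<xi>) * f \<xi>) ?e
        (\<lambda>\<xi>. ?c * (cis (x \<bullet> \<xi>) * f \<xi>) + cis (x \<bullet> \<xi>) * partial i f \<xi>)"
      unfolding has_directional_derivative_def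
    proof
      fix \<xi>
      have "(f has_derivative frechet_derivative f (at \<xi>)) (at (\<xi> + 0 *\<^sub>R ?e))"
        using f smooth_differentiable frechet_derivative_works by (auto simp: smooth_in_ball_def)
      then have "((\<lambda>t. f (\<xi> + t *\<^sub>R ?e)) has_derivative (\<lambda>t. frechet_derivative f (at \<xi>) (t *\<^sub>R ?e))) (at 0)"
        by (rule has_derivative_compose[rotated]) (auto intro!: derivative_eq_intros)
      moreover have "frechet_derivative f (at \<xi>) (t *\<^sub>R ?e) = t *\<^sub>R partial i f \<xi>" for t
        unfolding partial_def using f smooth_differentiable
        by (intro linear_cmul linear_frechet_derivative) (auto simp: smooth_in_ball_def)
      ultimately have df: "((\<lambda>t. f (\<xi> + t *\<^sub>R ?e)) has_vector_derivative partial i f \<xi>) (at 0)"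
        by (simp add: has_vector_derivative_def)
      have "((\<lambda>t. cis (x \<bullet> (\<xi> + t *\<^sub>R ?e))) has_vector_derivative ?c * cis (x \<bullet> \<xi>)) (at 0)"
        using has_vector_derivative_cis_affine[of "x \<bullet> \<xi>" "x $ i"] by (simp add: inner_axis inner_add_right)
      from has_vector_derivative_mult[OF this df]
      show "((\<lambda>t. cis (x \<bullet> (\<xi> + t *\<^sub>R ?e)) * f (\<xi> + t *\<^sub>R ?e)) has_vector_derivative
          ?c * (cis (x \<bullet> \<xi>) * f \<xi>) + cis (x \<bullet> \<xi>) * partial i f \<xi>) (at 0)"
        by (simp add: mult_ac add_ac)
    qed
    show "norm (cis (x \<bullet> \<xi>) * f \<xi>) \<le> C * decay 1 \<xi>" for \<xi>
      using C by (simp add: norm_mult)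
    show "norm (?c * (cis (x \<bullet> \<xi>) * f \<xi>) + cis (x \<bullet> \<xi>) * partial i f \<xi>) \<le> (\<bar>x $ i\<bar> * C + C') * decay 1 \<xi>" for \<xi>
    proof -
      have "norm (?c * (cis (x \<bullet> \<xi>) * f \<xi>) + cis (x \<bullet> \<xi>) * partial i f \<xi>)
          \<le> \<bar>x $ i\<bar> * norm (f \<xi>) + norm (partial i f \<xi>)"
        by (rule order_trans[OF norm_triangle_ineq]) (simp add: norm_mult)
      also have "\<dots> \<le> \<bar>x $ i\<bar> * (C * decay 1 \<xi>) + C' * decay 1 \<xi>"
        using C C' by (intro add_mono mult_left_mono) auto
      finally show ?thesis
        by (simp add: algebra_simps)
    qed
  qed measurable
  then have "?c * (LINT \<xi>|lborel. cis (x \<bullet> \<xi>) * f \<xi>) + (LINT \<xi>|lborel. cis (x \<bullet> \<xi>) * partial i f \<xi>) = 0"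
    using smooth_in_ball_integrable[OF f] smooth_in_ball_integrable[OF f']
    by (subst (asm) Bochner_Integration.integral_add) (auto intro!: integrable_cis_mult integrable_mult_right)
  then have "(LINT \<xi>|lborel. cis (x \<bullet> \<xi>) * partial i f \<xi>) = - ?c * (LINT \<xi>|lborel. cis (x \<bullet> \<xi>) * f \<xi>)"
    by (simp add: add_eq_0_iff)
  then show ?thesis
    by (simp add: inv_fourier_eq)
qed

lemma inv_fourier_coordinate_power:
  fixes f :: "real^'n \<Rightarrow> complex"
  assumes "smooth_in_ball R f"
  shows "\<exists>B. \<forall>x. \<bar>x $ i\<bar> ^ N * norm (inv_fourier f x) \<le> B"
  using assms
proof (induction N arbitrary: f)
  case 0
  then show ?case
    using norm_inv_fourier_le[OF smooth_in_ball_integrable] by auto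
next
  case (Suc N)
  then obtain B where "\<And>x. \<bar>x $ i\<bar> ^ N * norm (inv_fourier (partial i f) x) \<le> B"
    using smooth_in_ball_partial by blast
  then show ?case
    using Suc.prems by (auto simp: inv_fourier_partial norm_mult mult_ac)
qed

text \<open>Each power of a coordinate costs one partial derivative of the symbol. Decay in the norm
  follows because some coordinate is at least \<open>norm x\<close> divided by the
  dimension.\<close>

lemma inv_fourier_decay:
  fixes f :: "real^'n \<Rightarrow> complex"
  assumes f: "smooth_in_ball R f"
  obtains C where "0 \<le> C" "\<And>x. norm (inv_fourier f x) \<le> C * decay 1 x"
proof -
  let ?N = "CARD('n) + 1"
  let ?n = "real CARD('n)"
  have "\<forall>i. \<exists>B. \<forall>x. \<bar>x $ i\<bar> ^ ?N * norm (inv_fourier f x) \<le> B"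
    using inv_fourier_coordinate_power[OF f] by blast
  then obtain B where B: "\<And>i x. \<bar>x $ i\<bar> ^ ?N * norm (inv_fourier f x) \<le> B i"
    by metis
  obtain B0 where B0: "\<And>x. norm (inv_fourier f x) \<le> B0"
    using norm_inv_fourier_le[OF smooth_in_ball_integrable[OF f]] by blast
  have B_nonneg: "0 \<le> B i" for i
    using B[of 0 i] by simp
  have B0_nonneg: "0 \<le> B0"
    using B0[of 0] norm_ge_zero order_trans by blast
  define C where "C = 2 ^ ?N * (B0 + ?n ^ ?N * (\<Sum>i\<in>UNIV. B i))"
  have "(1 + norm x) ^ ?N * norm (inv_fourier f x) \<le> C" for x :: "real^'n"
  proof -
    have "\<exists>i. norm x \<le> ?n * \<bar>x $ i\<bar>"
    proof (rule ccontr)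
      assume "\<nexists>i. norm x \<le> ?n * \<bar>x $ i\<bar>"
      then have "?n * \<bar>x $ i\<bar> < norm x" for i
        by (simp add: not_le)
      then have "(\<Sum>i\<in>UNIV. ?n * \<bar>x $ i\<bar>) < (\<Sum>i\<in>(UNIV::'n set). norm x)"
        by (intro sum_strict_mono) auto
      then show False
        using norm_le_l1_cart[of x] by (simp add: sum_distrib_left[symmetric])
    qed
    then obtain i where i: "norm x \<le> ?n * \<bar>x $ i\<bar>"
      by blast
    have "(1 + norm x) ^ ?N \<le> (2 * max 1 (norm x)) ^ ?N"
      by (intro power_mono) auto
    also have "\<dots> \<le> 2 ^ ?N * (1 + norm x ^ ?N)"
      unfolding power_mult_distrib by (intro mult_left_mono) (auto simp: max_def)
    also have "\<dots> \<le> 2 ^ ?N * (1 + (?n * \<bar>x $ i\<bar>) ^ ?N)"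
      using i by (intro mult_left_mono add_mono power_mono) auto
    finally have "(1 + norm x) ^ ?N * norm (inv_fourier f x)
        \<le> 2 ^ ?N * (1 + (?n * \<bar>x $ i\<bar>) ^ ?N) * norm (inv_fourier f x)"
      by (rule mult_right_mono) simp
    also have "\<dots> = 2 ^ ?N * (norm (inv_fourier f x) + ?n ^ ?N * (\<bar>x $ i\<bar> ^ ?N * norm (inv_fourier f x)))"
      unfolding power_mult_distrib by (simp add: algebra_simps)
    also have "\<dots> \<le> 2 ^ ?N * (B0 + ?n ^ ?N * B i)"
      by (intro mult_left_mono add_mono B B0) auto
    also have "\<dots> \<le> C"
      unfolding C_def by (intro mult_left_mono add_left_mono member_le_sum) (auto simp: B_nonneg)
    finally show ?thesis .
  qed
  moreover have "0 < (1 + norm x) ^ ?N" for x :: "real^'n"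
    by (intro zero_less_power add_pos_nonneg) auto
  ultimately have "norm (inv_fourier f x) \<le> C * decay 1 x" for x
    unfolding decay_def by (simp add: pos_le_divide_eq mult.commute del: power_Suc power_Suc2 Suc_eq_plus1 add_Suc_right)
  moreover have "0 \<le> C"
    unfolding C_def using B_nonneg B0_nonneg by (intro mult_nonneg_nonneg add_nonneg_nonneg sum_nonneg) auto
  ultimately show thesis
    using that by blast
qed

lemma norm_cis_minus_linear: "norm (cis a - 1 - \<i> * of_real a) \<le> a\<^sup>2"
  using Taylor_exp[of "\<i> * of_real a" 1] by (simp add: cis_conv_exp norm_mult algebra_simps power2_eq_square)

text \<open>Differentiation under the integral with an explicit remainder: the second-order error of
  \<open>cis\<close> is at most the square of \<open>t * (\<xi> \<bullet> e)\<close>, which is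
  integrable against the compactly supported symbol.\<close>

lemma inv_fourier_has_directional_derivative:
  fixes f :: "real^'n \<Rightarrow> complex"
  assumes f: "smooth_in_ball R f"
  shows "has_directional_derivative (inv_fourier f) e (inv_fourier (\<lambda>\<xi>. \<i> * of_real (\<xi> \<bullet> e) * f \<xi>))"
  unfolding has_directional_derivative_def has_vector_derivative_def
proof
  fix x
  let ?g = "\<lambda>\<xi>. \<i> * of_real (\<xi> \<bullet> e) * f \<xi>"
  \<comment> \<open>The factors 1 match the shape of \<open>smooth_in_ball_inner_mult\<close>, which
    then yields integrability of the symbol times the square of
    \<open>\<xi> \<bullet> e\<close>.\<close>
  let ?h = "\<lambda>\<xi>. 1 * of_real (\<xi> \<bullet> e) * (1 * of_real (\<xi> \<bullet> e) * f \<xi>)"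
  note g = smooth_in_ball_inner_mult[OF f, of \<i> e]
  note h = smooth_in_ball_inner_mult[OF smooth_in_ball_inner_mult[OF f, of 1 e], of 1 e]
  note [measurable] = smooth_in_ball_measurable[OF f]
  note int = smooth_in_ball_integrable[OF f] smooth_in_ball_integrable[OF g] smooth_in_ball_integrable[OF h]
  define M where "M = (1 / (2 * pi) ^ CARD('n)) * (LINT \<xi>|lborel. norm (?h \<xi>))"
  show "((\<lambda>t. inv_fourier f (x + t *\<^sub>R e)) has_derivative (\<lambda>t. t *\<^sub>R inv_fourier ?g x)) (at 0)"
  proof (rule has_derivativeI_sandwich[where e = 1 and H = "\<lambda>t. \<bar>t\<bar> * M"])
    show "((\<lambda>t. \<bar>t\<bar> * M) \<longlongrightarrow> 0) (at 0)"
      by (auto intro!: tendsto_eq_intros)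
    fix t :: real assume "t \<noteq> 0"
    have int': "integrable lborel (\<lambda>\<xi>. cis ((x + t *\<^sub>R e) \<bullet> \<xi>) * f \<xi>)"
      "integrable lborel (\<lambda>\<xi>. cis (x \<bullet> \<xi>) * f \<xi>)" "integrable lborel (\<lambda>\<xi>. cis (x \<bullet> \<xi>) * ?g \<xi>)"
      by (intro integrable_cis_mult int; measurable)+
    let ?r = "\<lambda>\<xi>. cis ((x + t *\<^sub>R e) \<bullet> \<xi>) * f \<xi> - cis (x \<bullet> \<xi>) * f \<xi> - t *\<^sub>R (cis (x \<bullet> \<xi>) * ?g \<xi>)"
    have "norm (LINT \<xi>|lborel. ?r \<xi>) \<le> (LINT \<xi>|lborel. t\<^sup>2 * norm (?h \<xi>))"
    proof (rule Bochner_Integration.integral_norm_bound_integral)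
      show "integrable lborel (\<lambda>\<xi>. t\<^sup>2 * norm (?h \<xi>))"
        by (intro integrable_mult_right integrable_norm int)
      show "norm (?r \<xi>) \<le> t\<^sup>2 * norm (?h \<xi>)" for \<xi>
      proof -
        have "?r \<xi> = cis (x \<bullet> \<xi>) * f \<xi> * (cis (t * (\<xi> \<bullet> e)) - 1 - \<i> * of_real (t * (\<xi> \<bullet> e)))"
          by (simp add: inner_add_left inner_commute cis_mult[symmetric] scaleR_conv_of_real[where 'a = complex] algebra_simps)
        then have "norm (?r \<xi>) = norm (f \<xi>) * norm (cis (t * (\<xi> \<bullet> e)) - 1 - \<i> * of_real (t * (\<xi> \<bullet> e)))"
          by (simp add: norm_mult)
        also have "\<dots> \<le> norm (f \<xi>) * (t * (\<xi> \<bullet> e))\<^sup>2"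
          by (intro mult_left_mono norm_cis_minus_linear) auto
        also have "\<dots> = t\<^sup>2 * norm (?h \<xi>)"
          by (simp add: norm_mult power_mult_distrib power2_eq_square abs_mult_self_eq[symmetric, of "\<xi> \<bullet> e"] del: abs_mult_self_eq)
        finally show ?thesis .
      qed
    qed (intro Bochner_Integration.integrable_diff int' integrable_scaleR_right)
    then have "norm (LINT \<xi>|lborel. ?r \<xi>) \<le> t\<^sup>2 * (LINT \<xi>|lborel. norm (?h \<xi>))"
      by simp
    moreover have "inv_fourier f (x + t *\<^sub>R e) - inv_fourier f x - t *\<^sub>R inv_fourier ?g x
        = of_real (1 / (2 * pi) ^ CARD('n)) * (LINT \<xi>|lborel. ?r \<xi>)"
      using int' by (simp add: inv_fourier_eq Bochner_Integration.integral_diff Bochner_Integration.integrable_diff right_diff_distrib)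
    ultimately have "norm (inv_fourier f (x + t *\<^sub>R e) - inv_fourier f x - t *\<^sub>R inv_fourier ?g x)
        \<le> (1 / (2 * pi) ^ CARD('n)) * (t\<^sup>2 * (LINT \<xi>|lborel. norm (?h \<xi>)))"
      by (simp add: norm_mult norm_divide norm_power divide_right_mono)
    also have "\<dots> = \<bar>t\<bar> * (\<bar>t\<bar> * M)"
      by (simp add: M_def power2_eq_square)
    finally show "norm (inv_fourier f (x + t *\<^sub>R e) - inv_fourier f (x + 0 *\<^sub>R e) - (t - 0) *\<^sub>R inv_fourier ?g x) / norm (t - 0) \<le> \<bar>t\<bar> * M"
      using \<open>t \<noteq> 0\<close> by (simp add: divide_le_eq mult_ac)
  qed (auto intro: bounded_linear_scaleR_left)
qed

text \<open>Reduces an arbitrary direction to finitely many coordinate symbols, so that the decay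
  constant of the derivative depends on the direction only through its norm.\<close>

lemma inv_fourier_inner_mult:
  fixes f :: "real^'n \<Rightarrow> complex"
  assumes f: "smooth_in_ball R f"
  shows "inv_fourier (\<lambda>\<xi>. \<i> * of_real (\<xi> \<bullet> e) * f \<xi>) x
    = (\<Sum>i\<in>UNIV. of_real (e $ i) * inv_fourier (\<lambda>\<xi>. \<i> * of_real (\<xi> \<bullet> axis i 1) * f \<xi>) x)"
proof -
  have int: "integrable lborel (\<lambda>\<xi>. cis (x \<bullet> \<xi>) * (\<i> * of_real (\<xi> \<bullet> axis i 1) * f \<xi>))" for i
    by (intro integrable_cis_mult smooth_in_ball_integrable[OF smooth_in_ball_inner_mult[OF f]]) measurable
  note [measurable] = smooth_in_ball_measurable[OF f]
  have "(LINT \<xi>|lborel. cis (x \<bullet> \<xi>) * (\<i> * of_real (\<xi> \<bullet> e) * f \<xi>))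
      = (LINT \<xi>|lborel. (\<Sum>i\<in>UNIV. of_real (e $ i) * (cis (x \<bullet> \<xi>) * (\<i> * of_real (\<xi> \<bullet> axis i 1) * f \<xi>))))"
    by (simp add: inner_axis inner_vec_def[of _ e] sum_distrib_left sum_distrib_right mult_ac)
  also have "\<dots> = (\<Sum>i\<in>UNIV. of_real (e $ i) * (LINT \<xi>|lborel. cis (x \<bullet> \<xi>) * (\<i> * of_real (\<xi> \<bullet> axis i 1) * f \<xi>)))"
    by (subst Bochner_Integration.integral_sum) (auto intro!: integrable_mult_right int)
  finally show ?thesis
    by (simp add: inv_fourier_eq sum_distrib_left mult_ac)
qed

text \<open>Mean value estimate on the segment, with \<open>decay_shift\<close> returning the
  intermediate point to \<open>x\<close>. The decay factor stays on the right because the bound is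
  later integrated against functions that are only \<open>L1_plus_bounded\<close>.\<close>

lemma inv_fourier_lipschitz:
  fixes f :: "real^'n \<Rightarrow> complex"
  assumes f: "smooth_in_ball R f"
  obtains C where "0 \<le> C"
    "\<And>x y. norm (y - x) \<le> 1 \<Longrightarrow> norm (inv_fourier f y - inv_fourier f x) \<le> C * norm (y - x) * decay 1 x"
proof -
  let ?g = "\<lambda>e \<xi>. \<i> * of_real (\<xi> \<bullet> e) * f \<xi>"
  have "\<forall>i. \<exists>C. 0 \<le> C \<and> (\<forall>x. norm (inv_fourier (?g (axis i 1)) x) \<le> C * decay 1 x)"
    using inv_fourier_decay[OF smooth_in_ball_inner_mult[OF f]] by metis
  then obtain B where B: "\<And>i. 0 \<le> B i" "\<And>i x. norm (inv_fourier (?g (axis i 1)) x) \<le> B i * decay 1 x"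
    by metis
  let ?S = "\<Sum>i\<in>UNIV. B i"
  have S: "0 \<le> ?S"
    by (intro sum_nonneg B)
  have deriv: "norm (inv_fourier (?g e) x) \<le> norm e * ?S * decay 1 x" for e x
  proof -
    have "norm (inv_fourier (?g e) x) \<le> (\<Sum>i\<in>UNIV. norm e * (B i * decay 1 x))"
      unfolding inv_fourier_inner_mult[OF f, of e]
      by (intro sum_norm_le) (auto simp: norm_mult component_le_norm_cart B intro!: mult_mono)
    then show ?thesis
      by (simp add: sum_distrib_left sum_distrib_right mult_ac)
  qed
  show thesis
  proof
    show "0 \<le> ?S * 2 ^ (CARD('n) + 1)"
      using S by simp
    fix x y :: "real^'n" assume xy: "norm (y - x) \<le> 1"
    let ?e = "y - x"
    obtain \<tau> where \<tau>: "0 < \<tau>" "\<tau> < 1"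
      "norm (inv_fourier f (x + 1 *\<^sub>R ?e) - inv_fourier f x) \<le> 1 * norm (inv_fourier (?g ?e) (x + \<tau> *\<^sub>R ?e))"
      using directional_mean_value[OF inv_fourier_has_directional_derivative[OF f], of 1 x ?e] by auto
    have "norm (inv_fourier f y - inv_fourier f x) \<le> norm ?e * ?S * decay 1 (x + \<tau> *\<^sub>R ?e)"
      using \<tau>(3) deriv[of ?e "x + \<tau> *\<^sub>R ?e"] by simp
    also have "\<dots> \<le> norm ?e * ?S * (2 ^ (CARD('n) + 1) * decay 1 x)"
    proof (intro mult_left_mono)
      have "norm (\<tau> *\<^sub>R ?e) \<le> 1"
        using \<tau> xy by (simp add: mult_le_one)
      then show "decay 1 (x + \<tau> *\<^sub>R ?e) \<le> 2 ^ (CARD('n) + 1) * decay 1 x"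
        using decay_shift[of 1 "x + \<tau> *\<^sub>R ?e" x] by simp
    qed (use S in simp)
    finally show "norm (inv_fourier f y - inv_fourier f x) \<le> ?S * 2 ^ (CARD('n) + 1) * norm (y - x) * decay 1 x"
      by (simp add: mult_ac)
  qed
qed

lemma inv_fourier_continuous:
  fixes f :: "real^'n \<Rightarrow> complex"
  assumes f: "smooth_in_ball R f"
  shows "continuous_on UNIV (inv_fourier f)"
proof -
  obtain C where C: "0 \<le> C"
    "\<And>x y. norm (y - x) \<le> 1 \<Longrightarrow> norm (inv_fourier f y - inv_fourier f x) \<le> C * norm (y - x) * decay 1 x"
    using inv_fourier_lipschitz[OF f] by blast
  have "(inv_fourier f \<longlongrightarrow> inv_fourier f x) (at x)" for x
  proof (rule LIM_zero_cancel, rule Lim_null_comparison)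
    show "((\<lambda>y. C * norm (y - x) * decay 1 x) \<longlongrightarrow> 0) (at x)"
      by (auto intro!: tendsto_eq_intros)
    show "\<forall>\<^sub>F y in at x. norm (inv_fourier f y - inv_fourier f x) \<le> C * norm (y - x) * decay 1 x"
      unfolding eventually_at using C(2) by (intro exI[of _ 1]) (auto simp: dist_norm)
  qed
  then show ?thesis
    by (simp add: continuous_on_eq_continuous_at isCont_def)
qed

lemma inv_fourier_measurable: "smooth_in_ball R f \<Longrightarrow> inv_fourier f \<in> borel_measurable borel"
  by (intro borel_measurable_continuous_onI inv_fourier_continuous)

lemma inv_fourier_integrable: "smooth_in_ball R f \<Longrightarrow> integrable lborel (inv_fourier f)"
  by (rule inv_fourier_decay, assumption)
    (rule integrable_decay_bound, auto intro: inv_fourier_measurable)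

text \<open>For \<open>\<xi>\<^sub>0\<close> outside the support write \<open>f \<xi> = ((\<xi> - \<xi>\<^sub>0) \<bullet> \<xi>\<^sub>0) * h \<xi>\<close> with \<open>h\<close> smooth: then the integrand
  is a directional derivative. This replaces Fourier inversion.\<close>

lemma fourier_inv_fourier_outside:
  fixes f :: "real^'n \<Rightarrow> complex"
  assumes f: "smooth_in_ball R f" and \<xi>0: "R < norm \<xi>0"
  shows "(LINT x|lborel. cis (- (x \<bullet> \<xi>0)) * inv_fourier f x) = 0"
proof -
  let ?a = "\<xi>0 \<bullet> \<xi>0"
  define h where "h = (\<lambda>\<xi>. f \<xi> / of_real (\<xi> \<bullet> \<xi>0 - ?a))"
  \<comment> \<open>The hyperplane through \<open>\<xi>0\<close> orthogonal to it misses the ball,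
    so the linear form by which \<open>f\<close> is divided has no zero on the support.\<close>
  have nz: "\<xi> \<bullet> \<xi>0 \<noteq> ?a" if "norm \<xi> \<le> R" for \<xi>
  proof -
    have "\<xi> \<bullet> \<xi>0 \<le> norm \<xi> * norm \<xi>0"
      by (rule norm_cauchy_schwarz)
    also have "\<dots> < norm \<xi>0 * norm \<xi>0"
      using that \<xi>0 norm_ge_zero[of \<xi>] by (intro mult_strict_right_mono) linarith+
    finally show ?thesis
      by (simp add: power2_norm_eq_inner flip: power2_eq_square)
  qed
  have h: "smooth_in_ball R h"
    unfolding h_def by (rule smooth_in_ball_divide[OF f nz])
  note g = smooth_in_ball_inner_mult[OF h, of \<i> \<xi>0]
  \<comment> \<open>The first summand is the symbol of the derivative of
    \<open>inv_fourier h\<close> along \<open>\<xi>0\<close>, the second comes from differentiating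
    the phase; together they are the two terms of the product rule.\<close>
  have fh: "\<i> * f \<xi> = \<i> * of_real (\<xi> \<bullet> \<xi>0) * h \<xi> + (- \<i> * of_real ?a) * h \<xi>" for \<xi>
  proof (cases "f \<xi> = 0")
    case False
    then have "complex_of_real (\<xi> \<bullet> \<xi>0 - ?a) \<noteq> 0"
      using nz f by (auto simp: smooth_in_ball_def simp del: of_real_diff)
    moreover have "\<i> * of_real (\<xi> \<bullet> \<xi>0) * h \<xi> + (- \<i> * of_real ?a) * h \<xi> = \<i> * (of_real (\<xi> \<bullet> \<xi>0 - ?a) * h \<xi>)"
      by (simp add: algebra_simps)
    ultimately show ?thesis
      by (simp add: h_def)
  qed (simp add: h_def)
  have inv: "\<i> * inv_fourier f x
      = inv_fourier (\<lambda>\<xi>. \<i> * of_real (\<xi> \<bullet> \<xi>0) * h \<xi>) x + (- \<i> * of_real ?a) * inv_fourier h x" for x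
    using inv_fourier_cmult[OF smooth_in_ball_integrable[OF f], of \<i> x]
      inv_fourier_add[OF smooth_in_ball_integrable[OF g] smooth_in_ball_integrable[OF h], of "- \<i> * of_real ?a" x]
    by (simp only: fh)
  obtain C where C: "\<And>x. norm (inv_fourier h x) \<le> C * decay 1 x"
    using inv_fourier_decay[OF h] by blast
  obtain C' where C': "\<And>x. norm (inv_fourier f x) \<le> C' * decay 1 x"
    using inv_fourier_decay[OF f] by blast
  note [measurable] = inv_fourier_measurable[OF f] inv_fourier_measurable[OF h]
  have "(LINT x|lborel. cis (- (x \<bullet> \<xi>0)) * (\<i> * inv_fourier f x)) = 0"
  proof (rule integral_directional_derivative)
    show "has_directional_derivative (\<lambda>x. cis (- (x \<bullet> \<xi>0)) * inv_fourier h x) \<xi>0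
        (\<lambda>x. cis (- (x \<bullet> \<xi>0)) * (\<i> * inv_fourier f x))"
      unfolding has_directional_derivative_def
    proof
      fix x
      have dh: "((\<lambda>t. inv_fourier h (x + t *\<^sub>R \<xi>0)) has_vector_derivative
          inv_fourier (\<lambda>\<xi>. \<i> * of_real (\<xi> \<bullet> \<xi>0) * h \<xi>) x) (at 0)"
        using inv_fourier_has_directional_derivative[OF h, of \<xi>0] by (simp add: has_directional_derivative_def)
      have "((\<lambda>t. cis (- ((x + t *\<^sub>R \<xi>0) \<bullet> \<xi>0))) has_vector_derivative (- \<i> * of_real ?a) * cis (- (x \<bullet> \<xi>0))) (at 0)"
        using has_vector_derivative_cis_affine[of "- (x \<bullet> \<xi>0)" "- ?a"] by (simp add: inner_add_left)
      from has_vector_derivative_mult[OF this dh]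
      show "((\<lambda>t. cis (- ((x + t *\<^sub>R \<xi>0) \<bullet> \<xi>0)) * inv_fourier h (x + t *\<^sub>R \<xi>0)) has_vector_derivative
          cis (- (x \<bullet> \<xi>0)) * (\<i> * inv_fourier f x)) (at 0)"
        unfolding inv by (simp add: algebra_simps)
    qed
    show "norm (cis (- (x \<bullet> \<xi>0)) * inv_fourier h x) \<le> C * decay 1 x" for x
      using C by (simp add: norm_mult)
    show "norm (cis (- (x \<bullet> \<xi>0)) * (\<i> * inv_fourier f x)) \<le> C' * decay 1 x" for x
      using C' by (simp add: norm_mult)
  qed measurable
  then have "\<i> * (LINT x|lborel. cis (- (x \<bullet> \<xi>0)) * inv_fourier f x) = 0"
    by (subst (asm) mult.left_commute) simp
  then show ?thesis
    by simp
qed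

lemma inv_fourier_scale:
  fixes f :: "real^'n \<Rightarrow> complex"
  assumes [measurable]: "f \<in> borel_measurable borel" and "0 < c"
  shows "inv_fourier (\<lambda>\<xi>. f (\<xi> /\<^sub>R c)) x = of_real (c ^ CARD('n)) * inv_fourier f (c *\<^sub>R x)"
proof -
  have "(LINT \<xi>|lborel. cis (x \<bullet> \<xi>) * f (\<xi> /\<^sub>R c))
      = c ^ CARD('n) *\<^sub>R (LINT \<xi>|lborel. cis (x \<bullet> (c *\<^sub>R \<xi>)) * f ((c *\<^sub>R \<xi>) /\<^sub>R c))"
    using \<open>0 < c\<close> by (subst integral_lborel_scale[of _ c]) auto
  then show ?thesis
    using \<open>0 < c\<close> by (simp add: inv_fourier_eq scaleR_conv_of_real[where 'a = complex])
qed

section \<open>Convolution with kernels\<close>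

lemma integrable_product_phase:
  fixes f :: "'a::euclidean_space \<Rightarrow> complex" and g :: "'b::euclidean_space \<Rightarrow> complex"
  assumes f: "integrable lborel f" and g: "integrable lborel g"
    and [measurable]: "case_prod b \<in> borel_measurable (lborel \<Otimes>\<^sub>M lborel)"
  shows "integrable (lborel \<Otimes>\<^sub>M lborel) (\<lambda>(x, y). cis (b x y) * (f x * g y))"
proof (rule lborel_pair.Fubini_integrable)
  note [measurable] = borel_measurable_integrable[OF f] borel_measurable_integrable[OF g]
  show "(\<lambda>(x, y). cis (b x y) * (f x * g y)) \<in> borel_measurable (lborel \<Otimes>\<^sub>M lborel)"
    by measurable
  show "integrable lborel (\<lambda>x. LINT y|lborel. norm (case (x, y) of (x, y) \<Rightarrow> cis (b x y) * (f x * g y)))"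
    using f g by (simp add: norm_mult integrable_mult_left)
  have "b x \<in> borel_measurable borel" for x
    using measurable_Pair2[OF assms(3), of x] by simp
  then show "AE x in lborel. integrable lborel (\<lambda>y. case (x, y) of (x, y) \<Rightarrow> cis (b x y) * (f x * g y))"
    using g by (intro AE_I2) (auto intro!: integrable_cis_mult integrable_mult_right)
qed

text \<open>This class contains \<open>L\<^sup>p\<close> for all \<open>p \<ge> 1\<close>, and its elements can be convolved with kernels
  dominated by \<open>decay 1\<close>; working in it avoids Hoelder's inequality.\<close>

definition L1_plus_bounded :: "('a::euclidean_space \<Rightarrow> complex) \<Rightarrow> bool" where
  "L1_plus_bounded g \<longleftrightarrow> g \<in> borel_measurable borel \<and>
    (\<exists>B W. integrable lborel W \<and> (AE x in lborel. norm (g x) \<le> B + W x))"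

definition conv :: "('a::euclidean_space \<Rightarrow> complex) \<Rightarrow> ('a \<Rightarrow> complex) \<Rightarrow> 'a \<Rightarrow> complex" where
  "conv K g y = (LINT x|lborel. g x * K (y - x))"

lemma integral_decay_shift:
  fixes y :: "'a::euclidean_space"
  shows "(LINT x|lborel. decay 1 (y - x)) = (LINT x|lborel. decay 1 (x :: 'a))"
  using integral_lborel_shift[of "decay 1" "- y"] by (simp add: decay_minus_commute[of _ y])

text \<open>The bounded part of \<open>g\<close> meets the integral of the kernel, the integrable
  part its supremum. \<open>G\<close> depends neither on the kernel nor on \<open>y\<close>;
  uniformity in \<open>y\<close> is what makes Fubini's theorem applicable later.\<close>

lemma L1_plus_bounded_conv:
  fixes g :: "'a::euclidean_space \<Rightarrow> complex"
  assumes "L1_plus_bounded g"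
  obtains G where "0 \<le> G"
    "\<And>K C y. \<lbrakk>K \<in> borel_measurable borel; \<And>x. norm (K x) \<le> C * decay 1 x\<rbrakk> \<Longrightarrow>
      integrable lborel (\<lambda>x. g x * K (y - x)) \<and> (LINT x|lborel. norm (g x * K (y - x))) \<le> C * G"
proof -
  obtain B W where [measurable]: "g \<in> borel_measurable borel" and W: "integrable lborel W"
    and g: "AE x in lborel. norm (g x) \<le> B + W x"
    using assms by (auto simp: L1_plus_bounded_def)
  define G where "G = \<bar>B\<bar> * (LINT x|lborel. decay 1 (x::'a)) + (LINT x|lborel. \<bar>W x\<bar>)"
  show thesis
  proof
    show "0 \<le> G"
      unfolding G_def by (intro add_nonneg_nonneg mult_nonneg_nonneg integral_nonneg_AE) auto
    fix K :: "'a \<Rightarrow> complex" and C and y :: 'a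
    assume [measurable]: "K \<in> borel_measurable borel" and K: "\<And>x. norm (K x) \<le> C * decay 1 x"
    have C: "0 \<le> C"
      using order_trans[OF norm_ge_zero K[of 0]] by (simp add: decay_def)
    let ?w = "\<lambda>x. C * (\<bar>B\<bar> * decay 1 (y - x) + \<bar>W x\<bar>)"
    have w: "integrable lborel ?w"
      using W by (intro integrable_mult_right Bochner_Integration.integrable_add integrable_abs integrable_decay_shift) auto
    have bound: "AE x in lborel. norm (g x * K (y - x)) \<le> ?w x"
      using g
    proof eventually_elim
      fix x assume "norm (g x) \<le> B + W x"
      then have "norm (g x * K (y - x)) \<le> (\<bar>B\<bar> + \<bar>W x\<bar>) * (C * decay 1 (y - x))"
        unfolding norm_mult using K by (intro mult_mono) auto
      also have "\<dots> = C * (\<bar>B\<bar> * decay 1 (y - x) + \<bar>W x\<bar> * decay 1 (y - x))"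
        by (simp add: algebra_simps)
      also have "\<dots> \<le> C * (\<bar>B\<bar> * decay 1 (y - x) + \<bar>W x\<bar> * 1)"
        using C by (intro mult_left_mono add_left_mono decay_le_1) auto
      finally show "norm (g x * K (y - x)) \<le> ?w x"
        by simp
    qed
    have int: "integrable lborel (\<lambda>x. g x * K (y - x))"
      using w by (rule Bochner_Integration.integrable_bound) (measurable, use bound in eventually_elim, simp)
    moreover have "(LINT x|lborel. norm (g x * K (y - x))) \<le> (LINT x|lborel. ?w x)"
      by (rule integral_mono_AE[OF integrable_norm[OF int] w bound])
    moreover have "(LINT x|lborel. ?w x) = C * G"
    proof -
      have "(LINT x|lborel. \<bar>B\<bar> * decay 1 (y - x) + \<bar>W x\<bar>)
          = (LINT x|lborel. \<bar>B\<bar> * decay 1 (y - x)) + (LINT x|lborel. \<bar>W x\<bar>)"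
        using W by (intro Bochner_Integration.integral_add integrable_mult_right integrable_decay_shift integrable_abs) auto
      then show ?thesis
        by (simp add: G_def integral_decay_shift)
    qed
    ultimately show "integrable lborel (\<lambda>x. g x * K (y - x)) \<and> (LINT x|lborel. norm (g x * K (y - x))) \<le> C * G"
      by (simp only: simp_thms)
  qed
qed

lemma L1_plus_bounded_measurable: "L1_plus_bounded g \<Longrightarrow> g \<in> borel_measurable borel"
  by (simp add: L1_plus_bounded_def)

lemma conv_measurable [measurable]:
  assumes [measurable]: "g \<in> borel_measurable borel" "K \<in> borel_measurable borel"
  shows "conv K g \<in> borel_measurable borel"
  unfolding conv_def[abs_def] by measurable

lemma conv_bounded:
  assumes "L1_plus_bounded g" "K \<in> borel_measurable borel" "\<And>x. norm (K x) \<le> C * decay 1 x"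
  obtains B where "\<And>y. norm (conv K g y) \<le> B"
proof -
  obtain G where "\<And>y. (LINT x|lborel. norm (g x * K (y - x))) \<le> C * G"
    using L1_plus_bounded_conv[OF assms(1)] assms(2,3) by metis
  then have "norm (conv K g y) \<le> C * G" for y
    unfolding conv_def using integral_norm_bound order_trans by metis
  then show thesis
    using that by blast
qed

text \<open>Together with \<open>conv_bounded\<close> this allows the result of a convolution to be
  convolved again.\<close>

lemma L1_plus_bounded_of_bounded:
  assumes "h \<in> borel_measurable borel" "\<And>y. norm (h y) \<le> B"
  shows "L1_plus_bounded h"
  unfolding L1_plus_bounded_def using assms by (intro conjI exI[of _ B] exI[of _ "\<lambda>_. 0"]) auto

text \<open>The absolute integrals in \<open>x\<close> are bounded uniformly in \<open>y\<close>, so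
  integrability of \<open>\<phi>\<close> justifies the exchange. It serves twice: with a test
  function to identify the projections, and with a second kernel to compose two
  convolutions.\<close>

lemma conv_fubini:
  fixes g :: "'a::euclidean_space \<Rightarrow> complex"
  assumes g: "L1_plus_bounded g" and \<phi>: "integrable lborel \<phi>"
    and [measurable]: "K \<in> borel_measurable borel" and K: "\<And>x. norm (K x) \<le> C * decay 1 x"
  shows "integrable lborel (\<lambda>y. \<phi> y * conv K g y)"
    and "(LINT y|lborel. \<phi> y * conv K g y) = (LINT x|lborel. g x * (LINT y|lborel. \<phi> y * K (y - x)))"
proof -
  note [measurable] = L1_plus_bounded_measurable[OF g] borel_measurable_integrable[OF \<phi>]
  obtain G where G: "\<And>y. integrable lborel (\<lambda>x. g x * K (y - x))"
    "\<And>y. (LINT x|lborel. norm (g x * K (y - x))) \<le> C * G"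
    using L1_plus_bounded_conv[OF g] assms(3,4) by metis
  have int: "integrable (lborel \<Otimes>\<^sub>M lborel) (\<lambda>(y, x). \<phi> y * (g x * K (y - x)))"
  proof (rule lborel_pair.Fubini_integrable)
    show "(\<lambda>(y, x). \<phi> y * (g x * K (y - x))) \<in> borel_measurable (lborel \<Otimes>\<^sub>M lborel)"
      by measurable
    show "AE y in lborel. integrable lborel (\<lambda>x. case (y, x) of (y, x) \<Rightarrow> \<phi> y * (g x * K (y - x)))"
      using G by (intro AE_I2) (auto intro: integrable_mult_right)
    have "integrable lborel (\<lambda>y. norm (\<phi> y) * (LINT x|lborel. norm (g x * K (y - x))))"
    proof (rule Bochner_Integration.integrable_bound)
      show "integrable lborel (\<lambda>y. (C * G) *\<^sub>R norm (\<phi> y))"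
        using \<phi> by (intro integrable_scaleR_right integrable_norm)
      show "AE y in lborel. norm (norm (\<phi> y) * (LINT x|lborel. norm (g x * K (y - x)))) \<le> norm ((C * G) *\<^sub>R norm (\<phi> y))"
      proof (rule AE_I2)
        fix y
        have "0 \<le> (LINT x|lborel. norm (g x * K (y - x)))"
          by (intro integral_nonneg_AE) auto
        then have "\<bar>LINT x|lborel. norm (g x * K (y - x))\<bar> \<le> \<bar>C * G\<bar>"
          using G(2)[of y] by linarith
        from mult_right_mono[OF this norm_ge_zero[of "\<phi> y"]]
        show "norm (norm (\<phi> y) * (LINT x|lborel. norm (g x * K (y - x)))) \<le> norm ((C * G) *\<^sub>R norm (\<phi> y))"
          by (simp add: abs_mult mult_ac)
      qed
    qed measurable
    then show "integrable lborel (\<lambda>y. LINT x|lborel. norm (case (y, x) of (y, x) \<Rightarrow> \<phi> y * (g x * K (y - x))))"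
      by (simp add: norm_mult)
  qed
  show "integrable lborel (\<lambda>y. \<phi> y * conv K g y)"
    using lborel_pair.integrable_fst[OF int] by (simp add: conv_def)
  show "(LINT y|lborel. \<phi> y * conv K g y) = (LINT x|lborel. g x * (LINT y|lborel. \<phi> y * K (y - x)))"
  proof -
    have "(LINT y|lborel. \<phi> y * (g x * K (y - x))) = g x * (LINT y|lborel. \<phi> y * K (y - x))" for x
      by (simp add: mult.left_commute[of _ "g x"])
    then show ?thesis
      using lborel_pair.Fubini_integral[OF int] by (simp add: conv_def)
  qed
qed

text \<open>Projections act by duality, so this is the function against which \<open>g\<close> is
  tested. Exchanging the integrals moves the factor \<open>1 / (2 * pi) ^ CARD('n)\<close> from the
  transform of \<open>\<phi>\<close> to that of \<open>v\<close>, which leaves exactly the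
  kernel.\<close>

lemma fourier_mult_inv_fourier:
  fixes v \<phi> :: "real^'n \<Rightarrow> complex"
  assumes v: "integrable lborel v" and \<phi>: "integrable lborel \<phi>"
  shows "fourier (\<lambda>\<xi>. v \<xi> * inv_fourier \<phi> \<xi>) x = (LINT y|lborel. \<phi> y * inv_fourier v (y - x))"
proof -
  let ?c = "complex_of_real (1 / (2 * pi) ^ CARD('n))"
  note [measurable] = borel_measurable_integrable[OF v] borel_measurable_integrable[OF \<phi>]
  have int: "integrable (lborel \<Otimes>\<^sub>M lborel) (\<lambda>(\<xi>, y). cis ((y - x) \<bullet> \<xi>) * (v \<xi> * \<phi> y))"
    by (intro integrable_product_phase v \<phi>) measurable
  have [measurable]: "inv_fourier \<phi> \<in> borel_measurable borel"
  proof -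
    have "inv_fourier \<phi> = (\<lambda>x. ?c * (LINT \<xi>|lborel. cis (x \<bullet> \<xi>) * \<phi> \<xi>))"
      by (rule ext, rule inv_fourier_eq) measurable
    then show ?thesis
      by simp
  qed
  have "fourier (\<lambda>\<xi>. v \<xi> * inv_fourier \<phi> \<xi>) x = (LINT \<xi>|lborel. cis (- (x \<bullet> \<xi>)) * (v \<xi> * inv_fourier \<phi> \<xi>))"
    by (simp add: fourier_def integral_completion inner_commute)
  also have "\<dots> = (LINT \<xi>|lborel. ?c * (LINT y|lborel. cis ((y - x) \<bullet> \<xi>) * (v \<xi> * \<phi> y)))"
  proof (rule Bochner_Integration.integral_cong)
    fix \<xi>
    have "cis (- (x \<bullet> \<xi>)) * (v \<xi> * inv_fourier \<phi> \<xi>)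
        = ?c * (cis (- (x \<bullet> \<xi>)) * v \<xi> * (LINT y|lborel. cis (\<xi> \<bullet> y) * \<phi> y))"
      by (simp add: inv_fourier_eq)
    also have "cis (- (x \<bullet> \<xi>)) * v \<xi> * (LINT y|lborel. cis (\<xi> \<bullet> y) * \<phi> y)
        = (LINT y|lborel. cis (- (x \<bullet> \<xi>)) * v \<xi> * (cis (\<xi> \<bullet> y) * \<phi> y))"
      by simp
    also have "\<dots> = (LINT y|lborel. cis ((y - x) \<bullet> \<xi>) * (v \<xi> * \<phi> y))"
    proof (intro Bochner_Integration.integral_cong refl)
      fix y
      have "cis ((y - x) \<bullet> \<xi>) = cis (- (x \<bullet> \<xi>)) * cis (\<xi> \<bullet> y)"
        by (simp add: cis_mult inner_diff_left inner_diff_right inner_commute)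
      then show "cis (- (x \<bullet> \<xi>)) * v \<xi> * (cis (\<xi> \<bullet> y) * \<phi> y) = cis ((y - x) \<bullet> \<xi>) * (v \<xi> * \<phi> y)"
        by simp
    qed
    finally show "cis (- (x \<bullet> \<xi>)) * (v \<xi> * inv_fourier \<phi> \<xi>) = ?c * (LINT y|lborel. cis ((y - x) \<bullet> \<xi>) * (v \<xi> * \<phi> y))" .
  qed simp
  also have "\<dots> = ?c * (LINT \<xi>|lborel. LINT y|lborel. cis ((y - x) \<bullet> \<xi>) * (v \<xi> * \<phi> y))"
    by simp
  also have "(LINT \<xi>|lborel. LINT y|lborel. cis ((y - x) \<bullet> \<xi>) * (v \<xi> * \<phi> y))
      = (LINT y|lborel. LINT \<xi>|lborel. cis ((y - x) \<bullet> \<xi>) * (v \<xi> * \<phi> y))"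
    by (rule lborel_pair.Fubini_integral[OF int, symmetric])
  also have "?c * \<dots> = (LINT y|lborel. ?c * (LINT \<xi>|lborel. cis ((y - x) \<bullet> \<xi>) * (v \<xi> * \<phi> y)))"
    by simp
  also have "\<dots> = (LINT y|lborel. \<phi> y * inv_fourier v (y - x))"
  proof -
    have "(LINT \<xi>|lborel. cis ((y - x) \<bullet> \<xi>) * (v \<xi> * \<phi> y)) = \<phi> y * (LINT \<xi>|lborel. cis ((y - x) \<bullet> \<xi>) * v \<xi>)" for y
      by (simp add: mult.commute[of "\<phi> y"] flip: mult.assoc)
    then show ?thesis
      by (simp add: inv_fourier_eq[of v] mult_ac)
  qed
  finally show ?thesis .
qed

text \<open>Duality puts the kernel on the test function, and \<open>conv_fubini\<close> moves it
  over to \<open>g'\<close>.\<close>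

lemma lp_proj_represents_conv:
  fixes g g' :: "real^'n \<Rightarrow> complex"
  assumes sym: "smooth_in_ball R (lp_symbol m1 m k)" and g': "L1_plus_bounded g'"
    and g: "g \<in> borel_measurable lebesgue" and eq: "AE x in lborel. g x = g' x"
  shows "represents (conv (inv_fourier (lp_symbol m1 m k)) g') (lp_proj m1 m k (dist_of_fun g))"
proof -
  let ?v = "lp_symbol m1 m k"
  let ?K = "inv_fourier ?v"
  obtain C where C: "\<And>x. norm (?K x) \<le> C * decay 1 x"
    using inv_fourier_decay[OF sym] by blast
  note [measurable] = inv_fourier_measurable[OF sym] L1_plus_bounded_measurable[OF g']
  show ?thesis
  proof (rule represents_borelI)
    fix \<phi> :: "real^'n \<Rightarrow> complex" assume "\<phi> \<in> schwartz"
    note [measurable] = schwartz_measurable[OF this]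
    have \<phi>: "integrable lborel \<phi>"
      using schwartz_decay[OF \<open>\<phi> \<in> schwartz\<close>] integrable_decay_bound[OF schwartz_measurable[OF \<open>\<phi> \<in> schwartz\<close>]] by metis
    note fub = conv_fubini[OF g' \<phi> inv_fourier_measurable[OF sym] C]
    show "integrable lborel (\<lambda>y. conv ?K g' y * \<phi> y)"
      using fub(1) by (simp add: mult.commute)
    let ?\<psi> = "\<lambda>x. LINT y|lborel. \<phi> y * ?K (y - x)"
    have "lp_proj m1 m k (dist_of_fun g) \<phi> = (LINT x|lebesgue. g x * ?\<psi> x)"
      unfolding lp_proj_def dist_inv_fourier_def dist_mult_def dist_fourier_def dist_of_fun_def
      using fourier_mult_inv_fourier[OF smooth_in_ball_integrable[OF sym] \<phi>] by simp
    also have "\<dots> = (LINT x|lebesgue. g' x * ?\<psi> x)"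
    proof (rule integral_cong_AE)
      have "?\<psi> \<in> borel_measurable borel"
        by measurable
      then have \<psi>: "?\<psi> \<in> borel_measurable lebesgue"
        by (intro measurable_completion) simp
      have "g' \<in> borel_measurable lebesgue"
        by (intro measurable_completion) simp
      with \<psi> g show "(\<lambda>x. g x * ?\<psi> x) \<in> borel_measurable lebesgue" "(\<lambda>x. g' x * ?\<psi> x) \<in> borel_measurable lebesgue"
        by (auto intro: borel_measurable_times)
      show "AE x in lebesgue. g x * ?\<psi> x = g' x * ?\<psi> x"
        using eq unfolding AE_lebesgue_iff by eventually_elim simp
    qed
    also have "\<dots> = (LINT x|lborel. g' x * ?\<psi> x)"
      by (rule integral_completion) measurable
    finally show "lp_proj m1 m k (dist_of_fun g) \<phi> = (LINT y|lborel. conv ?K g' y * \<phi> y)"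
      using fub(2) by (simp add: mult.commute)
  qed measurable
qed

lemma norm_conv_diff_le:
  assumes g: "L1_plus_bounded g"
    and K: "K \<in> borel_measurable borel" "\<And>x. norm (K x) \<le> C * decay 1 x"
  shows "norm (conv K g y' - conv K g y) \<le> (LINT x|lborel. norm (g x) * norm (K (y' - x) - K (y - x)))"
proof -
  have int: "integrable lborel (\<lambda>x. g x * K (y - x))" for y
    using L1_plus_bounded_conv[OF g] K by metis
  have "conv K g y' - conv K g y = (LINT x|lborel. g x * (K (y' - x) - K (y - x)))"
    unfolding conv_def using int by (simp add: right_diff_distrib Bochner_Integration.integral_diff)
  then show ?thesis
    using integral_norm_bound[of lborel "\<lambda>x. g x * (K (y' - x) - K (y - x))"] by (simp add: norm_mult)
qed

text \<open>Continuity is what allows a projection to be evaluated on the boundary through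
  \<open>cont_rep\<close>. The Lipschitz bound of the kernel retains its decay and can therefore be
  integrated against \<open>g\<close>.\<close>

lemma conv_inv_fourier_continuous:
  fixes v :: "real^'n \<Rightarrow> complex"
  assumes v: "smooth_in_ball R v" and g: "L1_plus_bounded g"
  shows "continuous_on UNIV (conv (inv_fourier v) g)"
proof -
  let ?K = "inv_fourier v"
  obtain C where C: "0 \<le> C"
    "\<And>x y. norm (y - x) \<le> 1 \<Longrightarrow> norm (?K y - ?K x) \<le> C * norm (y - x) * decay 1 x"
    using inv_fourier_lipschitz[OF v] by blast
  obtain C' where C': "\<And>x. norm (?K x) \<le> C' * decay 1 x"
    using inv_fourier_decay[OF v] by blast
  note [measurable] = inv_fourier_measurable[OF v] L1_plus_bounded_measurable[OF g]
  have G: "integrable lborel (\<lambda>x. g x * of_real (decay 1 (y - x)))" for y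
  proof (rule L1_plus_bounded_conv[OF g])
    fix G assume *: "\<And>K C y. \<lbrakk>K \<in> borel_measurable borel; \<And>x. norm (K x) \<le> C * decay 1 x\<rbrakk> \<Longrightarrow>
      integrable lborel (\<lambda>x. g x * K (y - x)) \<and> (LINT x|lborel. norm (g x * K (y - x))) \<le> C * G"
    have "(\<lambda>x :: real^'n. complex_of_real (decay 1 x)) \<in> borel_measurable borel"
      by measurable
    from *[OF this, of 1 y] show ?thesis
      by simp
  qed
  have bound: "norm (conv ?K g y' - conv ?K g y) \<le> C * norm (y' - y) * (LINT x|lborel. norm (g x) * decay 1 (y - x))"
    if "norm (y' - y) \<le> 1" for y y'
  proof -
    have int: "integrable lborel (\<lambda>x. C * norm (y' - y) * (norm (g x) * decay 1 (y - x)))"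
      using integrable_norm[OF G[of y]] by (intro integrable_mult_right) (simp add: norm_mult)
    have le: "norm (g x) * norm (?K (y' - x) - ?K (y - x)) \<le> C * norm (y' - y) * (norm (g x) * decay 1 (y - x))" for x
      using mult_left_mono[OF C(2)[of "y' - x" "y - x"], of "norm (g x)"] that by (simp add: mult_ac)
    have "norm (conv ?K g y' - conv ?K g y) \<le> (LINT x|lborel. norm (g x) * norm (?K (y' - x) - ?K (y - x)))"
      by (rule norm_conv_diff_le[OF g inv_fourier_measurable[OF v] C'])
    also have "\<dots> \<le> (LINT x|lborel. C * norm (y' - y) * (norm (g x) * decay 1 (y - x)))"
      using int le by (intro integral_mono' ) (auto intro!: mult_nonneg_nonneg C(1))
    finally show ?thesis
      by simp
  qed
  have "(conv ?K g \<longlongrightarrow> conv ?K g y) (at y)" for y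
  proof (rule LIM_zero_cancel, rule Lim_null_comparison)
    show "((\<lambda>y'. C * norm (y' - y) * (LINT x|lborel. norm (g x) * decay 1 (y - x))) \<longlongrightarrow> 0) (at y)"
      by (auto intro!: tendsto_eq_intros)
    show "\<forall>\<^sub>F y' in at y. norm (conv ?K g y' - conv ?K g y) \<le> C * norm (y' - y) * (LINT x|lborel. norm (g x) * decay 1 (y - x))"
      unfolding eventually_at using bound by (intro exI[of _ 1]) (auto simp: dist_norm)
  qed
  then show ?thesis
    by (simp add: continuous_on_eq_continuous_at isCont_def)
qed

text \<open>Expanded into plane waves, \<open>inv_fourier w\<close> contains only frequencies beyond
  \<open>R\<close>, and each of them integrates to zero against a translate of
  \<open>inv_fourier v\<close> by \<open>fourier_inv_fourier_outside\<close>.\<close>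

lemma inv_fourier_orthogonal:
  fixes v w :: "real^'n \<Rightarrow> complex"
  assumes v: "smooth_in_ball R v" and w: "integrable lborel w"
    and supp: "\<And>\<xi>. w \<xi> \<noteq> 0 \<Longrightarrow> R < norm \<xi>"
  shows "(LINT x|lborel. inv_fourier w (y - x) * inv_fourier v (x - z)) = 0"
proof -
  let ?c = "complex_of_real (1 / (2 * pi) ^ CARD('n))"
  let ?K = "inv_fourier v"
  note [measurable] = inv_fourier_measurable[OF v] borel_measurable_integrable[OF w]
  have K: "integrable lborel (\<lambda>x. ?K (x - z))"
    using integrable_lborel_shift[OF inv_fourier_integrable[OF v], of "- z"] by simp
  have int: "integrable (lborel \<Otimes>\<^sub>M lborel) (\<lambda>(x, \<xi>). cis ((y - x) \<bullet> \<xi>) * (?K (x - z) * w \<xi>))"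
    by (intro integrable_product_phase K w) measurable
  have inner: "(LINT x|lborel. cis ((y - x) \<bullet> \<xi>) * (?K (x - z) * w \<xi>)) = 0" for \<xi>
  proof (cases "w \<xi> = 0")
    case False
    have "(LINT x|lborel. cis ((y - x) \<bullet> \<xi>) * (?K (x - z) * w \<xi>))
        = (LINT x|lborel. cis ((y - (z + x)) \<bullet> \<xi>) * (?K ((z + x) - z) * w \<xi>))"
      by (rule integral_lborel_shift[symmetric]) measurable
    also have "\<dots> = (LINT x|lborel. (w \<xi> * cis ((y - z) \<bullet> \<xi>)) * (cis (- (x \<bullet> \<xi>)) * ?K x))"
      by (intro Bochner_Integration.integral_cong) (auto simp: cis_mult inner_diff_left inner_add_left algebra_simps)
    also have "\<dots> = (w \<xi> * cis ((y - z) \<bullet> \<xi>)) * (LINT x|lborel. cis (- (x \<bullet> \<xi>)) * ?K x)"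
      by simp
    finally show ?thesis
      using fourier_inv_fourier_outside[OF v supp[OF False]] by simp
  qed simp
  have "(LINT \<xi>|lborel. cis ((y - x) \<bullet> \<xi>) * (?K (x - z) * w \<xi>)) = ?K (x - z) * (LINT \<xi>|lborel. cis ((y - x) \<bullet> \<xi>) * w \<xi>)" for x
    by (simp add: mult.left_commute[of _ "?K (x - z)"])
  then have "(LINT x|lborel. inv_fourier w (y - x) * ?K (x - z))
      = (LINT x|lborel. ?c * (LINT \<xi>|lborel. cis ((y - x) \<bullet> \<xi>) * (?K (x - z) * w \<xi>)))"
    by (simp add: inv_fourier_eq[of w] mult.assoc mult.commute mult.left_commute)
  also have "\<dots> = ?c * (LINT x|lborel. LINT \<xi>|lborel. cis ((y - x) \<bullet> \<xi>) * (?K (x - z) * w \<xi>))"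
    by simp
  also have "(LINT x|lborel. LINT \<xi>|lborel. cis ((y - x) \<bullet> \<xi>) * (?K (x - z) * w \<xi>))
      = (LINT \<xi>|lborel. LINT x|lborel. cis ((y - x) \<bullet> \<xi>) * (?K (x - z) * w \<xi>))"
    by (rule lborel_pair.Fubini_integral[OF int, symmetric])
  finally show ?thesis
    by (simp add: inner)
qed

text \<open>Fubini's theorem composes the two kernels, and the composite kernel vanishes.\<close>

lemma conv_conv_orthogonal:
  fixes v w g :: "real^'n \<Rightarrow> complex"
  assumes v: "smooth_in_ball R v" and w: "smooth_in_ball R' w"
    and supp: "\<And>\<xi>. w \<xi> \<noteq> 0 \<Longrightarrow> R < norm \<xi>" and g: "L1_plus_bounded g"
  shows "conv (inv_fourier w) (conv (inv_fourier v) g) y = 0"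
proof -
  obtain C where C: "\<And>x. norm (inv_fourier v x) \<le> C * decay 1 x"
    using inv_fourier_decay[OF v] by blast
  have "integrable lborel (\<lambda>x. inv_fourier w (y - x))"
  proof -
    obtain C' where C': "\<And>x. norm (inv_fourier w x) \<le> C' * decay 1 x"
      using inv_fourier_decay[OF w] by blast
    note [measurable] = inv_fourier_measurable[OF w]
    show ?thesis
    proof (rule Bochner_Integration.integrable_bound)
      show "integrable lborel (\<lambda>x. C' * decay 1 (y - x))"
        by (intro integrable_mult_right integrable_decay_shift) auto
      show "(\<lambda>x. inv_fourier w (y - x)) \<in> borel_measurable lborel"
        by measurable
      show "AE x in lborel. norm (inv_fourier w (y - x)) \<le> norm (C' * decay 1 (y - x))"
        unfolding real_norm_def by (intro AE_I2 order_trans[OF C' abs_ge_self])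
    qed
  qed
  from conv_fubini(2)[OF g this inv_fourier_measurable[OF v] C]
  show ?thesis
    using inv_fourier_orthogonal[OF v smooth_in_ball_integrable[OF w] supp, of y]
    by (simp add: conv_def mult.commute)
qed

section \<open>Decomposition of a Besov function\<close>

lemma two_powr_power: "((2::real) powr a) ^ k = (2 ^ k) powr a"
  by (simp add: powr_powr mult.commute flip: powr_realpow)

lemma geometric_summable:
  fixes x :: "nat \<Rightarrow> complex"
  assumes c: "0 < c" "c < 1" and bound: "\<And>k. norm (x k) \<le> c ^ k * M"
  shows "summable x" and "norm ((\<Sum>k. x k) - (\<Sum>k<n. x k)) \<le> c ^ n / (1 - c) * M"
proof -
  have geo: "summable (\<lambda>k. c ^ k * M)"
    using c by (intro summable_mult2 summable_geometric) auto
  show sx: "summable x"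
    using geo bound by (rule summable_comparison_test')
  have geo_n: "summable (\<lambda>k. c ^ (k + n) * M)"
    using geo by (rule summable_ignore_initial_segment)
  have "(\<Sum>k. x k) - (\<Sum>k<n. x k) = (\<Sum>k. x (k + n))"
    using suminf_split_initial_segment[OF sx, of n] by simp
  also have "norm \<dots> \<le> (\<Sum>k. c ^ (k + n) * M)"
    by (rule norm_suminf_le[OF bound geo_n])
  also have "\<dots> = (\<Sum>k. c ^ k) * (c ^ n * M)"
    using c by (subst suminf_mult2) (auto simp: power_add mult_ac intro!: summable_geometric)
  also have "\<dots> = c ^ n / (1 - c) * M"
    using c by (subst suminf_geometric) auto
  finally show "norm ((\<Sum>k. x k) - (\<Sum>k<n. x k)) \<le> c ^ n / (1 - c) * M" .
qed

locale besov_function =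
  fixes m1 m g :: "real^'n \<Rightarrow> complex" and s p :: real
  assumes littlewood_paley: "littlewood_paley m1 m"
    and p_gt_1: "1 < p" and s_gt: "1 / p < s" and s_less: "s < 1 + 1 / p"
    and g_represents: "represents g (dist_of_fun g)" and g_besov: "dist_of_fun g \<in> besov m1 m s p"
begin

abbreviation projection :: "nat \<Rightarrow> 'n dist" where
  "projection k \<equiv> lp_proj m1 m k (dist_of_fun g)"

abbreviation kernel :: "nat \<Rightarrow> real^'n \<Rightarrow> complex" where
  "kernel k \<equiv> inv_fourier (lp_symbol m1 m k)"

text \<open>\<open>\<rho> ^ k\<close> is 2^(-k s), the reciprocal Besov weight of the k-th piece
  after taking p-th roots.\<close>

definition \<rho> :: real where "\<rho> = 2 powr - s"

lemma s_pos: "0 < s"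
  using p_gt_1 s_gt by (smt (verit) divide_pos_pos)

lemma \<rho>_bounds: "0 < \<rho>" "\<rho> < 1"
  using s_pos by (auto simp: \<rho>_def powr_less_one)

lemma lp_symbol_support:
  obtains a b where "0 < a" "0 < b" "\<And>k. smooth_in_ball (b * 2 ^ k) (lp_symbol m1 m k)"
    "\<And>k \<xi>. 0 < k \<Longrightarrow> lp_symbol m1 m k \<xi> \<noteq> 0 \<Longrightarrow> a * 2 ^ k \<le> norm \<xi>"
proof -
  obtain c a b where sm: "smooth m1" "smooth m" and c: "\<And>\<xi>. m1 \<xi> \<noteq> 0 \<Longrightarrow> norm \<xi> \<le> c"
    and ab: "0 < a" "\<And>\<xi>. m \<xi> \<noteq> 0 \<Longrightarrow> a \<le> norm \<xi> \<and> norm \<xi> \<le> b"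
    using littlewood_paley unfolding littlewood_paley_def by blast
  \<comment> \<open>One radius for both symbols; the 1 makes it positive.\<close>
  define b' where "b' = max 1 (max b c)"
  show thesis
  proof
    show "0 < a" "0 < b'"
      using ab by (auto simp: b'_def)
    show "smooth_in_ball (b' * 2 ^ k) (lp_symbol m1 m k)" for k
    proof (cases "k = 0")
      case True
      then show ?thesis
        using sm c by (fastforce simp: smooth_in_ball_def lp_symbol_def b'_def)
    next
      case False
      have "norm \<xi> \<le> b' * 2 ^ k" if "m (\<xi> /\<^sub>R 2 ^ k) \<noteq> 0" for \<xi>
      proof -
        have "norm \<xi> / 2 ^ k \<le> b'"
          using ab(2)[OF that] by (simp add: b'_def divide_inverse mult.commute le_max_iff_disj)
        then show ?thesis
          by (simp add: divide_le_eq)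
      qed
      then show ?thesis
        using False smooth_scale[OF sm(2), of "inverse (2 ^ k)"]
        by (simp add: smooth_in_ball_def lp_symbol_def)
    qed
    show "a * 2 ^ k \<le> norm \<xi>" if "0 < k" "lp_symbol m1 m k \<xi> \<noteq> 0" for k \<xi>
    proof -
      have "a \<le> norm \<xi> / 2 ^ k"
        using that ab(2)[of "\<xi> /\<^sub>R 2 ^ k"] by (simp add: lp_symbol_def divide_inverse mult.commute)
      then show ?thesis
        by (simp add: le_divide_eq)
    qed
  qed
qed

lemma lp_symbol_smooth: "\<exists>R. smooth_in_ball R (lp_symbol m1 m k)"
  using lp_symbol_support by metis

text \<open>The infimum in \<open>Lp_norm_pow\<close> is infinite over the empty set, while the
  finite Besov norm with its positive weights makes it finite; hence some representing function
  exists.\<close>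

lemma projection_piece:
  obtains h where "h \<in> borel_measurable borel" "represents h (projection k)"
proof -
  have "Lp_norm_pow p (projection k) < \<infinity>"
  proof -
    have "ennreal ((2 ^ k) powr (s * p)) * Lp_norm_pow p (projection k) \<le>
        (\<Sum>k. ennreal ((2 ^ k) powr (s * p)) * Lp_norm_pow p (projection k))"
      using sum_le_suminf[of "\<lambda>k. ennreal ((2 ^ k) powr (s * p)) * Lp_norm_pow p (projection k)" "{k}"]
      by (simp add: summableI)
    also have "\<dots> \<le> besov_norm_pow m1 m s p (dist_of_fun g)"
      unfolding besov_norm_pow_def by (simp add: add_increasing)
    also have "\<dots> < \<infinity>"
      using g_besov by (simp add: besov_def)
    finally show ?thesis
      by (auto simp: ennreal_mult_less_top)
  qed
  then have "{h. represents h (projection k)} \<noteq> {}"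
    unfolding Lp_norm_pow_def by (intro notI) simp
  then obtain h0 where h0: "represents h0 (projection k)"
    by blast
  then obtain h where h: "h \<in> borel_measurable borel" "AE x in lborel. h0 x = h x"
    using lebesgue_measurable_borel_version unfolding represents_def by blast
  show thesis
    using represents_borel_version[OF h0 h] h(1) by (intro that[of h] represents_borelI) auto
qed

text \<open>Each term of the Besov series is at most the whole series, which after a p-th root gives
  one majorant for all pieces simultaneously.\<close>

lemma pieces:
  obtains h F where "\<And>k. h k \<in> borel_measurable borel" "\<And>k. represents (h k) (projection k)"
    "integrable lborel F" "\<And>x. 0 \<le> F x"
    "AE x in lborel. \<forall>k. norm (h k x) \<le> \<rho> ^ k * F x powr (1 / p)"
proof -
  have "\<exists>h. h \<in> borel_measurable borel \<and> represents h (projection k)" for k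
    using projection_piece by metis
  then obtain h where [measurable]: "\<And>k. h k \<in> borel_measurable borel"
    and h: "\<And>k. represents (h k) (projection k)"
    by metis
  define W where "W x = (\<Sum>k. ennreal ((2 ^ k) powr (s * p)) * ennreal (norm (h k x) powr p))" for x
  have [measurable]: "W \<in> borel_measurable borel"
    unfolding W_def by measurable
  have "(\<integral>\<^sup>+x. W x \<partial>lborel) = (\<Sum>k. ennreal ((2 ^ k) powr (s * p)) * Lp_norm_pow p (projection k))"
    unfolding W_def Lp_norm_pow_eq[OF h] nn_integral_completion
    by (simp add: nn_integral_suminf nn_integral_cmult)
  also have "\<dots> \<le> besov_norm_pow m1 m s p (dist_of_fun g)"
    unfolding besov_norm_pow_def by (simp add: add_increasing)
  also have "\<dots> < \<infinity>"
    using g_besov by (simp add: besov_def)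
  finally have fin: "(\<integral>\<^sup>+x. W x \<partial>lborel) < \<infinity>" .
  then have AE_fin: "AE x in lborel. W x \<noteq> \<infinity>"
    by (intro nn_integral_PInf_AE) auto
  \<comment> \<open>\<open>enn2real\<close> sends infinite values to 0, but these occur only on a
    null set.\<close>
  define F where "F x = enn2real (W x)" for x
  have [measurable]: "F \<in> borel_measurable borel"
    unfolding F_def by measurable
  have "(\<integral>\<^sup>+x. ennreal (norm (F x)) \<partial>lborel) = (\<integral>\<^sup>+x. W x \<partial>lborel)"
  proof (rule nn_integral_cong_AE)
    show "AE x in lborel. ennreal (norm (F x)) = W x"
      using AE_fin by eventually_elim (simp add: F_def less_top)
  qed
  then have F_int: "integrable lborel F"
    using fin by (intro integrableI_bounded) auto
  have "AE x in lborel. \<forall>k. norm (h k x) \<le> \<rho> ^ k * F x powr (1 / p)"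
    using AE_fin
  proof eventually_elim
    fix x assume "W x \<noteq> \<infinity>"
    then have W: "W x = ennreal (F x)"
      by (simp add: F_def less_top)
    show "\<forall>k. norm (h k x) \<le> \<rho> ^ k * F x powr (1 / p)"
    proof
      fix k
      let ?L = "(2 ^ k) powr s :: real"
      have "0 < ?L"
        by simp
      have "ennreal ((2 ^ k) powr (s * p)) * ennreal (norm (h k x) powr p) \<le> W x"
        using sum_le_suminf[of "\<lambda>k. ennreal ((2 ^ k) powr (s * p)) * ennreal (norm (h k x) powr p)" "{k}"]
        by (simp add: summableI W_def)
      then have "(2 ^ k) powr (s * p) * norm (h k x) powr p \<le> F x"
        unfolding W by (simp add: F_def flip: ennreal_mult)
      then have "(?L * norm (h k x)) powr p \<le> F x"
        by (simp add: powr_mult powr_powr)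
      then have "((?L * norm (h k x)) powr p) powr (1 / p) \<le> F x powr (1 / p)"
        using p_gt_1 by (intro powr_mono2) auto
      then have "?L * norm (h k x) \<le> F x powr (1 / p)"
        using p_gt_1 by (simp add: powr_powr)
      then show "norm (h k x) \<le> \<rho> ^ k * F x powr (1 / p)"
        unfolding \<rho>_def two_powr_power unfolding powr_minus using \<open>0 < ?L\<close> by (simp add: field_simps)
    qed
  qed
  with F_int h show thesis
    by (intro that[of h F]) (auto simp: F_def)
qed

text \<open>Linearizes p-th roots, so that integrability of \<open>F\<close> yields majorants of the
  form constant plus integrable.\<close>

lemma powr_inverse_p_le: "0 \<le> t \<Longrightarrow> t powr (1 / p) \<le> 1 + t"
proof (cases "t \<le> 1")
  case True
  assume "0 \<le> t"
  then have "t powr (1 / p) \<le> 1 powr (1 / p)"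
    using True p_gt_1 by (intro powr_mono2) auto
  then show ?thesis
    using \<open>0 \<le> t\<close> by simp
next
  case False
  then have "t powr (1 / p) \<le> t powr 1"
    using p_gt_1 by (intro powr_mono) auto
  then show ?thesis
    using False by simp
qed

text \<open>\<open>g'\<close> is the pointwise sum of Borel representatives of the projections;
  being dominated by a multiple of \<open>1 + F\<close>, it is \<open>L1_plus_bounded\<close>, which
  is not known for \<open>g\<close> beforehand. The weak Littlewood-Paley sum and dominated
  convergence identify it with \<open>g\<close> a.e., after which all projections become
  convolutions with \<open>g'\<close>.\<close>

lemma decomposition:
  obtains g' F where "L1_plus_bounded g'" "AE x in lborel. g x = g' x"
    "\<And>k. cont_rep (projection k) = conv (kernel k) g'"
    "integrable lborel F" "\<And>x. 0 \<le> F x"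
    "AE x in lborel. \<forall>k. norm (conv (kernel k) g' x) \<le> \<rho> ^ k * F x powr (1 / p)"
    "AE x in lborel. g' x = (\<Sum>k. conv (kernel k) g' x)"
proof -
  obtain h F where [measurable]: "\<And>k. h k \<in> borel_measurable borel"
    and h: "\<And>k. represents (h k) (projection k)"
    and F: "integrable lborel F" "\<And>x. 0 \<le> F x"
    and hF: "AE x in lborel. \<forall>k. norm (h k x) \<le> \<rho> ^ k * F x powr (1 / p)"
    by (rule pieces) (rule that)
  note [measurable] = borel_measurable_integrable[OF F(1)]
  define g' where "g' x = (\<Sum>k. h k x)" for x
  have [measurable]: "g' \<in> borel_measurable borel"
    unfolding g'_def by measurable
  let ?D = "1 / (1 - \<rho>)"
  have D: "0 \<le> ?D"
    using \<rho>_bounds by simp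
  \<comment> \<open>A partial sum is the limit minus a tail, and each of the two is at most
    \<open>?D * (1 + F x)\<close>; hence the doubled bound.\<close>
  have partial_bound: "AE x in lborel. \<forall>n. norm (\<Sum>k<n. h k x) \<le> ?D * (1 + F x) + ?D * (1 + F x)"
    and sums: "AE x in lborel. (\<lambda>n. \<Sum>k<n. h k x) \<longlonglongrightarrow> g' x"
    and g'_bound: "AE x in lborel. norm (g' x) \<le> ?D * (1 + F x)"
  proof -
    have main: "(\<forall>n. norm (\<Sum>k<n. h k x) \<le> ?D * (1 + F x) + ?D * (1 + F x)) \<and>
        (\<lambda>n. \<Sum>k<n. h k x) \<longlonglongrightarrow> g' x \<and> norm (g' x) \<le> ?D * (1 + F x)"
      if "\<forall>k. norm (h k x) \<le> \<rho> ^ k * F x powr (1 / p)" for x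
    proof -
      have "norm (h k x) \<le> \<rho> ^ k * (1 + F x)" for k
      proof -
        have "\<rho> ^ k * F x powr (1 / p) \<le> \<rho> ^ k * (1 + F x)"
          using powr_inverse_p_le[OF F(2)[of x]] \<rho>_bounds by (intro mult_left_mono) auto
        then show ?thesis
          using that order_trans by blast
      qed
      note geo = geometric_summable[OF \<rho>_bounds this]
      have tail: "norm (g' x - (\<Sum>k<n. h k x)) \<le> ?D * (1 + F x)" for n
      proof -
        have "\<rho> ^ n / (1 - \<rho>) * (1 + F x) \<le> ?D * (1 + F x)"
          using \<rho>_bounds F(2)[of x] by (intro mult_right_mono divide_right_mono power_le_one) auto
        then show ?thesis
          using geo(2)[of n] by (simp add: g'_def)
      qed
      have "norm (g' x) \<le> ?D * (1 + F x)"
        using tail[of 0] by simp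
      moreover from this have "norm (\<Sum>k<n. h k x) \<le> ?D * (1 + F x) + ?D * (1 + F x)" for n
        using norm_triangle_sub[of "\<Sum>k<n. h k x" "g' x"] tail[of n]
        unfolding norm_minus_commute[of "\<Sum>k<n. h k x" "g' x"] by linarith
      ultimately show ?thesis
        using summable_LIMSEQ[OF geo(1)] by (simp add: g'_def)
    qed
    show "AE x in lborel. \<forall>n. norm (\<Sum>k<n. h k x) \<le> ?D * (1 + F x) + ?D * (1 + F x)"
      "AE x in lborel. (\<lambda>n. \<Sum>k<n. h k x) \<longlonglongrightarrow> g' x"
      "AE x in lborel. norm (g' x) \<le> ?D * (1 + F x)"
      using hF by (eventually_elim, use main in blast)+
  qed
  have g'_L1: "L1_plus_bounded g'"
    unfolding L1_plus_bounded_def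
  proof (intro conjI exI)
    show "integrable lborel (\<lambda>x. ?D * F x)"
      using F(1) by (rule integrable_mult_right)
    show "AE x in lborel. norm (g' x) \<le> ?D + ?D * F x"
      using g'_bound by eventually_elim (simp add: distrib_left)
  qed measurable
  have "represents g' (dist_of_fun g)"
  proof (rule represents_borelI)
    fix \<phi> :: "real^'n \<Rightarrow> complex" assume \<phi>: "\<phi> \<in> schwartz"
    note [measurable] = schwartz_measurable[OF \<phi>]
    obtain C where C: "0 \<le> C" "\<And>x. norm (\<phi> x) \<le> C * decay 1 x"
      using schwartz_decay[OF \<phi>] by blast
    let ?w = "\<lambda>x. (2 * ?D * C) * (decay 1 x + F x)"
    have w: "integrable lborel ?w"
      using F(1) by (intro integrable_mult_right Bochner_Integration.integrable_add integrable_decay) auto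
    have bound: "norm (y * \<phi> x) \<le> ?w x" if "norm y \<le> ?D * (1 + F x) + ?D * (1 + F x)" for x y
    proof -
      have "norm (y * \<phi> x) \<le> (?D * (1 + F x) + ?D * (1 + F x)) * (C * decay 1 x)"
        unfolding norm_mult using that C F(2)[of x] D by (intro mult_mono) auto
      also have "\<dots> = (2 * ?D * C) * (decay 1 x + F x * decay 1 x)"
        by (simp add: algebra_simps)
      also have "\<dots> \<le> (2 * ?D * C) * (decay 1 x + F x * 1)"
        using C D F(2)[of x] by (intro mult_left_mono add_left_mono decay_le_1) auto
      finally show ?thesis
        by simp
    qed
    have lim_integral: "(\<lambda>n. LINT x|lborel. (\<Sum>k<n. h k x) * \<phi> x) \<longlonglongrightarrow> (LINT x|lborel. g' x * \<phi> x)"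
      and int: "integrable lborel (\<lambda>x. g' x * \<phi> x)"
    proof -
      have lim: "AE x in lborel. (\<lambda>n. (\<Sum>k<n. h k x) * \<phi> x) \<longlonglongrightarrow> g' x * \<phi> x"
        using sums by eventually_elim (intro tendsto_intros)
      have bd: "AE x in lborel. norm ((\<Sum>k<n. h k x) * \<phi> x) \<le> ?w x" for n
        using partial_bound by eventually_elim (use bound in blast)
      show "(\<lambda>n. LINT x|lborel. (\<Sum>k<n. h k x) * \<phi> x) \<longlonglongrightarrow> (LINT x|lborel. g' x * \<phi> x)"
        by (rule integral_dominated_convergence[OF _ _ w lim bd]) measurable
      show "integrable lborel (\<lambda>x. g' x * \<phi> x)"
        by (rule integrable_dominated_convergence[OF _ _ w lim bd]) measurable
    qed
    show "integrable lborel (\<lambda>x. g' x * \<phi> x)"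
      by (rule int)
    have h_int: "integrable lborel (\<lambda>x. h k x * \<phi> x)" "projection k \<phi> = (LINT x|lborel. h k x * \<phi> x)" for k
      using represents_borel_version[OF h, of "h k" k \<phi>] \<phi> by auto
    have "(LINT x|lborel. (\<Sum>k<n. h k x) * \<phi> x) = (\<Sum>k<n. projection k \<phi>)" for n
      unfolding sum_distrib_right h_int(2) by (rule Bochner_Integration.integral_sum) (rule h_int)
    moreover have "(\<lambda>n. \<Sum>k<n. projection k \<phi>) \<longlonglongrightarrow> dist_of_fun g \<phi>"
      using littlewood_paley g_besov \<phi> by (simp add: littlewood_paley_def besov_def sums_def)
    ultimately show "dist_of_fun g \<phi> = (LINT x|lborel. g' x * \<phi> x)"
      using lim_integral LIMSEQ_unique by auto
  qed measurable
  then have eq: "AE x in lborel. g x = g' x"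
    using represents_unique[OF g_represents] by blast
  have rep: "represents (conv (kernel k) g') (projection k)" for k
    using lp_symbol_smooth[of k] lp_proj_represents_conv[OF _ g'_L1 _ eq] g_represents
    by (auto simp: represents_def[of g])
  have AE_conv: "AE x in lborel. \<forall>k. h k x = conv (kernel k) g' x"
    unfolding AE_all_countable using represents_unique[OF h rep] by blast
  show thesis
  proof (rule that[OF g'_L1 eq _ F])
    show "cont_rep (projection k) = conv (kernel k) g'" for k
      using lp_symbol_smooth[of k] conv_inv_fourier_continuous[OF _ g'_L1] by (intro cont_rep_eqI rep) auto
    show "AE x in lborel. \<forall>k. norm (conv (kernel k) g' x) \<le> \<rho> ^ k * F x powr (1 / p)"
      using AE_conv hF by eventually_elim simp
    show "AE x in lborel. g' x = (\<Sum>k. conv (kernel k) g' x)"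
      using AE_conv by eventually_elim (simp add: g'_def)
  qed
qed

end

section \<open>Estimates at points of controlled growth\<close>

text \<open>The kernels of the dilated symbols are L1-normalized dilates of one profile; the point
  of the predicate is a single constant for all \<open>k\<close>.\<close>

definition dyadic_kernel_bound :: "(real^'n \<Rightarrow> complex) \<Rightarrow> real \<Rightarrow> bool" where
  "dyadic_kernel_bound f C \<longleftrightarrow>
    (\<forall>k w. norm (inv_fourier (\<lambda>\<xi>. f (\<xi> /\<^sub>R 2 ^ k)) w) \<le> C * (2 ^ k) ^ CARD('n) * decay (2 ^ k) w) \<and>
    (\<forall>k w w'. 2 ^ k * norm (w' - w) \<le> 1 \<longrightarrow>
      norm (inv_fourier (\<lambda>\<xi>. f (\<xi> /\<^sub>R 2 ^ k)) w' - inv_fourier (\<lambda>\<xi>. f (\<xi> /\<^sub>R 2 ^ k)) w)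
        \<le> C * (2 ^ k) ^ CARD('n) * (2 ^ k * norm (w' - w)) * decay (2 ^ k) w)"

lemma dyadic_kernel_bound_mono:
  fixes f :: "real^'n \<Rightarrow> complex"
  assumes "dyadic_kernel_bound f C" "C \<le> C'"
  shows "dyadic_kernel_bound f C'"
  unfolding dyadic_kernel_bound_def
proof (intro conjI allI impI)
  fix k and w w' :: "real^'n"
  have le: "C * (2 ^ k) ^ CARD('n) * decay (2 ^ k) w \<le> C' * (2 ^ k) ^ CARD('n) * decay (2 ^ k) w"
    "C * (2 ^ k) ^ CARD('n) * (2 ^ k * norm (w' - w)) * decay (2 ^ k) w
      \<le> C' * (2 ^ k) ^ CARD('n) * (2 ^ k * norm (w' - w)) * decay (2 ^ k) w"
    using assms(2) by (intro mult_right_mono; simp)+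
  show "norm (inv_fourier (\<lambda>\<xi>. f (\<xi> /\<^sub>R 2 ^ k)) w) \<le> C' * (2 ^ k) ^ CARD('n) * decay (2 ^ k) w"
    using assms(1) unfolding dyadic_kernel_bound_def by (intro order_trans[OF _ le(1)]) simp
  assume "2 ^ k * norm (w' - w) \<le> 1"
  then show "norm (inv_fourier (\<lambda>\<xi>. f (\<xi> /\<^sub>R 2 ^ k)) w' - inv_fourier (\<lambda>\<xi>. f (\<xi> /\<^sub>R 2 ^ k)) w)
        \<le> C' * (2 ^ k) ^ CARD('n) * (2 ^ k * norm (w' - w)) * decay (2 ^ k) w"
    using assms(1) unfolding dyadic_kernel_bound_def by (intro order_trans[OF _ le(2)]) simp
qed

lemma dyadic_kernel_bound_exists:
  fixes f :: "real^'n \<Rightarrow> complex"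
  assumes f: "smooth_in_ball R f"
  shows "\<exists>C\<ge>0. dyadic_kernel_bound f C"
proof -
  obtain C1 where C1: "0 \<le> C1" "\<And>x. norm (inv_fourier f x) \<le> C1 * decay 1 x"
    using inv_fourier_decay[OF f] by blast
  obtain C2 where C2: "0 \<le> C2"
    "\<And>x y. norm (y - x) \<le> 1 \<Longrightarrow> norm (inv_fourier f y - inv_fourier f x) \<le> C2 * norm (y - x) * decay 1 x"
    using inv_fourier_lipschitz[OF f] by blast
  have scale: "inv_fourier (\<lambda>\<xi>. f (\<xi> /\<^sub>R 2 ^ k)) w = of_real ((2 ^ k) ^ CARD('n)) * inv_fourier f (2 ^ k *\<^sub>R w)" for k w
    using inv_fourier_scale[OF smooth_in_ball_measurable[OF f], of "2 ^ k" w] by simp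
  have decay: "decay 1 (2 ^ k *\<^sub>R w) = decay (2 ^ k) w" for k and w :: "real^'n"
    by (simp add: decay_def)
  have "dyadic_kernel_bound f (C1 + C2)"
    unfolding dyadic_kernel_bound_def
  proof (intro conjI allI impI)
    fix k and w w' :: "real^'n"
    let ?t = "(2 ^ k) ^ CARD('n) :: real"
    have "norm (inv_fourier f (2 ^ k *\<^sub>R w)) \<le> (C1 + C2) * decay (2 ^ k) w"
      using C1(2)[of "2 ^ k *\<^sub>R w"] C2(1) by (simp add: decay distrib_right add_increasing2)
    then have "?t * norm (inv_fourier f (2 ^ k *\<^sub>R w)) \<le> ?t * ((C1 + C2) * decay (2 ^ k) w)"
      by (rule mult_left_mono) simp
    then show "norm (inv_fourier (\<lambda>\<xi>. f (\<xi> /\<^sub>R 2 ^ k)) w) \<le> (C1 + C2) * ?t * decay (2 ^ k) w"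
      unfolding scale by (simp add: norm_mult norm_power mult_ac)
    assume "2 ^ k * norm (w' - w) \<le> 1"
    moreover have norm_diff: "norm (2 ^ k *\<^sub>R w' - 2 ^ k *\<^sub>R w) = 2 ^ k * norm (w' - w)"
      by (simp flip: scaleR_diff_right)
    ultimately have "norm (inv_fourier f (2 ^ k *\<^sub>R w') - inv_fourier f (2 ^ k *\<^sub>R w))
        \<le> C2 * (2 ^ k * norm (w' - w)) * decay (2 ^ k) w"
      using C2(2)[of "2 ^ k *\<^sub>R w'" "2 ^ k *\<^sub>R w"] by (simp add: decay)
    also have "\<dots> \<le> (C1 + C2) * (2 ^ k * norm (w' - w)) * decay (2 ^ k) w"
      using C1(1) by (intro mult_right_mono) auto
    finally have "?t * norm (inv_fourier f (2 ^ k *\<^sub>R w') - inv_fourier f (2 ^ k *\<^sub>R w))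
        \<le> ?t * ((C1 + C2) * (2 ^ k * norm (w' - w)) * decay (2 ^ k) w)"
      by (rule mult_left_mono) simp
    then show "norm (inv_fourier (\<lambda>\<xi>. f (\<xi> /\<^sub>R 2 ^ k)) w' - inv_fourier (\<lambda>\<xi>. f (\<xi> /\<^sub>R 2 ^ k)) w)
        \<le> (C1 + C2) * ?t * (2 ^ k * norm (w' - w)) * decay (2 ^ k) w"
      unfolding scale by (simp add: norm_mult norm_power mult_ac flip: right_diff_distrib)
  qed
  then show ?thesis
    using C1(1) C2(1) add_nonneg_nonneg by blast
qed

lemma (in besov_function) kernel_bounds:
  obtains C where "0 \<le> C"
    "\<And>k w. norm (kernel k w) \<le> C * (2 ^ k) ^ CARD('n) * decay (2 ^ k) w"
    "\<And>k w w'. 2 ^ k * norm (w' - w) \<le> 1 \<Longrightarrow>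
      norm (kernel k w' - kernel k w) \<le> C * (2 ^ k) ^ CARD('n) * (2 ^ k * norm (w' - w)) * decay (2 ^ k) w"
proof -
  obtain R1 R where m: "smooth_in_ball R1 m1" "smooth_in_ball R m"
    using littlewood_paley unfolding littlewood_paley_def smooth_in_ball_def by blast
  obtain C1 C2 where C: "0 \<le> C1" "0 \<le> C2" "dyadic_kernel_bound m1 C1" "dyadic_kernel_bound m C2"
    using dyadic_kernel_bound_exists m by blast
  \<comment> \<open>All symbols are dilates of only two profiles; at \<open>k = 0\<close> the
    dilation is trivial, so the low-frequency symbol has the same form.\<close>
  define f where "f k = (if k = 0 then m1 else m)" for k :: nat
  have "dyadic_kernel_bound (f k) (C1 + C2)" for k
    using C by (auto simp: f_def intro: dyadic_kernel_bound_mono)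
  moreover have "lp_symbol m1 m k = (\<lambda>\<xi>. f k (\<xi> /\<^sub>R 2 ^ k))" for k
    by (simp add: lp_symbol_def f_def)
  ultimately show thesis
    using C by (intro that[of "C1 + C2"]) (simp_all add: dyadic_kernel_bound_def)
qed

locale besov_decomposition = besov_function m1 m g s p
  for m1 m g :: "real^'n \<Rightarrow> complex" and s p :: real +
  fixes g' :: "real^'n \<Rightarrow> complex" and F :: "real^'n \<Rightarrow> real"
  assumes g'_L1: "L1_plus_bounded g'"
    and F_int: "integrable lborel F" and F_nonneg: "\<And>x. 0 \<le> F x"
    and piece_bound: "AE x in lborel. \<forall>k. norm (conv (kernel k) g' x) \<le> \<rho> ^ k * F x powr (1 / p)"
    and pieces_sum: "AE x in lborel. g' x = (\<Sum>k. conv (kernel k) g' x)"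
begin

abbreviation piece :: "nat \<Rightarrow> real^'n \<Rightarrow> complex" where
  "piece k \<equiv> conv (kernel k) g'"

definition \<beta> :: real where "\<beta> = s - 1 / p"

text \<open>This rate takes the place of \<open>\<rho>\<close> at points of controlled growth, where
  the p-th root of \<open>F\<close> costs a factor 2^(1/p) per dyadic scale.\<close>

definition \<mu> :: real where "\<mu> = 2 powr - \<beta>"

lemma \<beta>_bounds: "0 < \<beta>" "\<beta> < 1"
  using s_gt s_less by (auto simp: \<beta>_def)

text \<open>\<open>\<beta> < 1\<close> gives \<open>1 < 2 * \<mu>\<close>, so that sums of powers of
  \<open>2 * \<mu>\<close> are governed by their last term; \<open>0 < \<beta>\<close> gives
  \<open>\<mu> < 1\<close> and hence convergence of the series at \<open>y\<close>.\<close>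

lemma \<mu>_bounds: "1 / 2 < \<mu>" "0 < \<mu>" "\<mu> < 1"
proof -
  have "(2::real) powr - 1 < 2 powr - \<beta>"
    using \<beta>_bounds by (intro powr_less_mono) auto
  then show "1 / 2 < \<mu>"
    by (simp add: \<mu>_def powr_minus)
  show "0 < \<mu>" "\<mu> < 1"
    using \<beta>_bounds by (auto simp: \<mu>_def powr_less_one)
qed

lemma F_measurable [measurable]: "F \<in> borel_measurable borel"
  using borel_measurable_integrable[OF F_int] by simp

lemma g'_measurable [measurable]: "g' \<in> borel_measurable borel"
  by (rule L1_plus_bounded_measurable[OF g'_L1])

lemma kernel_measurable [measurable]: "kernel k \<in> borel_measurable borel"
  using lp_symbol_smooth inv_fourier_measurable by blast

lemma kernel_decay: "\<exists>C. \<forall>x. norm (kernel k x) \<le> C * decay 1 x"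
  using lp_symbol_smooth[of k] inv_fourier_decay by metis

lemma piece_L1: "L1_plus_bounded (piece k)"
  using conv_bounded[OF g'_L1 kernel_measurable] kernel_decay[of k] L1_plus_bounded_of_bounded
  by (metis conv_measurable g'_measurable kernel_measurable)

lemma tail_bound: "AE x in lborel. \<forall>n. norm (g' x - (\<Sum>k<n. piece k x)) \<le> \<rho> ^ n / (1 - \<rho>) * F x powr (1 / p)"
  using piece_bound pieces_sum
proof eventually_elim
  fix x
  assume "\<forall>k. norm (piece k x) \<le> \<rho> ^ k * F x powr (1 / p)" "g' x = (\<Sum>k. piece k x)"
  then show "\<forall>n. norm (g' x - (\<Sum>k<n. piece k x)) \<le> \<rho> ^ n / (1 - \<rho>) * F x powr (1 / p)"
    using geometric_summable(2)[OF \<rho>_bounds, of "\<lambda>k. piece k x"] by simp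
qed

lemma conv_integrable:
  "L1_plus_bounded w \<Longrightarrow> integrable lborel (\<lambda>x. w x * kernel k (y - x))"
  using L1_plus_bounded_conv[of w] kernel_decay[of k] kernel_measurable by metis

text \<open>Only frequencies at least comparable to \<open>2 ^ k\<close> contribute to the \<open>k\<close>-th piece, and on these
  the defining series of \<open>g'\<close> already has the decay \<open>\<rho> ^ k\<close>.\<close>

lemma localization:
  obtains w C where "0 \<le> C" "\<And>k. L1_plus_bounded (w k)" "\<And>k y. piece k y = conv (kernel k) (w k) y"
    "AE x in lborel. \<forall>k. norm (w k x) \<le> C * \<rho> ^ k * F x powr (1 / p)"
proof -
  obtain a b where ab: "0 < a" "0 < b" "\<And>k. smooth_in_ball (b * 2 ^ k) (lp_symbol m1 m k)"
    "\<And>k \<xi>. 0 < k \<Longrightarrow> lp_symbol m1 m k \<xi> \<noteq> 0 \<Longrightarrow> a * 2 ^ k \<le> norm \<xi>"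
    using lp_symbol_support by blast
  \<comment> \<open>\<open>c\<close> measures the frequency overlap: for \<open>j < k - c\<close>
    the support radius \<open>b * 2 ^ j\<close> stays below \<open>a * 2 ^ k\<close>, where the
    support of the k-th symbol begins.\<close>
  obtain c where c: "b / a < 2 ^ c"
    using real_arch_pow[of 2 "b / a"] by auto
  define w where "w k x = g' x - (\<Sum>j<k - c. piece j x)" for k x
  \<comment> \<open>The tail from index \<open>k - c\<close> on has size
    \<open>\<rho> ^ (k - c)\<close>, and \<open>(1 / \<rho>) ^ c\<close> restores
    \<open>\<rho> ^ k\<close>. This covers \<open>k \<le> c\<close> as well, where the truncated
    difference is 0 and nothing is subtracted from \<open>g'\<close>.\<close>
  define C where "C = (1 / \<rho>) ^ c / (1 - \<rho>)"
  have C: "0 \<le> C"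
    using \<rho>_bounds by (simp add: C_def)
  have orth: "conv (kernel k) (piece j) y = 0" if "j < k - c" for j k y
  proof (rule conv_conv_orthogonal[OF ab(3) ab(3) _ g'_L1])
    fix \<xi> assume \<xi>: "lp_symbol m1 m k \<xi> \<noteq> 0"
    have "b * 2 ^ j < a * 2 ^ c * 2 ^ j"
      using c ab by (intro mult_strict_right_mono) (auto simp: field_simps)
    also have "\<dots> = a * 2 ^ (c + j)"
      by (simp add: power_add)
    also have "\<dots> \<le> a * 2 ^ k"
      using that ab by (intro mult_left_mono power_increasing) auto
    also have "\<dots> \<le> norm \<xi>"
      using that \<xi> by (intro ab(4)) auto
    finally show "b * 2 ^ j < norm \<xi>" .
  qed
  have piece_eq: "piece k y = conv (kernel k) (w k) y" for k y
  proof -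
    have "conv (kernel k) (w k) y
        = (LINT x|lborel. g' x * kernel k (y - x) - (\<Sum>j<k - c. piece j x * kernel k (y - x)))"
      by (simp add: conv_def[of _ "w k"] w_def left_diff_distrib sum_distrib_right)
    also have "\<dots> = piece k y - (\<Sum>j<k - c. conv (kernel k) (piece j) y)"
    proof -
      have "(LINT x|lborel. (\<Sum>j<k - c. piece j x * kernel k (y - x))) = (\<Sum>j<k - c. conv (kernel k) (piece j) y)"
        unfolding conv_def[of "kernel k" "piece _"]
        by (intro Bochner_Integration.integral_sum conv_integrable piece_L1)
      then show ?thesis
        by (subst Bochner_Integration.integral_diff)
          (auto simp: conv_def[of "kernel k" g'] intro!: conv_integrable g'_L1 piece_L1 Bochner_Integration.integrable_sum)
    qed
    finally show ?thesis
      by (simp add: orth)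
  qed
  have w_bound: "AE x in lborel. \<forall>k. norm (w k x) \<le> C * \<rho> ^ k * F x powr (1 / p)"
    using tail_bound
  proof eventually_elim
    fix x assume tail: "\<forall>n. norm (g' x - (\<Sum>k<n. piece k x)) \<le> \<rho> ^ n / (1 - \<rho>) * F x powr (1 / p)"
    show "\<forall>k. norm (w k x) \<le> C * \<rho> ^ k * F x powr (1 / p)"
    proof
      fix k
      have "\<rho> ^ (k - c) * \<rho> ^ c \<le> \<rho> ^ k"
        using \<rho>_bounds by (simp flip: power_add)
      then have "\<rho> ^ (k - c) \<le> (1 / \<rho>) ^ c * \<rho> ^ k"
        using \<rho>_bounds by (simp add: field_simps power_divide)
      then have "\<rho> ^ (k - c) / (1 - \<rho>) * F x powr (1 / p) \<le> (1 / \<rho>) ^ c * \<rho> ^ k / (1 - \<rho>) * F x powr (1 / p)"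
        using \<rho>_bounds by (intro mult_right_mono divide_right_mono) auto
      then show "norm (w k x) \<le> C * \<rho> ^ k * F x powr (1 / p)"
        using tail[rule_format, of "k - c"] by (simp add: w_def C_def)
    qed
  qed
  have [measurable]: "w k \<in> borel_measurable borel" for k
    unfolding w_def by measurable
  have "L1_plus_bounded (w k)" for k
    unfolding L1_plus_bounded_def
  proof (intro conjI exI)
    show "integrable lborel (\<lambda>x. C * \<rho> ^ k * F x)"
      using F_int by (rule integrable_mult_right)
    show "AE x in lborel. norm (w k x) \<le> C * \<rho> ^ k + C * \<rho> ^ k * F x"
      using w_bound
    proof eventually_elim
      fix x assume "\<forall>k. norm (w k x) \<le> C * \<rho> ^ k * F x powr (1 / p)"
      then have "norm (w k x) \<le> C * \<rho> ^ k * F x powr (1 / p)"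
        by blast
      also have "\<dots> \<le> C * \<rho> ^ k * (1 + F x)"
        using C \<rho>_bounds powr_inverse_p_le[OF F_nonneg[of x]] by (intro mult_left_mono) auto
      finally show "norm (w k x) \<le> C * \<rho> ^ k + C * \<rho> ^ k * F x"
        by (simp add: distrib_left)
    qed
  qed measurable
  then show thesis
    by (rule that[OF C _ piece_eq w_bound])
qed

text \<open>Since s = \<beta> + 1/p, part of the decay rescales \<open>t\<close> to
  \<open>t / 2 ^ k\<close>, which for values of \<open>F\<close> is at most of order 1 on average at
  scale 2^-k near a point of controlled growth; only then is the root linearized.\<close>

lemma \<rho>_power_F_le: "0 \<le> t \<Longrightarrow> \<rho> ^ k * t powr (1 / p) \<le> \<mu> ^ k * (1 + t / 2 ^ k)"
proof -
  assume t: "0 \<le> t"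
  have "t powr (1 / p) = (2 ^ k * (t / 2 ^ k)) powr (1 / p)"
    by simp
  also have "\<dots> = (2 ^ k) powr (1 / p) * (t / 2 ^ k) powr (1 / p)"
    by (rule powr_mult)
  also have "\<rho> ^ k * \<dots> = \<mu> ^ k * (t / 2 ^ k) powr (1 / p)"
    by (simp add: \<rho>_def \<mu>_def \<beta>_def two_powr_power flip: powr_add)
  also have "\<dots> \<le> \<mu> ^ k * (1 + t / 2 ^ k)"
    using t \<mu>_bounds by (intro mult_left_mono powr_inverse_p_le) auto
  finally show ?thesis .
qed

definition growth_at :: "real^'n \<Rightarrow> real \<Rightarrow> bool" where
  "growth_at y A \<longleftrightarrow> (\<forall>r>0. (\<integral>\<^sup>+z\<in>ball y r. ennreal (F z) \<partial>lborel) \<le> ennreal (A * r ^ (CARD('n) - 1)))"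

text \<open>With n the dimension, the constant of the linearized bound integrates to order 2^(-k n),
  and \<open>F / 2 ^ k\<close> to order 2^(-k) 2^(-k (n - 1)): the growth exponent makes the two
  agree. They are the two summands of \<open>D\<close>.\<close>

lemma local_average:
  assumes y: "growth_at y A" and A: "0 \<le> A" and [measurable]: "\<And>k. w k \<in> borel_measurable borel"
    and w: "AE x in lborel. \<forall>k. norm (w k x) \<le> C * \<rho> ^ k * F x powr (1 / p)" and C: "0 \<le> C"
  obtains M where "0 \<le> M" "\<And>k. integrable lborel (\<lambda>z. decay (2 ^ k) (y - z) * norm (w k z))"
    "\<And>k. (LINT z|lborel. decay (2 ^ k) (y - z) * norm (w k z)) \<le> M * \<mu> ^ k / (2 ^ k) ^ CARD('n)"
proof -
  define D where "D = 2 ^ (CARD('n) + 2) * unit_ball_vol (CARD('n)) + 2 ^ (CARD('n) + 2) * A"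
  have D: "0 \<le> D"
    using A by (simp add: D_def)
  have nn: "(\<integral>\<^sup>+z. ennreal (decay (2 ^ k) (y - z) * norm (w k z)) \<partial>lborel) \<le> ennreal (C * D * \<mu> ^ k / (2 ^ k) ^ CARD('n))" for k
  proof -
    let ?t = "2 ^ k :: real"
    let ?d = "\<lambda>z. ennreal (decay ?t (y - z))"
    have "(\<integral>\<^sup>+z. ennreal (decay ?t (y - z) * norm (w k z)) \<partial>lborel)
        \<le> (\<integral>\<^sup>+z. ennreal (C * \<mu> ^ k) * (?d z + ennreal (1 / ?t) * (?d z * ennreal (F z))) \<partial>lborel)"
    proof (rule nn_integral_mono_AE)
      show "AE z in lborel. ennreal (decay ?t (y - z) * norm (w k z))
          \<le> ennreal (C * \<mu> ^ k) * (?d z + ennreal (1 / ?t) * (?d z * ennreal (F z)))"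
        using w
      proof eventually_elim
        fix z assume "\<forall>k. norm (w k z) \<le> C * \<rho> ^ k * F z powr (1 / p)"
        then have "norm (w k z) \<le> C * (\<rho> ^ k * F z powr (1 / p))"
          by (simp add: mult.assoc)
        also have "\<dots> \<le> C * (\<mu> ^ k * (1 + F z / ?t))"
          using C F_nonneg by (intro mult_left_mono \<rho>_power_F_le) auto
        finally have "decay ?t (y - z) * norm (w k z) \<le> decay ?t (y - z) * (C * (\<mu> ^ k * (1 + F z / ?t)))"
          by (rule mult_left_mono) simp
        also have "\<dots> = (C * \<mu> ^ k) * (decay ?t (y - z) + 1 / ?t * (decay ?t (y - z) * F z))"
          by (simp add: algebra_simps)
        finally have "ennreal (decay ?t (y - z) * norm (w k z))
            \<le> ennreal ((C * \<mu> ^ k) * (decay ?t (y - z) + 1 / ?t * (decay ?t (y - z) * F z)))"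
          by (rule ennreal_leI)
        also have "\<dots> = ennreal (C * \<mu> ^ k) * (?d z + ennreal (1 / ?t) * (?d z * ennreal (F z)))"
        proof -
          have en: "ennreal (a * (b + c * (b * d))) = ennreal a * (ennreal b + ennreal c * (ennreal b * ennreal d))"
            if "0 \<le> a" "0 \<le> b" "0 \<le> c" "0 \<le> d" for a b c d
            using that by (simp add: ennreal_mult ennreal_plus)
          show ?thesis
            by (rule en) (use C \<mu>_bounds F_nonneg in auto)
        qed
        finally show "ennreal (decay ?t (y - z) * norm (w k z)) \<le> \<dots>" .
      qed
    qed
    also have "\<dots> = ennreal (C * \<mu> ^ k) * ((\<integral>\<^sup>+z. ?d z \<partial>lborel) + ennreal (1 / ?t) * (\<integral>\<^sup>+z. ?d z * ennreal (F z) \<partial>lborel))"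
      by (simp add: nn_integral_cmult nn_integral_add)
    also have "\<dots> \<le> ennreal (C * \<mu> ^ k) * (ennreal (2 ^ (CARD('n) + 2) * unit_ball_vol (CARD('n)) / ?t ^ CARD('n))
        + ennreal (1 / ?t) * ennreal (2 ^ (CARD('n) + 2) * A / ?t ^ (CARD('n) - 1)))"
    proof (intro mult_left_mono add_mono)
      show "(\<integral>\<^sup>+z. ?d z \<partial>lborel) \<le> ennreal (2 ^ (CARD('n) + 2) * unit_ball_vol (CARD('n)) / ?t ^ CARD('n))"
        using nn_integral_decay_lborel[of ?t y] by simp
      show "(\<integral>\<^sup>+z. ?d z * ennreal (F z) \<partial>lborel) \<le> ennreal (2 ^ (CARD('n) + 2) * A / ?t ^ (CARD('n) - 1))"
        using nn_integral_decay[of "\<lambda>z. ennreal (F z)" ?t "CARD('n) - 1" A y] A y by (simp add: growth_at_def)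
    qed auto
    also have "\<dots> = ennreal ((C * \<mu> ^ k) * (2 ^ (CARD('n) + 2) * unit_ball_vol (CARD('n)) / ?t ^ CARD('n)
        + 1 / ?t * (2 ^ (CARD('n) + 2) * A / ?t ^ (CARD('n) - 1))))"
    proof -
      have en: "ennreal a * (ennreal b + ennreal c * ennreal d) = ennreal (a * (b + c * d))"
        if "0 \<le> a" "0 \<le> b" "0 \<le> c" "0 \<le> d" for a b c d
        using that by (simp add: ennreal_mult ennreal_plus)
      show ?thesis
        by (rule en) (use C A \<mu>_bounds in auto)
    qed
    also have "(C * \<mu> ^ k) * (2 ^ (CARD('n) + 2) * unit_ball_vol (CARD('n)) / ?t ^ CARD('n)
        + 1 / ?t * (2 ^ (CARD('n) + 2) * A / ?t ^ (CARD('n) - 1))) = C * D * \<mu> ^ k / ?t ^ CARD('n)"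
    proof -
      have "?t * ?t ^ (CARD('n) - 1) = ?t ^ CARD('n)"
        by (simp flip: power_Suc)
      then have "1 / ?t * (2 ^ (CARD('n) + 2) * A / ?t ^ (CARD('n) - 1)) = 2 ^ (CARD('n) + 2) * A / ?t ^ CARD('n)"
        by (simp del: power_Suc)
      then show ?thesis
        by (simp only: D_def add_divide_distrib[symmetric]) simp
    qed
    finally show ?thesis .
  qed
  have int: "integrable lborel (\<lambda>z. decay (2 ^ k) (y - z) * norm (w k z))" for k
  proof (rule integrableI_nonneg)
    show "(\<integral>\<^sup>+z. ennreal (decay (2 ^ k) (y - z) * norm (w k z)) \<partial>lborel) < \<infinity>"
      using nn[of k] by (rule le_less_trans) simp
  qed auto
  have "(LINT z|lborel. decay (2 ^ k) (y - z) * norm (w k z)) \<le> C * D * \<mu> ^ k / (2 ^ k) ^ CARD('n)" for k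
  proof -
    have "ennreal (LINT z|lborel. decay (2 ^ k) (y - z) * norm (w k z)) \<le> ennreal (C * D * \<mu> ^ k / (2 ^ k) ^ CARD('n))"
      using nn[of k] nn_integral_eq_integral[OF int[of k]] by simp
    then show ?thesis
      using C D \<mu>_bounds by (subst (asm) ennreal_le_iff) auto
  qed
  with int C D show thesis
    by (intro that[of "C * D"]) auto
qed

text \<open>The bounds on \<open>w k\<close> hold only a.e., but under the integral they control the
  value at the single point \<open>y\<close>. The normalization \<open>(2 ^ k) ^ CARD('n)\<close> of
  the kernel cancels against the local average.\<close>

lemma pointwise_bounds:
  assumes y: "growth_at y A" and A: "0 \<le> A"
  obtains M where "0 \<le> M" "\<And>k. norm (piece k y) \<le> \<mu> ^ k * M"
    "\<And>k x. 2 ^ k * norm (x - y) \<le> 1 \<Longrightarrow> norm (piece k x - piece k y) \<le> M * (2 ^ k * norm (x - y)) * \<mu> ^ k"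
proof -
  obtain w C where C: "0 \<le> C" and w: "\<And>k. L1_plus_bounded (w k)" "\<And>k y. piece k y = conv (kernel k) (w k) y"
    "AE x in lborel. \<forall>k. norm (w k x) \<le> C * \<rho> ^ k * F x powr (1 / p)"
    by (rule localization) (rule that)
  note w_meas [measurable] = L1_plus_bounded_measurable[OF w(1)]
  obtain M where M: "0 \<le> M" "\<And>k. integrable lborel (\<lambda>z. decay (2 ^ k) (y - z) * norm (w k z))"
    "\<And>k. (LINT z|lborel. decay (2 ^ k) (y - z) * norm (w k z)) \<le> M * \<mu> ^ k / (2 ^ k) ^ CARD('n)"
    by (rule local_average[OF y A w_meas w(3) C]) (rule that)
  obtain C' where C': "0 \<le> C'"
    "\<And>k w. norm (kernel k w) \<le> C' * (2 ^ k) ^ CARD('n) * decay (2 ^ k) w"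
    "\<And>k w w'. 2 ^ k * norm (w' - w) \<le> 1 \<Longrightarrow>
      norm (kernel k w' - kernel k w) \<le> C' * (2 ^ k) ^ CARD('n) * (2 ^ k * norm (w' - w)) * decay (2 ^ k) w"
    by (rule kernel_bounds) (rule that)
  \<comment> \<open>Serves both estimates: \<open>c = 1\<close> for the kernel and
    \<open>c = 2 ^ k * norm (x - y)\<close> for its increment.\<close>
  have key: "(LINT z|lborel. norm (w k z) * \<kappa> z) \<le> C' * M * c * \<mu> ^ k"
    if \<kappa>: "\<And>z. \<kappa> z \<le> C' * (2 ^ k) ^ CARD('n) * c * decay (2 ^ k) (y - z)" and c: "0 \<le> c" for k c and \<kappa> :: "real^'n \<Rightarrow> real"
  proof -
    let ?b = "C' * (2 ^ k) ^ CARD('n) * c"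
    have "(LINT z|lborel. norm (w k z) * \<kappa> z) \<le> (LINT z|lborel. ?b * (decay (2 ^ k) (y - z) * norm (w k z)))"
    proof (rule integral_mono')
      show "integrable lborel (\<lambda>z. ?b * (decay (2 ^ k) (y - z) * norm (w k z)))"
        using M(2) by (rule integrable_mult_right)
      show "norm (w k z) * \<kappa> z \<le> ?b * (decay (2 ^ k) (y - z) * norm (w k z))" for z
        using mult_left_mono[OF \<kappa>[of z] norm_ge_zero[of "w k z"]] by (simp add: mult_ac)
      show "0 \<le> ?b * (decay (2 ^ k) (y - z) * norm (w k z))" for z
        using C' c by (intro mult_nonneg_nonneg) auto
    qed
    also have "\<dots> = ?b * (LINT z|lborel. decay (2 ^ k) (y - z) * norm (w k z))"
      by simp
    also have "\<dots> \<le> ?b * (M * \<mu> ^ k / (2 ^ k) ^ CARD('n))"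
      using C' c by (intro mult_left_mono M) auto
    finally show ?thesis
      by (simp add: mult_ac)
  qed
  show thesis
  proof
    show "0 \<le> C' * M"
      using C' M by simp
    show "norm (piece k y) \<le> \<mu> ^ k * (C' * M)" for k
    proof -
      have "norm (piece k y) \<le> (LINT z|lborel. norm (w k z) * norm (kernel k (y - z)))"
        unfolding w(2) conv_def[of _ "w k"]
        using integral_norm_bound[of lborel "\<lambda>z. w k z * kernel k (y - z)"] by (simp add: norm_mult)
      also have "\<dots> \<le> C' * M * 1 * \<mu> ^ k"
        by (rule key) (use C'(2) in auto)
      finally show ?thesis
        by (simp add: mult_ac)
    qed
    show "norm (piece k x - piece k y) \<le> C' * M * (2 ^ k * norm (x - y)) * \<mu> ^ k"
      if x: "2 ^ k * norm (x - y) \<le> 1" for k x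
    proof -
      obtain B where "\<And>x. norm (kernel k x) \<le> B * decay 1 x"
        using kernel_decay by blast
      then have "norm (piece k x - piece k y) \<le> (LINT z|lborel. norm (w k z) * norm (kernel k (x - z) - kernel k (y - z)))"
        unfolding w(2) by (intro norm_conv_diff_le w kernel_measurable)
      also have "\<dots> \<le> C' * M * (2 ^ k * norm (x - y)) * \<mu> ^ k"
      proof (rule key)
        show "norm (kernel k (x - z) - kernel k (y - z))
            \<le> C' * (2 ^ k) ^ CARD('n) * (2 ^ k * norm (x - y)) * decay (2 ^ k) (y - z)" for z
          using C'(3)[of k "x - z" "y - z"] x by simp
      qed simp
      finally show ?thesis .
    qed
  qed
qed

end

section \<open>Oscillation at points of controlled growth\<close>

lemma dyadic_scale:
  fixes r :: real
  assumes "0 < r" "r \<le> 1"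
  obtains J where "2 ^ J * r \<le> 1" "1 < 2 ^ Suc J * r"
proof -
  obtain n where n: "1 / r < 2 ^ n"
    using real_arch_pow[of 2 "1 / r"] by auto
  define N where "N = (LEAST n. 1 / r < 2 ^ n)"
  have N: "1 / r < 2 ^ N"
    unfolding N_def using n by (rule LeastI)
  then have "N \<noteq> 0"
    using assms by (intro notI) (simp add: divide_less_eq)
  then obtain J where J: "N = Suc J"
    using not0_implies_Suc by blast
  then have "\<not> 1 / r < 2 ^ J"
    using not_less_Least[of J "\<lambda>n. 1 / r < 2 ^ n"] by (simp add: N_def)
  then show thesis
    using N J assms by (intro that[of J]) (auto simp: field_simps)
qed

context besov_decomposition
begin

text \<open>At the scale \<open>r = 2 ^ - J\<close> the pieces of index at most \<open>J\<close> are treated as Lipschitz functions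
  and the others are small.\<close>

lemma oscillation_bound:
  assumes y: "growth_at y A" and A: "0 \<le> A"
  obtains C fy where "0 \<le> C" "(\<lambda>K. \<Sum>k\<le>K. piece k y) \<longlonglongrightarrow> fy"
    "\<And>r. \<lbrakk>0 < r; r \<le> 1\<rbrakk> \<Longrightarrow>
      AE x in lborel. x \<in> ball y r \<longrightarrow> norm (g' x - fy) \<le> C * r powr \<beta> * (1 + (r * F x) powr (1 / p))"
proof -
  obtain M where M: "0 \<le> M" "\<And>k. norm (piece k y) \<le> \<mu> ^ k * M"
    "\<And>k x. 2 ^ k * norm (x - y) \<le> 1 \<Longrightarrow> norm (piece k x - piece k y) \<le> M * (2 ^ k * norm (x - y)) * \<mu> ^ k"
    by (rule pointwise_bounds[OF y A]) (rule that)
  note geo = geometric_summable[OF \<mu>_bounds(2,3) M(2)]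
  define fy where "fy = (\<Sum>k. piece k y)"
  \<comment> \<open>The three terms bound the tail of the series at \<open>x\<close>, the tail at
    \<open>y\<close>, and the increments of the first \<open>Suc J\<close> pieces.\<close>
  define C where "C = 1 / (1 - \<rho>) + M / (1 - \<mu>) + 2 * M / (2 * \<mu> - 1)"
  have C_parts: "0 \<le> 1 / (1 - \<rho>)" "0 \<le> M / (1 - \<mu>)" "0 \<le> 2 * M / (2 * \<mu> - 1)"
    using \<rho>_bounds \<mu>_bounds M(1) by auto
  show thesis
  proof (rule that)
    show "0 \<le> C"
      using C_parts by (simp add: C_def)
    show "(\<lambda>K. \<Sum>k\<le>K. piece k y) \<longlonglongrightarrow> fy"
      using summable_LIMSEQ'[OF geo(1)] by (simp add: fy_def)
    fix r :: real assume r: "0 < r" "r \<le> 1"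
    obtain J where J: "2 ^ J * r \<le> 1" "1 < 2 ^ Suc J * r"
      using dyadic_scale[OF r] by blast
    let ?N = "Suc J"
    have scale: "(2 powr - a) ^ ?N \<le> r powr a" if "0 < a" for a
    proof -
      have "1 / r \<le> 2 ^ ?N"
        using J(2) r by (simp add: field_simps)
      then have "(2 ^ ?N) powr - a \<le> (1 / r) powr - a"
        using r that by (intro powr_mono2') auto
      also have "\<dots> = r powr a"
        using r by (simp add: powr_minus powr_divide)
      finally show ?thesis
        by (simp only: two_powr_power)
    qed
    have \<mu>N: "\<mu> ^ ?N \<le> r powr \<beta>" and \<rho>N: "\<rho> ^ ?N \<le> r powr s"
      unfolding \<mu>_def \<rho>_def by (intro scale \<beta>_bounds s_pos)+
    show "AE x in lborel. x \<in> ball y r \<longrightarrow> norm (g' x - fy) \<le> C * r powr \<beta> * (1 + (r * F x) powr (1 / p))"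
      using tail_bound
    proof (eventually_elim, intro impI)
      fix x assume tail: "\<forall>n. norm (g' x - (\<Sum>k<n. piece k x)) \<le> \<rho> ^ n / (1 - \<rho>) * F x powr (1 / p)"
        and "x \<in> ball y r"
      then have x: "norm (x - y) \<le> r"
        by (simp add: dist_norm norm_minus_commute)
      let ?f = "(r * F x) powr (1 / p)"
      have high_x: "norm (g' x - (\<Sum>k<?N. piece k x)) \<le> 1 / (1 - \<rho>) * (r powr \<beta> * ?f)"
      proof -
        have "norm (g' x - (\<Sum>k<?N. piece k x)) \<le> \<rho> ^ ?N / (1 - \<rho>) * F x powr (1 / p)"
          using tail by blast
        also have "\<dots> \<le> r powr s / (1 - \<rho>) * F x powr (1 / p)"
          using \<rho>_bounds \<rho>N by (intro mult_right_mono divide_right_mono) auto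
        \<comment> \<open>The factor \<open>r powr (1 / p)\<close> is absorbed into the root as
          \<open>r * F x\<close>, which is at most of order 1 on average over the ball.\<close>
        also have "r powr s = r powr \<beta> * r powr (1 / p)"
          by (simp add: \<beta>_def flip: powr_add)
        finally show ?thesis
          by (simp add: powr_mult mult_ac)
      qed
      have high_y: "norm (fy - (\<Sum>k<?N. piece k y)) \<le> M / (1 - \<mu>) * r powr \<beta>"
      proof -
        have "norm (fy - (\<Sum>k<?N. piece k y)) \<le> \<mu> ^ ?N / (1 - \<mu>) * M"
          unfolding fy_def by (rule geo(2))
        also have "\<dots> \<le> r powr \<beta> / (1 - \<mu>) * M"
          using \<mu>_bounds \<mu>N M(1) by (intro mult_right_mono divide_right_mono) auto
        finally show ?thesis
          by (simp add: mult_ac)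
      qed
      have low: "norm ((\<Sum>k<?N. piece k x) - (\<Sum>k<?N. piece k y)) \<le> 2 * M / (2 * \<mu> - 1) * r powr \<beta>"
      proof -
        have "norm ((\<Sum>k<?N. piece k x) - (\<Sum>k<?N. piece k y)) \<le> (\<Sum>k<?N. M * r * (2 * \<mu>) ^ k)"
          unfolding sum_subtractf[symmetric]
        proof (rule sum_norm_le)
          fix k assume "k \<in> {..<?N}"
          then have "(2::real) ^ k \<le> 2 ^ J"
            by (intro power_increasing) auto
          then have "2 ^ k * norm (x - y) \<le> 2 ^ J * r"
            using x by (intro mult_mono) auto
          then have "norm (piece k x - piece k y) \<le> M * (2 ^ k * norm (x - y)) * \<mu> ^ k"
            using J(1) by (intro M(3)) linarith
          also have "\<dots> \<le> M * (2 ^ k * r) * \<mu> ^ k"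
            using x M(1) \<mu>_bounds by (intro mult_right_mono mult_left_mono) auto
          finally show "norm (piece k x - piece k y) \<le> M * r * (2 * \<mu>) ^ k"
            by (simp add: power_mult_distrib mult_ac)
        qed
        also have "\<dots> = M * r * (\<Sum>k<?N. (2 * \<mu>) ^ k)"
          by (simp only: sum_distrib_left)
        also have "(\<Sum>k<?N. (2 * \<mu>) ^ k) = ((2 * \<mu>) ^ ?N - 1) / (2 * \<mu> - 1)"
          using \<mu>_bounds by (intro geometric_sum) auto
        \<comment> \<open>Dropping the 1 leaves \<open>2 ^ ?N * r\<close>, at most 2, times
          \<open>\<mu> ^ ?N\<close>, at most \<open>r powr \<beta>\<close>; this is the origin of
          the factor 2 in \<open>C\<close>.\<close>
        also have "M * r * \<dots> \<le> M * r * ((2 * \<mu>) ^ ?N / (2 * \<mu> - 1))"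
          using M(1) r \<mu>_bounds by (intro mult_left_mono divide_right_mono) auto
        also have "\<dots> = M / (2 * \<mu> - 1) * ((2 ^ ?N * r) * \<mu> ^ ?N)"
          by (simp add: power_mult_distrib)
        also have "\<dots> \<le> M / (2 * \<mu> - 1) * (2 * r powr \<beta>)"
          using M(1) r \<mu>_bounds J(1) \<mu>N by (intro mult_left_mono mult_mono) auto
        finally show ?thesis
          by (simp add: mult_ac)
      qed
      have "g' x - fy = (g' x - (\<Sum>k<?N. piece k x)) - (fy - (\<Sum>k<?N. piece k y))
          + ((\<Sum>k<?N. piece k x) - (\<Sum>k<?N. piece k y))"
        by simp
      then have "norm (g' x - fy) = norm ((g' x - (\<Sum>k<?N. piece k x)) - (fy - (\<Sum>k<?N. piece k y))
          + ((\<Sum>k<?N. piece k x) - (\<Sum>k<?N. piece k y)))"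
        by (rule arg_cong)
      then have "norm (g' x - fy) \<le> norm (g' x - (\<Sum>k<?N. piece k x)) + norm (fy - (\<Sum>k<?N. piece k y))
          + norm ((\<Sum>k<?N. piece k x) - (\<Sum>k<?N. piece k y))"
        using norm_triangle_ineq[of "(g' x - (\<Sum>k<?N. piece k x)) - (fy - (\<Sum>k<?N. piece k y))"
            "(\<Sum>k<?N. piece k x) - (\<Sum>k<?N. piece k y)"]
          norm_triangle_ineq4[of "g' x - (\<Sum>k<?N. piece k x)" "fy - (\<Sum>k<?N. piece k y)"] by linarith
      also have "\<dots> \<le> 1 / (1 - \<rho>) * (r powr \<beta> * ?f) + M / (1 - \<mu>) * r powr \<beta> + 2 * M / (2 * \<mu> - 1) * r powr \<beta>"
        by (intro add_mono high_x high_y low)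
      also have "\<dots> \<le> 1 / (1 - \<rho>) * (r powr \<beta> * (1 + ?f)) + M / (1 - \<mu>) * (r powr \<beta> * (1 + ?f))
          + 2 * M / (2 * \<mu> - 1) * (r powr \<beta> * (1 + ?f))"
        using C_parts by (intro add_mono mult_left_mono) (auto simp: distrib_left)
      also have "\<dots> = C * r powr \<beta> * (1 + ?f)"
        by (simp add: C_def distrib_right mult.assoc)
      finally show "norm (g' x - fy) \<le> C * r powr \<beta> * (1 + ?f)" .
    qed
  qed
qed

text \<open>The base is at least 1, so the exponent \<open>q\<close> may be raised to
  \<open>p\<close>, which undoes the root.\<close>

lemma power_mean_bound:
  assumes "0 \<le> t" "1 \<le> q" "q \<le> p"
  shows "(1 + t powr (1 / p)) powr q \<le> 2 powr p * (1 + t)"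
proof -
  let ?u = "t powr (1 / p)"
  have "(1 + ?u) powr q \<le> (1 + ?u) powr p"
    using assms by (intro powr_mono) auto
  also have "\<dots> \<le> (2 * max 1 ?u) powr p"
    using p_gt_1 by (intro powr_mono2) auto
  also have "\<dots> = 2 powr p * max 1 ?u powr p"
    by (simp add: powr_mult)
  also have "max 1 ?u powr p \<le> 1 + t"
    using assms p_gt_1 by (auto simp: max_def powr_powr)
  finally show ?thesis
    by simp
qed

text \<open>The integral of \<open>1 + r * F x\<close> over the ball is of order r^n, because
  \<open>F\<close> contributes r times r^(n - 1); the growth exponent again balances the two terms.
  Restricting to the part of the ball in \<open>\<Omega>\<close> only decreases the
  integral.\<close>

lemma ball_average_bound:
  assumes y: "growth_at y A" and A: "0 \<le> A" and q: "1 \<le> q" "q \<le> p"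
    and [measurable]: "\<Omega> \<in> sets borel"
  obtains C fy where "0 \<le> C" "(\<lambda>K. \<Sum>k\<le>K. piece k y) \<longlonglongrightarrow> fy"
    "\<And>r. \<lbrakk>0 < r; r \<le> 1\<rbrakk> \<Longrightarrow>
      set_integrable lborel (ball y r \<inter> \<Omega>) (\<lambda>x. norm (g' x - fy) powr q) \<and>
      (LINT x:(ball y r \<inter> \<Omega>)|lborel. norm (g' x - fy) powr q) \<le> C * r ^ CARD('n) * (r powr \<beta>) powr q"
proof -
  obtain C fy where C: "0 \<le> C" and lim: "(\<lambda>K. \<Sum>k\<le>K. piece k y) \<longlonglongrightarrow> fy"
    and osc: "\<And>r. \<lbrakk>0 < r; r \<le> 1\<rbrakk> \<Longrightarrow>
      AE x in lborel. x \<in> ball y r \<longrightarrow> norm (g' x - fy) \<le> C * r powr \<beta> * (1 + (r * F x) powr (1 / p))"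
    by (rule oscillation_bound[OF y A]) (rule that)
  let ?V = "unit_ball_vol (CARD('n))"
  define C' where "C' = C powr q * 2 powr p * (?V + A)"
  show thesis
  proof (rule that[OF _ lim])
    show "0 \<le> C'"
      using A by (simp add: C'_def)
    fix r :: real assume r: "0 < r" "r \<le> 1"
    let ?B = "ball y r \<inter> \<Omega>"
    let ?k = "C powr q * (r powr \<beta>) powr q * 2 powr p"
    let ?w = "\<lambda>x. ?k * (indicator (ball y r) x + r * (indicator (ball y r) x * F x))"
    have FB: "integrable lborel (\<lambda>x. indicator (ball y r) x * F x)"
      using integrable_mult_indicator[OF _ F_int, of "ball y r"] by simp
    have ball_int: "integrable lborel (indicator (ball y r) :: real^'n \<Rightarrow> real)"
      using emeasure_lborel_ball_finite by (intro integrable_real_indicator) auto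
    have w: "integrable lborel ?w"
      by (intro integrable_mult_right Bochner_Integration.integrable_add FB ball_int)
    have bound: "AE x in lborel. norm (indicator ?B x *\<^sub>R norm (g' x - fy) powr q) \<le> ?w x"
      using osc[OF r]
    proof eventually_elim
      fix x assume x: "x \<in> ball y r \<longrightarrow> norm (g' x - fy) \<le> C * r powr \<beta> * (1 + (r * F x) powr (1 / p))"
      show "norm (indicator ?B x *\<^sub>R norm (g' x - fy) powr q) \<le> ?w x"
      proof (cases "x \<in> ?B")
        case True
        then have "norm (g' x - fy) powr q \<le> (C * r powr \<beta> * (1 + (r * F x) powr (1 / p))) powr q"
          using x q by (intro powr_mono2) auto
        also have "\<dots> = C powr q * (r powr \<beta>) powr q * (1 + (r * F x) powr (1 / p)) powr q"
          by (simp add: powr_mult)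
        also have "\<dots> \<le> C powr q * (r powr \<beta>) powr q * (2 powr p * (1 + r * F x))"
          using r F_nonneg q by (intro mult_left_mono power_mean_bound) auto
        finally show ?thesis
          using True by (simp add: mult.assoc)
      next
        case False
        then show ?thesis
          using r F_nonneg by (auto simp: indicator_def)
      qed
    qed
    have int: "integrable lborel (\<lambda>x. indicator ?B x *\<^sub>R norm (g' x - fy) powr q)"
      using w
    proof (rule Bochner_Integration.integrable_bound)
      show "AE x in lborel. norm (indicator ?B x *\<^sub>R norm (g' x - fy) powr q) \<le> norm (?w x)"
        using bound by eventually_elim (rule order_trans, assumption, simp)
    qed measurable
    have "(LINT x|lborel. indicator ?B x *\<^sub>R norm (g' x - fy) powr q) \<le> (LINT x|lborel. ?w x)"
    proof (rule integral_mono_AE[OF int w])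
      show "AE x in lborel. indicator ?B x *\<^sub>R norm (g' x - fy) powr q \<le> ?w x"
        using bound by eventually_elim simp
    qed
    also have "\<dots> = ?k * ((LINT x|lborel. indicator (ball y r) x) + r * (LINT x|lborel. indicator (ball y r) x * F x))"
      using FB ball_int by simp
    also have "(LINT x|lborel. indicator (ball y r) x) = ?V * r ^ CARD('n)"
      using r by (simp add: content_ball)
    also have "?k * (?V * r ^ CARD('n) + r * (LINT x|lborel. indicator (ball y r) x * F x))
        \<le> ?k * (?V * r ^ CARD('n) + r * (A * r ^ (CARD('n) - 1)))"
    proof (intro mult_left_mono add_left_mono)
      have "ennreal (LINT x|lborel. indicator (ball y r) x * F x) = (\<integral>\<^sup>+x\<in>ball y r. ennreal (F x) \<partial>lborel)"
        using F_nonneg FB by (subst nn_integral_eq_integral[symmetric])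
          (auto intro!: nn_integral_cong simp: indicator_def)
      also have "\<dots> \<le> ennreal (A * r ^ (CARD('n) - 1))"
        using y r by (simp add: growth_at_def)
      finally show "(LINT x|lborel. indicator (ball y r) x * F x) \<le> A * r ^ (CARD('n) - 1)"
        using A r by (subst (asm) ennreal_le_iff) auto
    qed (use r in auto)
    also have "r * (A * r ^ (CARD('n) - 1)) = A * r ^ CARD('n)"
      by (simp flip: power_Suc)
    also have "?k * (?V * r ^ CARD('n) + A * r ^ CARD('n)) = C' * r ^ CARD('n) * (r powr \<beta>) powr q"
      by (simp add: C'_def algebra_simps)
    finally show "set_integrable lborel ?B (\<lambda>x. norm (g' x - fy) powr q) \<and>
      (LINT x:?B|lborel. norm (g' x - fy) powr q) \<le> C' * r ^ CARD('n) * (r powr \<beta>) powr q"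
      using int by (simp add: set_integrable_def set_lebesgue_integral_def)
  qed
qed

end

text \<open>Carries the estimates from \<open>g'\<close> and \<open>lborel\<close> to
  \<open>f\<close> and Lebesgue measure; completeness of the latter makes \<open>u\<close>
  measurable on \<open>S\<close>.\<close>

lemma set_integral_lebesgue_cong_AE:
  fixes u v :: "'a::euclidean_space \<Rightarrow> real"
  assumes v: "set_integrable lborel S v" and ae: "AE x in lborel. x \<in> S \<longrightarrow> u x = v x"
  shows "set_integrable lebesgue S u" "(LINT x:S|lebesgue. u x) = (LINT x:S|lborel. v x)"
proof -
  have v_meas: "(\<lambda>x. indicator S x *\<^sub>R v x) \<in> borel_measurable lborel"
    using v by (auto simp: set_integrable_def)
  have v_leb: "integrable lebesgue (\<lambda>x. indicator S x *\<^sub>R v x)"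
    using v v_meas by (simp add: set_integrable_def integrable_completion)
  have eq: "AE x in lebesgue. indicator S x *\<^sub>R v x = indicator S x *\<^sub>R u x"
    using ae unfolding AE_lebesgue_iff by eventually_elim (auto simp: indicator_def)
  have u_meas: "(\<lambda>x. indicator S x *\<^sub>R u x) \<in> borel_measurable lebesgue"
    using v_leb eq by (intro borel_measurable_AE[OF borel_measurable_integrable])
  show "set_integrable lebesgue S u"
    unfolding set_integrable_def by (rule integrable_cong_AE_imp[OF v_leb u_meas eq])
  show "(LINT x:S|lebesgue. u x) = (LINT x:S|lborel. v x)"
    unfolding set_lebesgue_integral_def
    using integral_cong_AE[OF borel_measurable_integrable[OF v_leb] u_meas eq] integral_completion[OF v_meas] by simp
qed

lemma powr_average_bound:
  fixes r C I \<beta> \<alpha> q :: real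
  assumes "0 < r" "r \<le> 1" "0 \<le> C" "\<alpha> \<le> \<beta>" "1 \<le> q" "0 \<le> I" "I \<le> C * r ^ n * (r powr \<beta>) powr q"
  shows "(1 / r ^ n * I) powr (1 / q) \<le> C powr (1 / q) * r powr \<alpha>"
proof -
  have "1 / r ^ n * I \<le> C * (r powr \<beta>) powr q"
    using assms by (simp add: field_simps)
  then have "(1 / r ^ n * I) powr (1 / q) \<le> (C * (r powr \<beta>) powr q) powr (1 / q)"
    using assms by (intro powr_mono2) auto
  also have "\<dots> = C powr (1 / q) * r powr \<beta>"
    using assms by (simp add: powr_mult powr_powr)
  also have "\<dots> \<le> C powr (1 / q) * r powr \<alpha>"
    using assms by (intro mult_left_mono powr_mono') auto
  finally show ?thesis .
qed

text \<open>The trace is defined through an extension, so the estimate is claimed for each extension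
  \<open>g\<close>. Integrability belongs to the claim because the integral of a non-integrable
  function is 0, which would make the inequality empty.\<close>

theorem theorem2:
  fixes \<Omega> :: "(real^'n) set" and m1 m f :: "real^'n \<Rightarrow> complex" and s p \<alpha> q :: real
  assumes "littlewood_paley m1 m"
    and "open \<Omega>" "connected \<Omega>" "\<Omega> \<noteq> {}" "lipschitz_boundary \<Omega>"
    and "1 < p" "1 / p < s" "s < 1 + 1 / p"
    and "f \<in> besov_on m1 m s p \<Omega>"
    and "0 \<le> \<alpha>" "\<alpha> < s - 1 / p" "1 \<le> q" "q \<le> p"
  shows "\<forall>g. besov_extension m1 m s p \<Omega> f g \<longrightarrow>
    ae_boundary \<Omega> (\<lambda>y. \<exists>fy. lp_partial_sum m1 m g y \<longlonglongrightarrow> fy \<and>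
      (\<exists>C. \<forall>r. 0 < r \<and> r \<le> 1 \<longrightarrow>
        set_integrable lebesgue (ball y r \<inter> \<Omega>) (\<lambda>x. norm (f x - fy) powr q) \<and>
        (1 / r ^ CARD('n) * (LINT x:(ball y r \<inter> \<Omega>)|lebesgue. norm (f x - fy) powr q)) powr (1 / q)
          \<le> C * r powr \<alpha>))"
proof (intro allI impI)
  fix g assume g: "besov_extension m1 m s p \<Omega> f g"
  interpret besov_function m1 m g s p
    by unfold_locales (use assms g in \<open>auto simp: besov_extension_def\<close>)
  obtain g' F where g': "L1_plus_bounded g'" and gg': "AE x in lborel. g x = g' x"
    and cont_rep: "\<And>k. cont_rep (projection k) = conv (kernel k) g'"
    and F: "integrable lborel F" "\<And>x. 0 \<le> F x"
    and pieces: "AE x in lborel. \<forall>k. norm (conv (kernel k) g' x) \<le> \<rho> ^ k * F x powr (1 / p)"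
      "AE x in lborel. g' x = (\<Sum>k. conv (kernel k) g' x)"
    by (rule decomposition) (rule that)
  interpret besov_decomposition m1 m g s p g' F
    by unfold_locales (use g' F pieces in auto)
  let ?P = "\<lambda>y. \<exists>fy. lp_partial_sum m1 m g y \<longlonglongrightarrow> fy \<and>
      (\<exists>C. \<forall>r. 0 < r \<and> r \<le> 1 \<longrightarrow>
        set_integrable lebesgue (ball y r \<inter> \<Omega>) (\<lambda>x. norm (f x - fy) powr q) \<and>
        (1 / r ^ CARD('n) * (LINT x:(ball y r \<inter> \<Omega>)|lebesgue. norm (f x - fy) powr q)) powr (1 / q)
          \<le> C * r powr \<alpha>)"
  have fg': "AE x in lborel. x \<in> \<Omega> \<longrightarrow> f x = g' x"
  proof -
    have "AE x in lborel. x \<in> \<Omega> \<longrightarrow> f x = g x"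
      using g by (simp add: besov_extension_def AE_lebesgue_iff)
    then show ?thesis
      using gg' by eventually_elim simp
  qed
  have P: "?P y" if y: "growth_at y A" for y A
  proof -
    \<comment> \<open>The complement of the exceptional set supplies some real \<open>A\<close>,
      whereas the estimates take a nonnegative constant.\<close>
    have "growth_at y \<bar>A\<bar>"
      unfolding growth_at_def
    proof (intro allI impI)
      fix r :: real assume "0 < r"
      then have "(\<integral>\<^sup>+z\<in>ball y r. ennreal (F z) \<partial>lborel) \<le> ennreal (A * r ^ (CARD('n) - 1))"
        using y by (simp add: growth_at_def)
      also have "\<dots> \<le> ennreal (\<bar>A\<bar> * r ^ (CARD('n) - 1))"
        using \<open>0 < r\<close> by (intro ennreal_leI mult_right_mono) auto
      finally show "(\<integral>\<^sup>+z\<in>ball y r. ennreal (F z) \<partial>lborel) \<le> \<dots>" .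
    qed
    moreover have "\<Omega> \<in> sets borel"
      using assms by simp
    ultimately obtain C fy where C: "0 \<le> C" and lim: "(\<lambda>K. \<Sum>k\<le>K. piece k y) \<longlonglongrightarrow> fy"
      and avg: "\<And>r. \<lbrakk>0 < r; r \<le> 1\<rbrakk> \<Longrightarrow>
        set_integrable lborel (ball y r \<inter> \<Omega>) (\<lambda>x. norm (g' x - fy) powr q) \<and>
        (LINT x:(ball y r \<inter> \<Omega>)|lborel. norm (g' x - fy) powr q) \<le> C * r ^ CARD('n) * (r powr \<beta>) powr q"
      using ball_average_bound[of y "\<bar>A\<bar>" q \<Omega>] assms by (metis abs_ge_zero)
    show ?thesis
    proof (intro exI conjI allI impI)
      show "lp_partial_sum m1 m g y \<longlonglongrightarrow> fy"
        using lim by (simp add: lp_partial_sum_def[abs_def] cont_rep)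
      fix r :: real assume r: "0 < r \<and> r \<le> 1"
      have "AE x in lborel. x \<in> ball y r \<inter> \<Omega> \<longrightarrow> norm (f x - fy) powr q = norm (g' x - fy) powr q"
        using fg' by eventually_elim simp
      note cong = set_integral_lebesgue_cong_AE[OF _ this]
      show "set_integrable lebesgue (ball y r \<inter> \<Omega>) (\<lambda>x. norm (f x - fy) powr q)"
        using avg r by (intro cong) auto
      have "(LINT x:(ball y r \<inter> \<Omega>)|lebesgue. norm (f x - fy) powr q) \<le> C * r ^ CARD('n) * (r powr \<beta>) powr q"
        using avg r cong(2) by simp
      moreover have "0 \<le> (LINT x:(ball y r \<inter> \<Omega>)|lebesgue. norm (f x - fy) powr q)"
        unfolding set_lebesgue_integral_def by (intro integral_nonneg_AE) auto
      ultimately show "(1 / r ^ CARD('n) * (LINT x:(ball y r \<inter> \<Omega>)|lebesgue. norm (f x - fy) powr q)) powr (1 / q)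
          \<le> C powr (1 / q) * r powr \<alpha>"
        using r C assms by (intro powr_average_bound[where \<beta> = \<beta>]) (auto simp: \<beta>_def)
    qed
  qed
  have "{y \<in> frontier \<Omega>. \<not> ?P y} \<subseteq> {y. \<not> (\<exists>A. \<forall>r>0. (\<integral>\<^sup>+z\<in>ball y r. ennreal (F z) \<partial>lborel) \<le> ennreal (A * r ^ (CARD('n) - 1)))}"
    using P unfolding growth_at_def by blast
  then have "hausdorff_measure (CARD('n) - 1) {y \<in> frontier \<Omega>. \<not> ?P y} \<le> hausdorff_measure (CARD('n) - 1)
      {y. \<not> (\<exists>A. \<forall>r>0. (\<integral>\<^sup>+z\<in>ball y r. ennreal (F z) \<partial>lborel) \<le> ennreal (A * r ^ (CARD('n) - 1)))}"
    by (rule hausdorff_measure_mono)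
  also have "\<dots> = 0"
  proof (rule hausdorff_measure_exceptional)
    show "(\<integral>\<^sup>+z. ennreal (F z) \<partial>lborel) < \<infinity>"
      using nn_integral_eq_integral[OF F(1)] F(2) by simp
  qed measurable
  finally show "ae_boundary \<Omega> ?P"
    by (simp add: ae_boundary_def)
qed

end
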